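(* Let the loss $\ell$ and the data distribution $\mathbb P$ satisfy the assumptions on loss, data and compatibility stated in the context. Let $\pi_0\in\mathcal P_2(\overline\Theta)$ be omni-directional, let $(\pi_t)_{t\ge 0}$ be the Wasserstein gradient flow of $\mathcal R$ starting at $\pi_0$, and assume that the Morse-Sard condition stated in the context holds. Let $\Omega^{lim}$ be the set of all pairs $(g,V)$ for which there exist $t_n\to\infty$ such that $\delta_\pi\mathcal R(\pi_{t_n},\cdot)\to g$ and $\nabla_\theta\delta_\pi\mathcal R(\pi_{t_n},\cdot)\to V$ locally uniformly. Assume in addition that there exist a sequence of times $t_n\to\infty$ and a measure $\pi_\infty$ on $\Theta$ such that $\pi_{t_n}\to\pi_\infty$ in 2-Wasserstein distance, and that $|\Omega^{lim}|=1$. Then $f_{\pi_\infty}=f^*$ ($\overline{\mathbb P}$-almost everywhere), i.e. $\pi_\infty$ is a risk minimizing measure.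
   Context: **Network.** Let $\Theta=\{(a,w,b)\in\mathbb R\times\mathbb R^d\times\mathbb R: a^2<|w|^2+b^2\}$, with closure $\overline\Theta\subset\mathbb R^{d+2}$; write $\theta=(a,w,b)$. Let $\sigma(z)=\max\{z,0\}$, $\sigma'(z)=1_{\{z>0\}}$, $\phi(\theta;x)=a\,\sigma(w^Tx+b)$ and $\nabla_\theta\phi(\theta;x)=\big(\sigma(w^Tx+b),\,a\,\sigma'(w^Tx+b)\,x,\,a\,\sigma'(w^Tx+b)\big)$ for $x\in\mathbb R^d$. $\mathcal P_2(\overline\Theta)$ is the set of Borel probability measures on $\overline\Theta$ with finite second moment, and $f_\pi(x)=\int_{\overline\Theta}\phi(\theta;x)\,\pi(d\theta)$. **Loss.** $\ell:\mathbb R\times\mathbb R\to[0,\infty)$ is jointly continuous, continuously differentiable in the first argument with $|\partial_1\ell|\le C_\ell$ for some constant $C_\ell>0$, and $y\mapsto\ell(y,\bar y)$ is convex for every $\bar y\in\mathbb R$. **Data.** $\mathbb P$ is a Borel probability measure on $\mathbb R^d\times\mathbb R$ with $\int(|x|+|y|)\,d\mathbb P<\infty$; $\overline{\mathbb P}$ is its marginal on $\mathbb R^d$ and $\mathbb P^x$ are the conditional distributions of $y$ given $x$. The span of the functions $\phi(\theta;\cdot)$ is dense in $L^1(\overline{\mathbb P})$, and the map $S^d\to L^1(\sqrt{1+|x|^2}\cdot\overline{\mathbb P})$, $(w,b)\mapsto 1_{\{x\,:\,w^Tx+b>0\}}$, is Lipschitz continuous (here $S^d\subset\mathbb R^{d+1}$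 is the unit sphere and $h\cdot\mu$ is the measure with density $h$ with respect to $\mu$). **Compatibility.** With $L_x(\alpha)=\int_{\mathbb R}\ell(\alpha,y)\,\mathbb P^x(dy)$: $\lim_{|\alpha|\to\infty}L_x(\alpha)=\infty$ for $\overline{\mathbb P}$-a.e. $x$, and $\int\ell(0,y)\,\mathbb P(dx\otimes dy)<\infty$. Under these conditions there is a $\overline{\mathbb P}$-measurable function $f^*:\mathbb R^d\to\mathbb R$ with $f^*(x)\in\operatorname{argmin}_{\alpha\in\mathbb R} L_x(\alpha)$ for $\overline{\mathbb P}$-a.e. $x$; it is assumed that there exists a version of $f^*$ in $L^1(\overline{\mathbb P})$. **Risk and gradient flow.** $\mathcal R(\pi)=\int\ell(f_\pi(x),y)\,\mathbb P(dx\otimes dy)$; a risk minimizing measure is a minimizer of $\mathcal R$. Further, $\delta_\pi\mathcal R(\pi,\theta)=\int(\partial_1\ell)(f_\pi(x),y)\,\phi(\theta;x)\,\mathbb P(dx\otimes dy)$ and $\nabla_\theta\delta_\pi\mathcal R(\pi,\theta)=\int(\partial_1\ell)(f_\pi(x),y)\,\nabla_\theta\phi(\theta;x)\,\mathbb P(dx\otimes dy)$. The (2-)Wasserstein gradient flow $\pi_t\in\mathcal P_2(\overline\Theta)$ of $\mathcal R$ starting at $\pi_0$ is described by the continuity equation $\frac{d}{dt}\pi_t=\mathrm{div}_\theta(\pi_t\nabla_\theta\delta_\pi\mathcal R(\pi_t,\cdot))$ in the distributional sense, i.e. $\frac{d}{dt}\int_\Theta\psi\,d\pi_t=-\int_\Theta\langle\nabla\psi,\nabla_\theta\delta_\pi\mathcal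 R(\pi_t,\cdot)\rangle\,d\pi_t$ for $\psi\in C_c^\infty(\Theta)$; under the assumptions above it exists and is unique for every $\pi_0\in\mathcal P_2(\overline\Theta)$. **Omni-directional.** A probability measure is omni-directional if every (nonempty) open cone in $\Theta$ has positive measure. **Morse-Sard condition.** Whenever $t_n\to\infty$, $\delta_\pi\mathcal R(\pi_{t_n},\cdot)\to g$ and $\nabla_\theta\delta_\pi\mathcal R(\pi_{t_n},\cdot)\to V$ locally uniformly on $\overline\Theta$, the restriction of $g$ to the unit sphere $S^{d+1}=\{a^2+|w|^2+b^2=1\}$ has the property that the gradient tangent to the sphere, $\nabla^Sg(\theta)=(I-\theta\otimes\theta)V(\theta)$, does not vanish anywhere on the level set $\{g=s\}$ for Lebesgue-almost every $s$.
   Formalization: Since f* need not be unique (the loss is only convex), "f_{π∞} = f*" is read as: f_{π∞} is itself an integrable measurable selection of argmin L_x, and it equals the given f* at almost every x where the minimizer of L_x is unique. *)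

theory Defs
  imports "HOL-Probability.Probability"
begin

section \<open>Parameter space and network\<close>

text \<open>Parameters \<open>\<theta> = (a, w, b)\<close>. The norm and inner product of the product type are the
  Euclidean ones of \<open>\<real>\<^sup>d\<^sup>+\<^sup>2\<close>.\<close>

type_synonym 'd param = "real \<times> (real ^ 'd) \<times> real"

definition Theta :: "'d::finite param set" where
  "Theta = {(a, w, b). a\<^sup>2 < (norm w)\<^sup>2 + b\<^sup>2}"

definition relu :: "real \<Rightarrow> real" where
  "relu z = max z 0"

definition relu' :: "real \<Rightarrow> real" where
  "relu' z = (if z > 0 then 1 else 0)"

definition phi :: "'d::finite param \<Rightarrow> real ^ 'd \<Rightarrow> real" where
  "phi = (\<lambda>(a, w, b) x. a * relu (w \<bullet> x + b))"

definition grad_phi :: "'d::finite param \<Rightarrow> real ^ 'd \<Rightarrow> 'd param" where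
  "grad_phi = (\<lambda>(a, w, b) x.
     (relu (w \<bullet> x + b), (a * relu' (w \<bullet> x + b)) *\<^sub>R x, a * relu' (w \<bullet> x + b)))"

text \<open>Measures on a closed set \<open>A\<close> are Borel measures on the ambient space concentrated on \<open>A\<close>;
  integrals over \<open>A\<close> are then integrals over the ambient space.\<close>

definition P2 :: "'a::euclidean_space set \<Rightarrow> 'a measure set" where
  "P2 A = {\<pi>. sets \<pi> = sets borel \<and> prob_space \<pi> \<and> (AE \<theta> in \<pi>. \<theta> \<in> A) \<and>
              integrable \<pi> (\<lambda>\<theta>. (norm \<theta>)\<^sup>2)}"

definition f_net :: "'d::finite param measure \<Rightarrow> real ^ 'd \<Rightarrow> real" where
  "f_net \<pi> x = (\<integral>\<theta>. phi \<theta> x \<partial>\<pi>)"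

text \<open>\<open>0\<close> does not belong to \<^term>\<open>Theta\<close>, so cones are closed under strictly positive scaling only
  (the library predicate \<^const>\<open>cone\<close> forces \<open>0 \<in> U\<close>, which no subset of \<^term>\<open>Theta\<close> satisfies).\<close>

definition omnidirectional :: "'d::finite param measure \<Rightarrow> bool" where
  "omnidirectional \<pi> \<longleftrightarrow>
     (\<forall>U. open U \<and> U \<noteq> {} \<and> U \<subseteq> Theta \<and> (\<forall>\<theta>\<in>U. \<forall>c>0. c *\<^sub>R \<theta> \<in> U) \<longrightarrow> emeasure \<pi> U > 0)"


section \<open>Loss, data, compatibility\<close>

definition d1 :: "(real \<Rightarrow> real \<Rightarrow> real) \<Rightarrow> real \<Rightarrow> real \<Rightarrow> real" where
  "d1 l u y = deriv (\<lambda>v. l v y) u"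

definition loss_assm :: "(real \<Rightarrow> real \<Rightarrow> real) \<Rightarrow> bool" where
  "loss_assm l \<longleftrightarrow>
     (\<forall>u y. 0 \<le> l u y) \<and>
     continuous_on UNIV (\<lambda>(u, y). l u y) \<and>
     (\<forall>y. (\<lambda>u. l u y) C1_differentiable_on UNIV) \<and>
     (\<exists>C>0. \<forall>u y. \<bar>d1 l u y\<bar> \<le> C) \<and>
     (\<forall>y. convex_on UNIV (\<lambda>u. l u y))"

definition marg :: "((real ^ 'd::finite) \<times> real) measure \<Rightarrow> (real ^ 'd) measure" where
  "marg P = distr P borel fst"

definition data_assm :: "((real ^ 'd::finite) \<times> real) measure \<Rightarrow> bool" where
  "data_assm P \<longleftrightarrow>
     sets P = sets borel \<and> prob_space P \<and>
     integrable P (\<lambda>(x, y). norm x + \<bar>y\<bar>) \<and>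
     \<comment> \<open>density in \<open>L\<^sup>1\<close> of the span of the functions \<open>phi \<theta>\<close>\<close>
     (\<forall>h \<epsilon>. integrable (marg P) h \<and> \<epsilon> > 0 \<longrightarrow>
        (\<exists>S c. finite S \<and> S \<subseteq> closure Theta \<and>
           (\<integral>x. \<bar>h x - (\<Sum>\<theta>\<in>S. c \<theta> * phi \<theta> x)\<bar> \<partial>marg P) < \<epsilon>)) \<and>
     \<comment> \<open>Lipschitz continuity of the half-space indicators in the weighted \<open>L\<^sup>1\<close> space\<close>
     (\<exists>L. \<forall>(w, b) \<in> sphere 0 1. \<forall>(w', b') \<in> sphere 0 1.
        (\<integral>x. \<bar>indicator {x. w \<bullet> x + b > 0} x - indicator {x. w' \<bullet> x + b' > 0} x\<bar>
            \<partial>density (marg P) (\<lambda>x. ennreal (sqrt (1 + (norm x)\<^sup>2))))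
        \<le> L * dist (w, b) (w', b'))"

text \<open>\<open>\<kappa> x\<close> is the conditional distribution of \<open>y\<close> given \<open>x\<close>.\<close>

definition cond_distribution ::
    "((real ^ 'd::finite) \<times> real) measure \<Rightarrow> (real ^ 'd \<Rightarrow> real measure) \<Rightarrow> bool" where
  "cond_distribution P \<kappa> \<longleftrightarrow>
     \<kappa> \<in> borel \<rightarrow>\<^sub>M prob_algebra borel \<and>
     (\<forall>A\<in>sets borel. \<forall>B\<in>sets borel.
        emeasure P (A \<times> B) = (\<integral>\<^sup>+x. emeasure (\<kappa> x) B * indicator A x \<partial>marg P))"

definition cond_loss ::
    "(real \<Rightarrow> real \<Rightarrow> real) \<Rightarrow> (real ^ 'd::finite \<Rightarrow> real measure) \<Rightarrow> real ^ 'd \<Rightarrow> real \<Rightarrow> real" where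
  "cond_loss l \<kappa> x \<alpha> = (\<integral>y. l \<alpha> y \<partial>\<kappa> x)"

definition compat_assm ::
    "(real \<Rightarrow> real \<Rightarrow> real) \<Rightarrow> ((real ^ 'd::finite) \<times> real) measure \<Rightarrow> (real ^ 'd \<Rightarrow> real measure) \<Rightarrow> bool"
  where
  "compat_assm l P \<kappa> \<longleftrightarrow>
     (AE x in marg P. filterlim (cond_loss l \<kappa> x) at_top at_infinity) \<and>
     integrable P (\<lambda>(x, y). l 0 y)"

text \<open>\<open>f\<close> is a version of \<open>f\<^sup>*\<close>: a measurable selection of minimizers of the conditional losses.
  Several versions may exist which do not agree almost everywhere.\<close>

definition optimal_predictor ::
    "(real \<Rightarrow> real \<Rightarrow> real) \<Rightarrow> ((real ^ 'd::finite) \<times> real) measure \<Rightarrow> (real ^ 'd \<Rightarrow> real measure)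
      \<Rightarrow> (real ^ 'd \<Rightarrow> real) \<Rightarrow> bool" where
  "optimal_predictor l P \<kappa> f \<longleftrightarrow>
     f \<in> borel_measurable (marg P) \<and>
     (AE x in marg P. is_arg_min (cond_loss l \<kappa> x) (\<lambda>_. True) (f x))"


section \<open>Risk and its Wasserstein gradient flow\<close>

definition risk ::
    "(real \<Rightarrow> real \<Rightarrow> real) \<Rightarrow> ((real ^ 'd::finite) \<times> real) measure \<Rightarrow> 'd param measure \<Rightarrow> real" where
  "risk l P \<pi> = (\<integral>(x, y). l (f_net \<pi> x) y \<partial>P)"

definition risk_minimizing ::
    "(real \<Rightarrow> real \<Rightarrow> real) \<Rightarrow> ((real ^ 'd::finite) \<times> real) measure \<Rightarrow> 'd param measure \<Rightarrow> bool" where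
  "risk_minimizing l P \<pi> \<longleftrightarrow> is_arg_min (risk l P) (\<lambda>\<mu>. \<mu> \<in> P2 (closure Theta)) \<pi>"

definition delta_risk ::
    "(real \<Rightarrow> real \<Rightarrow> real) \<Rightarrow> ((real ^ 'd::finite) \<times> real) measure \<Rightarrow> 'd param measure
      \<Rightarrow> 'd param \<Rightarrow> real" where
  "delta_risk l P \<pi> \<theta> = (\<integral>(x, y). d1 l (f_net \<pi> x) y * phi \<theta> x \<partial>P)"

definition grad_delta_risk ::
    "(real \<Rightarrow> real \<Rightarrow> real) \<Rightarrow> ((real ^ 'd::finite) \<times> real) measure \<Rightarrow> 'd param measure
      \<Rightarrow> 'd param \<Rightarrow> 'd param" where
  "grad_delta_risk l P \<pi> \<theta> = (\<integral>(x, y). d1 l (f_net \<pi> x) y *\<^sub>R grad_phi \<theta> x \<partial>P)"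

definition couplings :: "'a::euclidean_space measure \<Rightarrow> 'a measure \<Rightarrow> ('a \<times> 'a) measure set" where
  "couplings \<mu> \<nu> = {\<gamma>. sets \<gamma> = sets borel \<and> distr \<gamma> borel fst = \<mu> \<and> distr \<gamma> borel snd = \<nu>}"

text \<open>Only meaningful on \<^term>\<open>P2 UNIV\<close>, where the infimum is finite.\<close>

definition W2 :: "'a::euclidean_space measure \<Rightarrow> 'a measure \<Rightarrow> real" where
  "W2 \<mu> \<nu> = sqrt (enn2real (INF \<gamma>\<in>couplings \<mu> \<nu>. \<integral>\<^sup>+(p, q). ennreal ((dist p q)\<^sup>2) \<partial>\<gamma>))"

fun Ck :: "nat \<Rightarrow> ('a::euclidean_space \<Rightarrow> real) \<Rightarrow> bool" where
  "Ck 0 f \<longleftrightarrow> continuous_on UNIV f"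
| "Ck (Suc k) f \<longleftrightarrow> f differentiable_on UNIV \<and> (\<forall>v. Ck k (\<lambda>x. frechet_derivative f (at x) v))"

text \<open>Elements of \<open>C\<^sub>c\<^sup>\<infinity>(U)\<close>, extended by zero to the whole space.\<close>

definition Cc_inf :: "'a::euclidean_space set \<Rightarrow> ('a \<Rightarrow> real) set" where
  "Cc_inf U = {\<psi>. (\<forall>k. Ck k \<psi>) \<and> compact (closure {x. \<psi> x \<noteq> 0}) \<and> closure {x. \<psi> x \<noteq> 0} \<subseteq> U}"

definition grad :: "('a::euclidean_space \<Rightarrow> real) \<Rightarrow> 'a \<Rightarrow> 'a" where
  "grad \<psi> x = (\<Sum>v\<in>Basis. frechet_derivative \<psi> (at x) v *\<^sub>R v)"

text \<open>A gradient flow is a continuous curve in the Wasserstein space over the closure of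
  \<^term>\<open>Theta\<close> which solves the continuity equation in \<^term>\<open>Theta\<close> in the distributional sense.
  Only the values of \<open>\<pi>\<close> at times \<open>t \<ge> 0\<close> matter.
  The test functions do not see the boundary of \<^term>\<open>Theta\<close>; no further equation is imposed on
  the mass sitting there.\<close>

definition wasserstein_gradient_flow ::
    "(real \<Rightarrow> real \<Rightarrow> real) \<Rightarrow> ((real ^ 'd::finite) \<times> real) measure \<Rightarrow> 'd param measure
      \<Rightarrow> (real \<Rightarrow> 'd param measure) \<Rightarrow> bool" where
  "wasserstein_gradient_flow l P \<pi>0 \<pi> \<longleftrightarrow>
     \<pi> 0 = \<pi>0 \<and>
     (\<forall>t\<ge>0. \<pi> t \<in> P2 (closure Theta)) \<and>
     (\<forall>t\<ge>0. ((\<lambda>s. W2 (\<pi> s) (\<pi> t)) \<longlongrightarrow> 0) (at t within {0..})) \<and>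
     (\<forall>\<psi>\<in>Cc_inf Theta. \<forall>t>0.
        ((\<lambda>s. \<integral>\<theta>. \<psi> \<theta> \<partial>\<pi> s) has_real_derivative
           - (\<integral>\<theta>. grad \<psi> \<theta> \<bullet> grad_delta_risk l P (\<pi> t) \<theta> \<partial>\<pi> t)) (at t))"


section \<open>Limits along the flow and the Morse-Sard condition\<close>

definition loc_unif_limit ::
    "'a::euclidean_space set \<Rightarrow> (nat \<Rightarrow> 'a \<Rightarrow> 'b::metric_space) \<Rightarrow> ('a \<Rightarrow> 'b) \<Rightarrow> bool" where
  "loc_unif_limit A F G \<longleftrightarrow> (\<forall>K. compact K \<and> K \<subseteq> A \<longrightarrow> uniform_limit K F G sequentially)"

definition limit_along ::
    "(real \<Rightarrow> real \<Rightarrow> real) \<Rightarrow> ((real ^ 'd::finite) \<times> real) measure \<Rightarrow> (real \<Rightarrow> 'd param measure)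
      \<Rightarrow> (nat \<Rightarrow> real) \<Rightarrow> ('d param \<Rightarrow> real) \<Rightarrow> ('d param \<Rightarrow> 'd param) \<Rightarrow> bool" where
  "limit_along l P \<pi> t g V \<longleftrightarrow>
     filterlim t at_top sequentially \<and>
     loc_unif_limit (closure Theta) (\<lambda>n. delta_risk l P (\<pi> (t n))) g \<and>
     loc_unif_limit (closure Theta) (\<lambda>n. grad_delta_risk l P (\<pi> (t n))) V"

text \<open>The limits are functions on the closure of \<^term>\<open>Theta\<close>; without \<^const>\<open>extensional\<close> their
  arbitrary values elsewhere would make this set infinite as soon as it is nonempty.\<close>

definition Omega_lim ::
    "(real \<Rightarrow> real \<Rightarrow> real) \<Rightarrow> ((real ^ 'd::finite) \<times> real) measure \<Rightarrow> (real \<Rightarrow> 'd param measure)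
      \<Rightarrow> (('d param \<Rightarrow> real) \<times> ('d param \<Rightarrow> 'd param)) set" where
  "Omega_lim l P \<pi> =
     {(g, V). g \<in> extensional (closure Theta) \<and> V \<in> extensional (closure Theta) \<and>
              (\<exists>t. limit_along l P \<pi> t g V)}"

text \<open>\<open>(I - \<theta> \<otimes> \<theta>) V(\<theta>)\<close>\<close>

definition tangential :: "('d::finite param \<Rightarrow> 'd param) \<Rightarrow> 'd param \<Rightarrow> 'd param" where
  "tangential V \<theta> = V \<theta> - (\<theta> \<bullet> V \<theta>) *\<^sub>R \<theta>"

definition morse_sard ::
    "(real \<Rightarrow> real \<Rightarrow> real) \<Rightarrow> ((real ^ 'd::finite) \<times> real) measure \<Rightarrow> (real \<Rightarrow> 'd param measure)
      \<Rightarrow> bool" where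
  "morse_sard l P \<pi> \<longleftrightarrow>
     (\<forall>t g V. limit_along l P \<pi> t g V \<longrightarrow>
        (AE s in lborel. \<forall>\<theta> \<in> sphere 0 1 \<inter> closure Theta. g \<theta> = s \<longrightarrow> tangential V \<theta> \<noteq> 0))"

end

theory Submission
  imports Defs "HOL-Complex_Analysis.Great_Picard" "HOL-Real_Asymp.Real_Asymp"
begin

text \<open>The function \<open>g = \<delta>\<^sub>\<pi>R(\<pi>_inf, \<cdot>)\<close> and its gradient are the only limit along the flow, so by
  Arzela-Ascoli the whole flow of potentials converges to them. Suppose that \<open>g \<noteq> 0\<close>. Since \<open>g\<close> is
  \<open>2\<close>-homogeneous and odd in \<open>a\<close>, it is negative somewhere, and the Morse-Sard condition yields a regular
  level \<open>s < 0\<close> above its minimum on the sphere. The open cone \<open>{g < s |\<theta>|\<^sup>2}\<close> is then eventually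
  forward invariant under the characteristics, and inside it \<open>|\<theta>|\<^sup>2\<close> grows exponentially. As the flow
  stays omni-directional, the cone carries mass, hence the second moments diverge, which contradicts the
  Wasserstein convergence. So \<open>g = 0\<close>, and by density of the networks and convexity of the loss,
  \<open>f_net \<pi>_inf\<close> minimizes the conditional losses.

  The characteristics enter only through smooth subsolutions of the adjoint transport equation, used as test
  functions: a moving ball around a single characteristic propagates omni-directionality, and a cut-off
  of \<open>|\<theta>|\<^sup>2\<close> to the cone, built from a smooth approximation of \<open>g\<close>, yields the growth.\<close>

subsection \<open>Smooth functions\<close>

text \<open>The flow is known only as a weak solution tested on functions supported in the open set
  \<open>Theta\<close>, so transport of mass along characteristics cannot be taken for granted;
  every statement about mass has to be extracted from test functions. Three features make this
  possible. The quadratic form \<open>qf\<close> is conserved by every velocity field, so a cut-off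
  in \<open>qf\<close> keeps supports away from the boundary at no cost. The derivative of the ReLU
  jumps, but on the closure of \<open>Theta\<close> the outer weight is dominated by the inner one,
  which cancels the singular factor in the half-space estimate and makes the velocities Lipschitz
  there. The fields are homogeneous, so bounds on the sphere hold at every scale, up to the matching
  power of the norm. Test functions must be smooth, whereas the limit potential need not be; it is
  replaced by a finite sum of softplus neurons that is close to it together with its gradient.
  Uniqueness of the limit pair turns closeness along a sequence of times into closeness at all late
  times; otherwise mass might leave the cone in between.\<close>

lemma Ck_SucI:
  assumes "\<And>x. (f has_derivative f' x) (at x)" and "\<And>v. Ck k (\<lambda>x. f' x v)"
  shows "Ck (Suc k) f"
proof -
  have "frechet_derivative f (at x) = f' x" for x
    using frechet_derivative_at[OF assms(1)] by simp
  moreover have "f differentiable_on UNIV"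
    using assms(1) by (auto simp: differentiable_on_def differentiable_def)
  ultimately show ?thesis using assms(2) by simp
qed

lemma Ck_Suc_has_derivative:
  assumes "Ck (Suc k) f"
  shows "(f has_derivative frechet_derivative f (at x)) (at x)"
  using assms by (simp add: differentiable_on_def frechet_derivative_works)

lemma Ck_Suc_imp_Ck: "Ck (Suc k) f \<Longrightarrow> Ck k f"
proof (induction k arbitrary: f)
  case 0
  then show ?case by (simp add: differentiable_imp_continuous_on)
next
  case (Suc k)
  have "Ck k (\<lambda>x. frechet_derivative f (at x) v)" for v
    by (rule Suc.IH) (use Suc.prems in simp)
  then show ?case using Suc.prems by simp
qed

lemma Ck_const: "Ck k (\<lambda>x. c)"
proof (induction k arbitrary: c)
  case (Suc k)
  show ?case by (rule Ck_SucI[where f' = "\<lambda>x v. 0"]) (auto simp: Suc)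
qed simp

lemma Ck_linear:
  assumes "bounded_linear f"
  shows "Ck k f"
proof (cases k)
  case 0
  then show ?thesis using assms by (simp add: linear_continuous_on)
next
  case (Suc m)
  have "Ck (Suc m) f"
    by (rule Ck_SucI[where f' = "\<lambda>x. f"])
      (auto simp: Ck_const bounded_linear_imp_has_derivative[OF assms])
  then show ?thesis using Suc by simp
qed

lemma Ck_add: "Ck k f \<Longrightarrow> Ck k g \<Longrightarrow> Ck k (\<lambda>x. f x + g x)"
proof (induction k arbitrary: f g)
  case 0
  then show ?case by (simp add: continuous_on_add)
next
  case (Suc k)
  have "((\<lambda>x. f x + g x) has_derivative
      (\<lambda>v. frechet_derivative f (at x) v + frechet_derivative g (at x) v)) (at x)" for x
    by (rule has_derivative_add[OF Ck_Suc_has_derivative[OF Suc.prems(1)] Ck_Suc_has_derivative[OF Suc.prems(2)]])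
  moreover have "Ck k (\<lambda>x. frechet_derivative f (at x) v + frechet_derivative g (at x) v)" for v
    using Suc.prems by (intro Suc.IH) auto
  ultimately show ?case by (rule Ck_SucI)
qed

lemma Ck_mult: "Ck k f \<Longrightarrow> Ck k g \<Longrightarrow> Ck k (\<lambda>x. f x * g x)"
proof (induction k arbitrary: f g)
  case 0
  then show ?case by (simp add: continuous_on_mult)
next
  case (Suc k)
  have "((\<lambda>x. f x * g x) has_derivative
      (\<lambda>v. f x * frechet_derivative g (at x) v + frechet_derivative f (at x) v * g x)) (at x)" for x
    by (rule has_derivative_mult[OF Ck_Suc_has_derivative[OF Suc.prems(1)] Ck_Suc_has_derivative[OF Suc.prems(2)]])
  moreover have "Ck k (\<lambda>x. f x * frechet_derivative g (at x) v + frechet_derivative f (at x) v * g x)" for v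
    using Suc.prems Suc.prems[THEN Ck_Suc_imp_Ck] by (intro Ck_add Suc.IH) auto
  ultimately show ?case by (rule Ck_SucI)
qed

lemma Ck_sum: "finite A \<Longrightarrow> (\<And>i. i \<in> A \<Longrightarrow> Ck k (f i)) \<Longrightarrow> Ck k (\<lambda>x. \<Sum>i\<in>A. f i x)"
  by (induction A rule: finite_induct) (auto intro: Ck_const Ck_add)

lemma Ck_diff: "Ck k f \<Longrightarrow> Ck k g \<Longrightarrow> Ck k (\<lambda>x. f x - g x)"
  using Ck_add[of k f "\<lambda>x. (-1) * g x"] Ck_mult[OF Ck_const[of k "-1"], of g] by simp

lemma Ck_inner_self: "Ck k (\<lambda>x. x \<bullet> x)"
  by (subst euclidean_inner) (intro Ck_sum Ck_mult Ck_linear bounded_linear_inner_left finite_Basis)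

text \<open>Smoothness is witnessed by the whole sequence of derivatives, so that composition can be
  treated by a single induction ranging over all members of the sequence: the chain rule passes from
  \<open>D n\<close> to \<open>D (Suc n)\<close>.\<close>

definition smooth_real :: "(real \<Rightarrow> real) \<Rightarrow> bool" where
  "smooth_real \<phi> \<longleftrightarrow> (\<exists>D. D 0 = \<phi> \<and> (\<forall>n x. (D n has_real_derivative D (Suc n) x) (at x)))"

lemma Ck_compose:
  assumes "smooth_real \<phi>" "Ck k f"
  shows "Ck k (\<lambda>x. \<phi> (f x))"
proof -
  obtain D where D: "D 0 = \<phi>" "\<And>n x. (D n has_real_derivative D (Suc n) x) (at x)"
    using assms(1) unfolding smooth_real_def by blast
  have "Ck k (\<lambda>x. D n (f x))" for n
    using assms(2)
  proof (induction k arbitrary: n)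
    case 0
    have "continuous_on UNIV (D n)"
      by (rule DERIV_continuous_on[OF has_field_derivative_at_within[OF D(2)]])
    then show ?case using 0 continuous_on_compose2[of UNIV "D n" UNIV f] by simp
  next
    case (Suc k)
    have "((\<lambda>x. D n (f x)) has_derivative (\<lambda>v. D (Suc n) (f x) * frechet_derivative f (at x) v)) (at x)" for x
      by (rule has_derivative_compose[OF Ck_Suc_has_derivative[OF Suc.prems]])
         (use D(2)[of n "f x"] in \<open>simp add: has_field_derivative_def\<close>)
    moreover have "Ck k (\<lambda>x. D (Suc n) (f x) * frechet_derivative f (at x) v)" for v
      using Suc.prems by (intro Ck_mult Suc.IH[OF Ck_Suc_imp_Ck]) auto
    ultimately show ?case by (rule Ck_SucI)
  qed
  then show ?thesis using D(1) by blast
qed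

lemma grad_eq:
  assumes "(\<psi> has_derivative (\<lambda>v. G \<bullet> v)) (at x)"
  shows "grad \<psi> x = G"
  unfolding grad_def frechet_derivative_at[OF assms, symmetric]
  by (rule euclidean_representation)

lemma Cc_infI:
  assumes "\<And>k. Ck k \<psi>" "compact K" "K \<subseteq> U" "\<And>x. x \<notin> K \<Longrightarrow> \<psi> x = 0"
  shows "\<psi> \<in> Cc_inf U"
proof -
  have sub: "closure {x. \<psi> x \<noteq> 0} \<subseteq> K"
    using assms(2,4) by (intro closure_minimal) (auto intro: compact_imp_closed)
  then have "compact (closure {x. \<psi> x \<noteq> 0})"
    unfolding compact_closure
    using bounded_subset[OF compact_imp_bounded[OF assms(2)]] closure_subset by blast
  then show ?thesis unfolding Cc_inf_def using assms(1,3) sub by blast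
qed

section \<open>The flat function as a smooth cut-off\<close>

definition bump :: "real \<Rightarrow> real" where
  "bump x = (if x > 0 then exp (- 1 / x) else 0)"

definition bump' :: "real \<Rightarrow> real" where
  "bump' x = (if x > 0 then exp (- 1 / x) / x\<^sup>2 else 0)"

lemma poly_times_exp_minus_tendsto_0:
  fixes p :: "real poly"
  shows "((\<lambda>u. poly p u * exp (- u)) \<longlongrightarrow> 0) at_top"
proof -
  have "((\<lambda>u. \<Sum>i\<le>degree p. coeff p i * (u ^ i / exp u)) \<longlongrightarrow> (\<Sum>i\<le>degree p. coeff p i * 0)) at_top"
    by (intro tendsto_sum tendsto_mult tendsto_const tendsto_power_div_exp_0)
  then show ?thesis
    by (simp add: poly_altdef sum_distrib_right exp_minus divide_inverse mult.assoc)
qed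

text \<open>With u = 1/x, differentiating p(u) exp(-u) gives u^2 (p - p')(u) exp(-u), so this class
  of functions is closed under differentiation. At 0 the difference quotient from the right is again
  a polynomial in u times exp(-u) and tends to 0, so the extension by zero is differentiable there
  too.\<close>

lemma has_real_derivative_poly_inverse_exp:
  fixes p :: "real poly"
  defines "H \<equiv> \<lambda>(p::real poly) x. if x > 0 then poly p (1 / x) * exp (- 1 / x) else 0"
  shows "(H p has_real_derivative H ([:0, 0, 1:] * (p - pderiv p)) x) (at x)"
proof -
  consider "x > 0" | "x < 0" | "x = 0" by linarith
  then show ?thesis
  proof cases
    case 1
    have "((\<lambda>x. poly p (1 / x) * exp (- 1 / x)) has_real_derivative
        H ([:0, 0, 1:] * (p - pderiv p)) x) (at x)"
      using 1 unfolding H_def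
      by (auto intro!: derivative_eq_intros simp: field_simps power2_eq_square)
    then show ?thesis
      by (rule DERIV_cong_ev[THEN iffD1, rotated -1])
         (use 1 in \<open>auto simp: H_def intro!: eventually_mono[OF eventually_nhds_in_open[of "{0<..}"]]\<close>)
  next
    case 2
    have "((\<lambda>x. 0) has_real_derivative H ([:0, 0, 1:] * (p - pderiv p)) x) (at x)"
      using 2 unfolding H_def by auto
    then show ?thesis
      by (rule DERIV_cong_ev[THEN iffD1, rotated -1])
         (use 2 in \<open>auto simp: H_def intro!: eventually_mono[OF eventually_nhds_in_open[of "{..<0}"]]\<close>)
  next
    case 3
    have "((\<lambda>h. poly (p * [:0, 1:]) (inverse h) * exp (- inverse h)) \<longlongrightarrow> 0) (at_right 0)"
      by (rule filterlim_compose[OF poly_times_exp_minus_tendsto_0 filterlim_inverse_at_top_right])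
    then have R: "((\<lambda>h. H p h / h) \<longlongrightarrow> 0) (at_right 0)"
      by (rule Lim_transform_eventually)
         (auto simp: H_def eventually_at_filter divide_simps)
    have L: "((\<lambda>h. H p h / h) \<longlongrightarrow> 0) (at_left 0)"
      by (rule Lim_transform_eventually[OF tendsto_const])
         (auto simp: H_def eventually_at_filter)
    have "((\<lambda>h. H p h / h) \<longlongrightarrow> 0) (at 0)"
      using L R by (simp add: filterlim_split_at)
    then show ?thesis using 3 by (simp add: has_field_derivative_iff H_def)
  qed
qed

lemma smooth_real_bump: "smooth_real bump"
proof -
  define H where "H \<equiv> \<lambda>(p::real poly) x. if x > 0 then poly p (1 / x) * exp (- 1 / x) else (0::real)"
  define q where "q n = ((\<lambda>p. [:0, 0, 1:] * (p - pderiv p)) ^^ n) (1 :: real poly)" for n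
  have "H (q 0) = bump" by (auto simp: H_def q_def bump_def)
  moreover have "(H (q n) has_real_derivative H (q (Suc n)) x) (at x)" for n x
    using has_real_derivative_poly_inverse_exp[of "q n" x]
    unfolding H_def q_def funpow.simps comp_def by blast
  ultimately show ?thesis unfolding smooth_real_def by (intro exI[of _ "\<lambda>n. H (q n)"]) auto
qed

lemma bump_has_real_derivative: "(bump has_real_derivative bump' x) (at x)"
proof -
  have "(\<lambda>x. if x > 0 then poly 1 (1 / x) * exp (- 1 / x) else (0::real)) = bump"
    by (auto simp: bump_def)
  moreover have "(if x > 0 then poly ([:0, 0, 1:] * (1 - pderiv 1)) (1 / x) * exp (- 1 / x) else (0::real)) = bump' x"
    by (auto simp: bump'_def field_simps power2_eq_square)
  ultimately show ?thesis using has_real_derivative_poly_inverse_exp[of 1 x] by simp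
qed

lemma bump'_continuous: "continuous_on UNIV bump'"
proof -
  have *: "(\<lambda>x. if x > 0 then poly [:0, 0, 1:] (1 / x) * exp (- 1 / x) else (0::real)) = bump'"
    by (auto simp: bump'_def field_simps power2_eq_square)
  show ?thesis
    unfolding *[symmetric]
    by (rule DERIV_continuous_on[OF has_field_derivative_at_within[OF has_real_derivative_poly_inverse_exp[of "[:0, 0, 1:]"]]])
qed

lemma bump_nonneg: "0 \<le> bump x" and bump'_nonneg: "0 \<le> bump' x"
  and bump_pos_iff: "0 < bump x \<longleftrightarrow> 0 < x" and bump_le_1: "bump x \<le> 1"
  by (auto simp: bump_def bump'_def)

lemma bump_eq_0: "x \<le> 0 \<Longrightarrow> bump x = 0" and bump'_eq_0: "x \<le> 0 \<Longrightarrow> bump' x = 0"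
  by (auto simp: bump_def bump'_def)

lemma bump_mono: "x \<le> y \<Longrightarrow> bump x \<le> bump y"
  by (rule DERIV_nonneg_imp_nondecreasing[of x y bump]) (auto intro: bump_has_real_derivative bump'_nonneg)

section \<open>Softplus and logistic as smooth replacements of the ReLU and of its
  derivative\<close>

definition logistic :: "real \<Rightarrow> real" where
  "logistic z = 1 / (1 + exp (- z))"

definition softplus :: "real \<Rightarrow> real \<Rightarrow> real" where
  "softplus k z = ln (1 + exp (k * z)) / k"

lemma logistic_has_real_derivative:
  "((\<lambda>z. logistic (k * z)) has_real_derivative k * (logistic (k * z) * (1 - logistic (k * z)))) (at z)"
proof -
  have "1 + exp (- (k * z)) \<noteq> 0" by (metis add_pos_pos exp_gt_zero less_irrefl zero_less_one)
  then show ?thesis unfolding logistic_def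
    by (auto intro!: derivative_eq_intros simp: field_simps power2_eq_square)
qed

lemma softplus_has_real_derivative:
  assumes "k > 0"
  shows "(softplus k has_real_derivative logistic (k * z)) (at z)"
proof -
  have *: "1 + exp (k * z) > 0" by (simp add: add_pos_pos)
  have "((\<lambda>z. ln (1 + exp (k * z)) / k) has_real_derivative logistic (k * z)) (at z)"
    using assms * unfolding logistic_def
    by (auto intro!: derivative_eq_intros simp: exp_minus) (simp add: divide_simps)
  then show ?thesis unfolding softplus_def[abs_def] .
qed

text \<open>The logistic function \<sigma> satisfies \<sigma>' = \<sigma> (1 - \<sigma>), so every
  derivative of softplus is a polynomial in \<sigma>(k z). The sequence \<open>q\<close> records
  these polynomials: it starts from X and maps p to k p' (X - X^2).\<close>

lemma smooth_real_softplus: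
  assumes "k > 0"
  shows "smooth_real (softplus k)"
proof -
  define q where "q n = ((\<lambda>p. smult k (pderiv p * [:0, 1, -1:])) ^^ n) ([:0, 1:] :: real poly)" for n
  define D where "D n = (case n of 0 \<Rightarrow> softplus k | Suc m \<Rightarrow> \<lambda>z. poly (q m) (logistic (k * z)))" for n
  have "(D n has_real_derivative D (Suc n) z) (at z)" for n z
  proof (cases n)
    case 0
    then show ?thesis using softplus_has_real_derivative[OF assms] by (simp add: D_def q_def)
  next
    case (Suc m)
    have "((\<lambda>z. poly (q m) (logistic (k * z))) has_real_derivative
        poly (pderiv (q m)) (logistic (k * z)) * (k * (logistic (k * z) * (1 - logistic (k * z))))) (at z)"
      by (rule DERIV_chain2[OF poly_DERIV logistic_has_real_derivative])
    then show ?thesis using Suc by (simp add: D_def q_def algebra_simps)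
  qed
  then show ?thesis unfolding smooth_real_def by (intro exI[of _ D]) (auto simp: D_def)
qed

lemma logistic_bounds: "0 \<le> logistic z" "logistic z \<le> 1"
  unfolding logistic_def by (auto simp: add_pos_pos)

text \<open>The error is exponentially small in \<open>k\<close>, but only at distance \<tau> from
  the jump. The excluded slab is later controlled by its mass, in
  \<open>logistic_slab_le\<close>.\<close>

lemma logistic_approx:
  assumes "k > 0" "\<tau> > 0" "\<bar>z\<bar> \<ge> \<tau>"
  shows "\<bar>logistic (k * z) - relu' z\<bar> \<le> exp (- k * \<tau>)"
proof (cases "z > 0")
  case True
  have "\<bar>logistic (k * z) - 1\<bar> = exp (- (k * z)) / (1 + exp (- (k * z)))"
    using add_pos_pos[OF zero_less_one exp_gt_zero[of "- (k * z)"]]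
    unfolding logistic_def by (simp add: divide_simps)
  also have "\<dots> \<le> exp (- (k * z))" by (simp add: divide_le_eq add_pos_pos)
  also have "\<dots> \<le> exp (- k * \<tau>)" using True assms by simp
  finally show ?thesis using True by (simp add: relu'_def)
next
  case False
  have "logistic (k * z) = exp (k * z) / (exp (k * z) + 1)"
    using add_pos_pos[OF zero_less_one exp_gt_zero[of "k * z"]]
    unfolding logistic_def by (simp add: exp_minus divide_simps)
  also have "\<dots> \<le> exp (k * z)" by (simp add: divide_le_eq add_pos_pos)
  also have "\<dots> \<le> exp (- k * \<tau>)" using False assms
    by (auto simp: abs_if) (smt (verit) mult_left_mono mult_minus_right)
  finally show ?thesis using False logistic_bounds[of "k * z"] by (simp add: relu'_def)
qed

lemma softplus_approx:
  assumes "k > 0"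
  shows "\<bar>softplus k z - relu z\<bar> \<le> 1 / k"
proof (cases "z > 0")
  case True
  have "ln (1 + exp (k * z)) = ln (exp (k * z) * (1 + exp (- (k * z))))"
    by (simp add: algebra_simps flip: exp_add)
  also have "\<dots> = k * z + ln (1 + exp (- (k * z)))"
    using add_pos_pos[OF zero_less_one exp_gt_zero[of "- (k * z)"]] by (subst ln_mult) auto
  finally have "softplus k z - z = ln (1 + exp (- (k * z))) / k"
    using assms by (simp add: softplus_def field_simps)
  moreover have "ln (1 + exp (- (k * z))) \<le> 1"
    using ln_add_one_self_le_self[of "exp (- (k * z))"] True assms
    by (smt (verit) exp_ge_zero exp_le_one_iff mult_pos_pos)
  moreover have "0 \<le> ln (1 + exp (- (k * z)))" by simp
  ultimately show ?thesis using True assms by (simp add: relu_def abs_of_nonneg divide_right_mono)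
next
  case False
  have "ln (1 + exp (k * z)) \<le> 1"
    using ln_add_one_self_le_self[of "exp (k * z)"] False assms
    by (smt (verit) exp_ge_zero exp_le_one_iff mult_nonneg_nonpos)
  moreover have "0 \<le> ln (1 + exp (k * z))" by simp
  ultimately show ?thesis using False assms
    by (simp add: softplus_def relu_def max_def abs_of_nonneg divide_right_mono)
qed

subsection \<open>Ordinary differential equations with a Lipschitz right-hand side\<close>

text \<open>Banach's fixed point theorem on the whole interval at once: measuring curves with the
  weight exp(-2 K t) makes the Picard map a contraction with factor 1/2, whatever the length of the
  interval.\<close>

lemma picard_lindelof:
  fixes W :: "real \<Rightarrow> 'a::euclidean_space \<Rightarrow> 'a"
  assumes T: "0 \<le> T" and K: "0 < K"
    and cont: "continuous_on ({0..T} \<times> UNIV) (\<lambda>(t, x). W t x)"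
    and lip: "\<And>t x y. t \<in> {0..T} \<Longrightarrow> norm (W t x - W t y) \<le> K * norm (x - y)"
  obtains \<gamma> where "\<gamma> 0 = x0"
    and "\<And>t. t \<in> {0..T} \<Longrightarrow> (\<gamma> has_vector_derivative W t (\<gamma> t)) (at t within {0..T})"
proof -
  \<comment> \<open>Retraction of the line onto the interval. Precomposing with it turns Picard
    iterates into bounded continuous functions on all of \<open>real\<close>, which form a complete
    metric type.\<close>
  define cl where "cl t = max 0 (min T t)" for t :: real
  have cl: "cl t \<in> {0..T}" "t \<in> {0..T} \<Longrightarrow> cl t = t" for t
    using T by (auto simp: cl_def)
  have cl_cont: "continuous_on UNIV cl" unfolding cl_def by (intro continuous_intros)
  \<comment> \<open>The unknown is the weighted curve u(t) = exp(-2 K t) \<gamma>(t), so the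
    ordinary supremum metric on \<open>u\<close> is the weighted metric on \<gamma>.\<close>
  define J where "J u t = exp (- 2 * K * t) *\<^sub>R (x0 + integral {0..t} (\<lambda>s. W s (exp (2 * K * s) *\<^sub>R u s)))"
    for u :: "real \<Rightarrow> 'a" and t
  have integrand: "continuous_on {0..T} (\<lambda>s. W s (exp (2 * K * s) *\<^sub>R apply_bcontfun u s))" for u
  proof -
    have "continuous_on {0..T} (\<lambda>s. (s, exp (2 * K * s) *\<^sub>R apply_bcontfun u s))"
      by (intro continuous_intros continuous_on_apply_bcontfun)
    from continuous_on_compose2[OF cont this] show ?thesis by auto
  qed
  then have int: "(\<lambda>s. W s (exp (2 * K * s) *\<^sub>R apply_bcontfun u s)) integrable_on {0..t}"
    if "t \<in> {0..T}" for u t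
    using that by (intro integrable_continuous_real continuous_on_subset[OF integrand]) auto
  have J_cont: "continuous_on {0..T} (J (apply_bcontfun u))" for u
    unfolding J_def
    by (intro continuous_intros indefinite_integral_continuous_1 int) (use T in auto)
  have J_b: "(\<lambda>t. J (apply_bcontfun u) (cl t)) \<in> bcontfun" for u
  proof -
    have "continuous_on UNIV (\<lambda>t. J (apply_bcontfun u) (cl t))"
      by (rule continuous_on_compose2[OF J_cont cl_cont]) (use cl(1) in auto)
    moreover have "bounded (range (\<lambda>t. J (apply_bcontfun u) (cl t)))"
      using compact_imp_bounded[OF compact_continuous_image[OF J_cont compact_Icc]]
      by (rule bounded_subset) (use cl(1) in auto)
    ultimately show ?thesis by (simp add: bcontfun_def)
  qed
  define \<Phi> where "\<Phi> u = Bcontfun (\<lambda>t. J (apply_bcontfun u) (cl t))" for u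
  have \<Phi>: "apply_bcontfun (\<Phi> u) t = J (apply_bcontfun u) (cl t)" for u t
    unfolding \<Phi>_def using J_b by (simp add: Bcontfun_inverse)
  have contraction: "dist (\<Phi> u) (\<Phi> v) \<le> 1 / 2 * dist u v" for u v
  proof (rule dist_bound)
    fix t
    define \<tau> where "\<tau> = cl t"
    have \<tau>: "\<tau> \<in> {0..T}" using cl(1) by (simp add: \<tau>_def)
    let ?d = "dist u v"
    have E: "((\<lambda>s. K * exp (2 * K * s) * ?d) has_integral (exp (2 * K * \<tau>) / 2 * ?d - exp (2 * K * 0) / 2 * ?d)) {0..\<tau>}"
      using \<tau> K by (intro fundamental_theorem_of_calculus)
        (auto intro!: derivative_eq_intros simp flip: has_real_derivative_iff_has_vector_derivative)
    have "norm (integral {0..\<tau>} (\<lambda>s. W s (exp (2 * K * s) *\<^sub>R u s) - W s (exp (2 * K * s) *\<^sub>R v s)))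
        \<le> integral {0..\<tau>} (\<lambda>s. K * exp (2 * K * s) * ?d)"
    proof (rule integral_norm_bound_integral)
      fix s assume s: "s \<in> {0..\<tau>}"
      have "norm (W s (exp (2 * K * s) *\<^sub>R u s) - W s (exp (2 * K * s) *\<^sub>R v s))
          \<le> K * norm (exp (2 * K * s) *\<^sub>R u s - exp (2 * K * s) *\<^sub>R v s)"
        using s \<tau> by (intro lip) auto
      also have "\<dots> = K * exp (2 * K * s) * dist (u s) (v s)"
        by (simp add: dist_norm flip: scaleR_diff_right)
      also have "\<dots> \<le> K * exp (2 * K * s) * ?d"
        using K by (intro mult_left_mono dist_bounded) auto
      finally show "norm (W s (exp (2 * K * s) *\<^sub>R u s) - W s (exp (2 * K * s) *\<^sub>R v s))
          \<le> K * exp (2 * K * s) * ?d" .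
    qed (use int[OF \<tau>] E in \<open>auto intro: integrable_diff\<close>)
    also have "\<dots> = (exp (2 * K * \<tau>) - 1) / 2 * ?d"
      using integral_unique[OF E] by (simp add: field_simps)
    also have "\<dots> \<le> exp (2 * K * \<tau>) / 2 * ?d" by (intro mult_right_mono) auto
    finally have I: "norm (integral {0..\<tau>} (\<lambda>s. W s (exp (2 * K * s) *\<^sub>R u s) - W s (exp (2 * K * s) *\<^sub>R v s)))
        \<le> exp (2 * K * \<tau>) / 2 * ?d" .
    have "dist (\<Phi> u t) (\<Phi> v t) = exp (- 2 * K * \<tau>) *
        norm (integral {0..\<tau>} (\<lambda>s. W s (exp (2 * K * s) *\<^sub>R u s) - W s (exp (2 * K * s) *\<^sub>R v s)))"
      unfolding \<Phi> J_def \<tau>_def[symmetric] dist_norm integral_diff[OF int[OF \<tau>] int[OF \<tau>]]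
      by (simp flip: scaleR_diff_right)
    also have "\<dots> \<le> exp (- 2 * K * \<tau>) * (exp (2 * K * \<tau>) / 2 * ?d)"
      using I by (intro mult_left_mono) auto
    also have "\<dots> = 1 / 2 * ?d" by (simp add: exp_minus)
    finally show "dist (\<Phi> u t) (\<Phi> v t) \<le> 1 / 2 * ?d" .
  qed
  have "\<exists>!u. \<Phi> u = u"
    by (rule banach_fix_type[of "1/2"]) (use contraction in auto)
  then obtain u where u: "\<Phi> u = u" by blast
  define \<gamma> where "\<gamma> t = x0 + integral {0..t} (\<lambda>s. W s (exp (2 * K * s) *\<^sub>R u s))" for t
  have ueq: "exp (2 * K * t) *\<^sub>R u t = \<gamma> t" if "t \<in> {0..T}" for t
  proof -
    have "u t = exp (- 2 * K * t) *\<^sub>R \<gamma> t"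
      using \<Phi>[of u t] u cl(2)[OF that] by (simp add: J_def \<gamma>_def)
    then show ?thesis by (simp add: exp_minus)
  qed
  show ?thesis
  proof (rule that[of \<gamma>])
    show "\<gamma> 0 = x0" by (simp add: \<gamma>_def)
    fix t assume t: "t \<in> {0..T}"
    have "((\<lambda>t. integral {0..t} (\<lambda>s. W s (exp (2 * K * s) *\<^sub>R u s))) has_vector_derivative
        W t (exp (2 * K * t) *\<^sub>R u t)) (at t within {0..T})"
      by (rule integral_has_vector_derivative[OF integrand t])
    then have "((\<lambda>t. x0 + integral {0..t} (\<lambda>s. W s (exp (2 * K * s) *\<^sub>R u s))) has_vector_derivative
        W t (exp (2 * K * t) *\<^sub>R u t)) (at t within {0..T})"
      by (auto intro!: derivative_eq_intros)
    then show "(\<gamma> has_vector_derivative W t (\<gamma> t)) (at t within {0..T})"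
      unfolding \<gamma>_def[abs_def, symmetric] ueq[OF t] .
  qed
qed

subsection \<open>Potentials and velocity fields of bounded densities\<close>

definition qf :: "'d::finite param \<Rightarrow> real" where
  "qf \<theta> = snd \<theta> \<bullet> snd \<theta> - (fst \<theta>)\<^sup>2"

text \<open>Appends 1 to the input, so that the bias joins the inner weights in the single vector
  \<open>snd \<theta>\<close> and a neuron depends on one inner product.\<close>

definition lift1 :: "real ^ 'd::finite \<Rightarrow> (real ^ 'd) \<times> real" where
  "lift1 x = (x, 1)"

section \<open>Identities and growth bounds for a single neuron\<close>

lemma phi_eq: "phi \<theta> x = fst \<theta> * relu (snd \<theta> \<bullet> lift1 x)"
  by (cases \<theta>) (simp add: phi_def lift1_def inner_prod_def)

lemma grad_phi_eq: "grad_phi \<theta> x = (relu (snd \<theta> \<bullet> lift1 x), (fst \<theta> * relu' (snd \<theta> \<bullet> lift1 x)) *\<^sub>R lift1 x)"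
  by (cases \<theta>) (simp add: grad_phi_def lift1_def inner_prod_def)

lemma Theta_eq: "Theta = {\<theta>. qf \<theta> > 0}"
  by (auto simp: Theta_def qf_def inner_prod_def power2_norm_eq_inner) (auto simp: power2_eq_square)

lemma continuous_on_qf: "continuous_on A qf"
  unfolding qf_def[abs_def] by (intro continuous_intros)

lemma open_Theta: "open (Theta :: 'd::finite param set)"
  unfolding Theta_eq by (intro open_Collect_less continuous_on_const continuous_on_qf)

lemma closure_Theta_qf: "\<theta> \<in> closure (Theta :: 'd::finite param set) \<Longrightarrow> 0 \<le> qf \<theta>"
proof -
  have "closure (Theta :: 'd param set) \<subseteq> {\<theta>. 0 \<le> qf \<theta>}"
    unfolding Theta_eq
    by (intro closure_minimal closed_Collect_le continuous_on_const continuous_on_qf) auto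
  then show "\<theta> \<in> closure Theta \<Longrightarrow> 0 \<le> qf \<theta>" by auto
qed

lemma qf_scaleR: "qf (c *\<^sub>R \<theta>) = c\<^sup>2 * qf \<theta>"
  by (simp add: qf_def power2_eq_square algebra_simps)

lemma Theta_scaleR: "\<theta> \<in> Theta \<Longrightarrow> c > 0 \<Longrightarrow> c *\<^sub>R \<theta> \<in> Theta"
  by (simp add: Theta_eq qf_scaleR)

lemma qf_nonneg_fst_le: "0 \<le> qf \<theta> \<Longrightarrow> \<bar>fst \<theta>\<bar> \<le> norm (snd \<theta>)"
  unfolding qf_def power2_norm_eq_inner[symmetric] by (simp add: abs_le_square_iff[symmetric])

lemma qf_le: "qf \<theta> \<le> (norm \<theta>)\<^sup>2"
  by (cases \<theta>) (auto simp: qf_def norm_prod_def simp flip: power2_norm_eq_inner)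

lemma norm_fst_param: "\<bar>fst \<theta>\<bar> \<le> norm \<theta>" for \<theta> :: "'d::finite param"
  using norm_fst_le[of "fst \<theta>" "snd \<theta>"] by simp

lemma norm_snd_param: "norm (snd \<theta>) \<le> norm \<theta>" for \<theta> :: "'d::finite param"
  using norm_snd_le[of "snd \<theta>" "fst \<theta>"] by simp

lemma norm_lift1: "norm (lift1 x) \<le> 1 + norm x"
  using norm_Pair_le[of x "1::real"] by (simp add: lift1_def)

lemma relu_lipschitz: "\<bar>relu x - relu y\<bar> \<le> \<bar>x - y\<bar>"
  and relu_abs_le: "\<bar>relu x\<bar> \<le> \<bar>x\<bar>" and relu_nonneg: "0 \<le> relu x"
  and relu'_abs_le: "\<bar>relu' x\<bar> \<le> 1"
  and relu'_mult_self: "relu' x * x = relu x"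
  by (auto simp: relu_def relu'_def)

lemma relu_mult: "0 < c \<Longrightarrow> relu (c * x) = c * relu x"
  by (auto simp: relu_def max_def mult_le_0_iff zero_le_mult_iff)

lemma relu'_mult: "0 < c \<Longrightarrow> relu' (c * x) = relu' x"
  by (auto simp: relu'_def zero_less_mult_iff)

lemma relu_measurable [measurable]: "relu \<in> borel_measurable borel"
  unfolding relu_def[abs_def] by measurable

lemma relu'_measurable [measurable]: "relu' \<in> borel_measurable borel"
  unfolding relu'_def[abs_def] by measurable

lemma lift1_measurable [measurable]: "lift1 \<in> borel_measurable borel"
  unfolding lift1_def[abs_def] by (intro borel_measurable_continuous_onI continuous_intros)

lemma phi_measurable [measurable]: "(\<lambda>x. phi \<theta> x) \<in> borel_measurable borel"
  unfolding phi_eq by measurable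

lemma grad_phi_measurable [measurable]: "(\<lambda>x. grad_phi \<theta> x) \<in> borel_measurable borel"
  unfolding grad_phi_eq by (intro borel_measurable_Pair) measurable

lemma inner_lift1_le: "\<bar>u \<bullet> lift1 x\<bar> \<le> norm u * (1 + norm x)"
  using Cauchy_Schwarz_ineq2[of u "lift1 x"] mult_left_mono[OF norm_lift1[of x] norm_ge_zero[of u]]
  by linarith

lemma phi_abs_le: "\<bar>phi \<theta> x\<bar> \<le> (norm \<theta>)\<^sup>2 * (1 + norm x)"
proof -
  have "\<bar>phi \<theta> x\<bar> \<le> norm \<theta> * (norm \<theta> * (1 + norm x))"
    unfolding phi_eq abs_mult
    by (intro mult_mono norm_fst_param order_trans[OF relu_abs_le] order_trans[OF inner_lift1_le]
        mult_right_mono norm_snd_param) auto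
  then show ?thesis by (simp add: power2_eq_square mult.assoc)
qed

lemma grad_phi_norm_le: "norm (grad_phi \<theta> x) \<le> 2 * norm \<theta> * (1 + norm x)"
proof -
  have 1: "\<bar>relu (snd \<theta> \<bullet> lift1 x)\<bar> \<le> norm \<theta> * (1 + norm x)"
    by (intro order_trans[OF relu_abs_le] order_trans[OF inner_lift1_le] mult_right_mono norm_snd_param) auto
  have "\<bar>fst \<theta>\<bar> * \<bar>relu' (snd \<theta> \<bullet> lift1 x)\<bar> * norm (lift1 x) \<le> norm \<theta> * 1 * (1 + norm x)"
    by (intro mult_mono norm_fst_param relu'_abs_le norm_lift1) auto
  then have 2: "norm ((fst \<theta> * relu' (snd \<theta> \<bullet> lift1 x)) *\<^sub>R lift1 x) \<le> norm \<theta> * (1 + norm x)"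
    by (simp add: abs_mult)
  show ?thesis unfolding grad_phi_eq
    by (rule order_trans[OF norm_Pair_le]) (use 1 2 in simp)
qed

lemma phi_diff_le: "\<bar>phi \<theta> x - phi \<theta>' x\<bar> \<le> (norm \<theta> + norm \<theta>') * norm (\<theta> - \<theta>') * (1 + norm x)"
proof -
  let ?r = "relu (snd \<theta> \<bullet> lift1 x)" and ?r' = "relu (snd \<theta>' \<bullet> lift1 x)"
  have "\<bar>?r - ?r'\<bar> \<le> norm (\<theta> - \<theta>') * (1 + norm x)"
    using relu_lipschitz[of "snd \<theta> \<bullet> lift1 x" "snd \<theta>' \<bullet> lift1 x"] inner_lift1_le[of "snd (\<theta> - \<theta>')" x]
      mult_right_mono[OF norm_snd_param[of "\<theta> - \<theta>'"], of "1 + norm x"]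
    by (simp add: inner_diff_left)
  then have 1: "\<bar>fst \<theta> * (?r - ?r')\<bar> \<le> norm \<theta> * (norm (\<theta> - \<theta>') * (1 + norm x))"
    unfolding abs_mult by (intro mult_mono norm_fst_param) auto
  have 2: "\<bar>fst (\<theta> - \<theta>') * ?r'\<bar> \<le> norm (\<theta> - \<theta>') * (norm \<theta>' * (1 + norm x))"
    unfolding abs_mult
    by (intro mult_mono norm_fst_param order_trans[OF relu_abs_le] order_trans[OF inner_lift1_le]
        mult_right_mono norm_snd_param) auto
  have "phi \<theta> x - phi \<theta>' x = fst \<theta> * (?r - ?r') + fst (\<theta> - \<theta>') * ?r'"
    by (simp add: phi_eq algebra_simps)
  then have "\<bar>phi \<theta> x - phi \<theta>' x\<bar> \<le> \<bar>fst \<theta> * (?r - ?r')\<bar> + \<bar>fst (\<theta> - \<theta>') * ?r'\<bar>"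
    by (metis abs_triangle_ineq)
  with 1 2 show ?thesis by (simp add: algebra_simps)
qed

lemma phi_diff_arg_le: "\<bar>phi \<theta> x - phi \<theta> x'\<bar> \<le> (norm \<theta>)\<^sup>2 * norm (x - x')"
proof -
  have "\<bar>relu (snd \<theta> \<bullet> lift1 x) - relu (snd \<theta> \<bullet> lift1 x')\<bar> \<le> norm \<theta> * norm (x - x')"
  proof -
    have "\<bar>snd \<theta> \<bullet> lift1 x - snd \<theta> \<bullet> lift1 x'\<bar> = \<bar>snd \<theta> \<bullet> (x - x', 0)\<bar>"
      by (simp add: lift1_def flip: inner_diff_right)
    also have "\<dots> \<le> norm (snd \<theta>) * norm (x - x')"
      using Cauchy_Schwarz_ineq2[of "snd \<theta>" "(x - x', 0)"] by (simp add: norm_prod_def)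
    also have "\<dots> \<le> norm \<theta> * norm (x - x')" by (intro mult_right_mono norm_snd_param) auto
    finally show ?thesis using relu_lipschitz order_trans by blast
  qed
  then have "\<bar>fst \<theta> * (relu (snd \<theta> \<bullet> lift1 x) - relu (snd \<theta> \<bullet> lift1 x'))\<bar> \<le> norm \<theta> * (norm \<theta> * norm (x - x'))"
    unfolding abs_mult by (intro mult_mono norm_fst_param) auto
  then show ?thesis by (simp add: phi_eq algebra_simps power2_eq_square)
qed

text \<open>Euler's identity for a function homogeneous of degree 2. It holds at the kink as well,
  because \<open>relu' x * x = relu x\<close> for every \<open>x\<close>.\<close>

lemma grad_phi_inner_self: "grad_phi \<theta> x \<bullet> \<theta> = 2 * phi \<theta> x"
proof -
  have "grad_phi \<theta> x \<bullet> \<theta> = relu (snd \<theta> \<bullet> lift1 x) * fst \<theta>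
      + fst \<theta> * (relu' (snd \<theta> \<bullet> lift1 x) * (snd \<theta> \<bullet> lift1 x))"
    by (cases \<theta>) (simp add: grad_phi_eq inner_commute algebra_simps)
  then show ?thesis unfolding relu'_mult_self by (simp add: phi_eq)
qed

text \<open>With u the vector of inner weights, (- a, u) generates the rescaling (a / c, c u), which
  leaves the neuron unchanged; hence the gradient is orthogonal to it. The same vector is half the
  gradient of \<open>qf\<close>, so every velocity field conserves \<open>qf\<close>.\<close>

lemma grad_phi_inner_conserved: "grad_phi \<theta> x \<bullet> (- fst \<theta>, snd \<theta>) = 0"
proof -
  have "grad_phi \<theta> x \<bullet> (- fst \<theta>, snd \<theta>) = - relu (snd \<theta> \<bullet> lift1 x) * fst \<theta>
      + fst \<theta> * (relu' (snd \<theta> \<bullet> lift1 x) * (snd \<theta> \<bullet> lift1 x))"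
    by (simp add: grad_phi_eq inner_commute algebra_simps)
  then show ?thesis unfolding relu'_mult_self by simp
qed

lemma phi_scaleR: "0 < c \<Longrightarrow> phi (c *\<^sub>R \<theta>) x = c\<^sup>2 * phi \<theta> x"
  by (simp add: phi_eq relu_mult power2_eq_square)

lemma grad_phi_scaleR: "0 < c \<Longrightarrow> grad_phi (c *\<^sub>R \<theta>) x = c *\<^sub>R grad_phi \<theta> x"
  by (simp add: grad_phi_eq relu_mult relu'_mult)

text \<open>Abstracts the derivative of the loss at the network output, seen as a function of the
  data point. Potentials and velocities depend on the parameter measure only through it, and
  linearly.\<close>

definition bounded_density :: "real \<Rightarrow> ((real ^ 'd::finite) \<times> real \<Rightarrow> real) \<Rightarrow> bool" where
  "bounded_density C h \<longleftrightarrow> h \<in> borel_measurable borel \<and> (\<forall>z. \<bar>h z\<bar> \<le> C)"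

lemma norm_normalize_diff_le:
  fixes u v :: "'a::real_normed_vector"
  assumes "u \<noteq> 0" "v \<noteq> 0"
  shows "norm (u /\<^sub>R norm u - v /\<^sub>R norm v) \<le> 2 * norm (u - v) / norm v"
proof -
  have "u /\<^sub>R norm u - v /\<^sub>R norm v = (u - v) /\<^sub>R norm v + (1 / norm u - 1 / norm v) *\<^sub>R u"
    by (simp add: algebra_simps divide_inverse)
  then have "norm (u /\<^sub>R norm u - v /\<^sub>R norm v) \<le> norm (u - v) / norm v + \<bar>1 / norm u - 1 / norm v\<bar> * norm u"
    by (metis (no_types, lifting) norm_triangle_ineq norm_scaleR abs_inverse abs_norm_cancel divide_inverse mult.commute)
  also have "\<bar>1 / norm u - 1 / norm v\<bar> * norm u = \<bar>norm v - norm u\<bar> / norm v"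
    using assms by (simp add: abs_if divide_simps)
  also have "\<dots> \<le> norm (u - v) / norm v"
    using norm_triangle_ineq3[of u v] by (intro divide_right_mono) (auto simp: abs_minus_commute)
  finally show ?thesis by simp
qed

text \<open>The weight sqrt(1 + |x|^2) of the data assumption is replaced by the comparable 1 + |x|,
  which bounds \<open>lift1 x\<close> and therefore all the integrands.\<close>

locale relu_data =
  fixes P :: "((real ^ 'd::finite) \<times> real) measure" and L :: real
  assumes sets_P [measurable_cong, simp]: "sets P = sets borel"
    and prob_P: "prob_space P"
    and integrable_norm: "integrable P (\<lambda>z. norm (fst z))"
    and L_nonneg: "0 \<le> L"
    and halfspace_sphere: "\<And>u v. norm u = 1 \<Longrightarrow> norm v = 1 \<Longrightarrow>
      (\<integral>z. (1 + norm (fst z)) * \<bar>relu' (u \<bullet> lift1 (fst z)) - relu' (v \<bullet> lift1 (fst z))\<bar> \<partial>P) \<le> L * norm (u - v)"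
begin

sublocale prob_space P by (rule prob_P)

lemma space_P [simp]: "space P = UNIV"
  using sets_eq_imp_space_eq[OF sets_P] by simp

lemma fst_P_measurable [measurable]: "fst \<in> P \<rightarrow>\<^sub>M borel"
  unfolding measurable_cong_sets[OF sets_P refl] borel_prod[symmetric] by measurable

lemma snd_P_measurable [measurable]: "snd \<in> P \<rightarrow>\<^sub>M borel"
  unfolding measurable_cong_sets[OF sets_P refl] borel_prod[symmetric] by measurable

definition wt :: "(real ^ 'd) \<times> real \<Rightarrow> real" where "wt z = 1 + norm (fst z)"

definition mom :: real where "mom = (\<integral>z. wt z \<partial>P)"

lemma wt_ge_1: "1 \<le> wt z" and wt_pos: "0 < wt z" and wt_nonneg: "0 \<le> wt z"
  by (auto simp: wt_def add_pos_nonneg)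

lemma integrable_wt: "integrable P wt"
  unfolding wt_def[abs_def] using integrable_norm by (intro Bochner_Integration.integrable_add) auto

lemma wt_measurable [measurable]: "wt \<in> borel_measurable P"
  using integrable_wt by (rule borel_measurable_integrable)

lemma mom_ge_1: "1 \<le> mom"
proof -
  have "(\<integral>z. 1 \<partial>P) \<le> mom"
    unfolding mom_def by (intro integral_mono integrable_wt) (auto simp: wt_ge_1)
  then show ?thesis using prob_space by simp
qed

lemma integrable_le_wt:
  fixes f :: "(real ^ 'd) \<times> real \<Rightarrow> 'b::{banach, second_countable_topology}"
  assumes [measurable]: "f \<in> borel_measurable P" and "\<And>z. norm (f z) \<le> c * wt z"
  shows "integrable P f"
  by (rule Bochner_Integration.integrable_bound[where f="\<lambda>z. c * wt z"])
     (use assms(2) in \<open>auto intro!: integrable_mult_right integrable_wt order_trans[OF _ abs_ge_self]\<close>)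

definition pot :: "((real ^ 'd) \<times> real \<Rightarrow> real) \<Rightarrow> 'd param \<Rightarrow> real" where
  "pot h \<theta> = (\<integral>z. h z * phi \<theta> (fst z) \<partial>P)"

text \<open>That this is the gradient of \<open>pot h\<close> enters the argument only through
  Euler's identity \<open>vel_inner_self\<close> and through \<open>pot_smooth_approx\<close>, where
  a smooth function and its gradient approximate the pair.\<close>

definition vel :: "((real ^ 'd) \<times> real \<Rightarrow> real) \<Rightarrow> 'd param \<Rightarrow> 'd param" where
  "vel h \<theta> = (\<integral>z. h z *\<^sub>R grad_phi \<theta> (fst z) \<partial>P)"

definition L1dist :: "((real ^ 'd) \<times> real \<Rightarrow> real) \<Rightarrow> ((real ^ 'd) \<times> real \<Rightarrow> real) \<Rightarrow> real" where
  "L1dist h h' = (\<integral>z. \<bar>h z - h' z\<bar> * wt z \<partial>P)"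

lemma bounded_densityD:
  assumes "bounded_density C h"
  shows "h \<in> borel_measurable P" "\<bar>h z\<bar> \<le> C" "0 \<le> C"
proof -
  have "\<bar>h z\<bar> \<le> C" "h \<in> borel_measurable borel" for z
    using assms unfolding bounded_density_def by blast+
  then show "h \<in> borel_measurable P" "\<bar>h z\<bar> \<le> C" "0 \<le> C"
    unfolding measurable_cong_sets[OF sets_P refl] using abs_ge_zero order_trans by blast+
qed

lemma bounded_density_mult_wt_le:
  assumes "bounded_density C h" "\<bar>f z\<bar> \<le> c * wt z" "0 \<le> c"
  shows "\<bar>h z * f z\<bar> \<le> C * c * wt z"
proof -
  have "\<bar>h z\<bar> * \<bar>f z\<bar> \<le> C * (c * wt z)"
    using assms bounded_densityD[OF assms(1)] by (intro mult_mono) auto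
  then show ?thesis by (simp add: abs_mult)
qed

lemma integrable_pot:
  assumes "bounded_density C h"
  shows "integrable P (\<lambda>z. h z * phi \<theta> (fst z))"
proof -
  note [measurable] = bounded_densityD(1)[OF assms]
  show ?thesis
    by (rule integrable_le_wt[where c="C * (norm \<theta>)\<^sup>2"])
       (auto intro!: bounded_density_mult_wt_le[OF assms, unfolded wt_def] simp: phi_abs_le wt_def)
qed

lemma norm_vel_integrand_le:
  assumes "bounded_density C h"
  shows "norm (h z *\<^sub>R grad_phi \<theta> (fst z)) \<le> C * (2 * norm \<theta>) * wt z"
  using bounded_density_mult_wt_le[OF assms, of "\<lambda>z. norm (grad_phi \<theta> (fst z))" z "2 * norm \<theta>"]
  by (simp add: wt_def grad_phi_norm_le abs_mult)

lemma integrable_vel: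
  assumes "bounded_density C h"
  shows "integrable P (\<lambda>z. h z *\<^sub>R grad_phi \<theta> (fst z))"
proof -
  note [measurable] = bounded_densityD(1)[OF assms]
  show ?thesis
    by (rule integrable_le_wt[OF _ norm_vel_integrand_le[OF assms]]) auto
qed

lemma integrable_L1dist:
  assumes "bounded_density C h" "bounded_density C h'"
  shows "integrable P (\<lambda>z. \<bar>h z - h' z\<bar> * wt z)"
proof -
  note [measurable] = bounded_densityD(1)[OF assms(1)] bounded_densityD(1)[OF assms(2)]
  show ?thesis
  proof (rule integrable_le_wt[where c="2 * C"])
    fix z
    have "\<bar>h z - h' z\<bar> \<le> 2 * C"
      using bounded_densityD(2)[OF assms(1), of z] bounded_densityD(2)[OF assms(2), of z] by linarith
    then show "norm (\<bar>h z - h' z\<bar> * wt z) \<le> 2 * C * wt z"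
      using wt_nonneg[of z] by (auto intro!: mult_right_mono simp: abs_mult)
  qed auto
qed

lemma L1dist_nonneg: "0 \<le> L1dist h h'"
  unfolding L1dist_def by (intro Bochner_Integration.integral_nonneg mult_nonneg_nonneg wt_nonneg) auto

section \<open>Homogeneity of potential and velocity, and their dependence on the density\<close>

lemma vel_inner:
  assumes "bounded_density C h"
  shows "vel h \<theta> \<bullet> v = (\<integral>z. h z * (grad_phi \<theta> (fst z) \<bullet> v) \<partial>P)"
  unfolding vel_def using integral_inner_left[OF integrable_vel[OF assms], of \<theta> v] by simp

lemma vel_inner_self:
  assumes "bounded_density C h"
  shows "vel h \<theta> \<bullet> \<theta> = 2 * pot h \<theta>"
  unfolding vel_inner[OF assms] pot_def grad_phi_inner_self
  by (subst integral_mult_right_zero[symmetric]) (simp add: mult_ac)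

lemma vel_inner_conserved:
  assumes "bounded_density C h"
  shows "vel h \<theta> \<bullet> (- fst \<theta>, snd \<theta>) = 0"
  unfolding vel_inner[OF assms] grad_phi_inner_conserved by simp

lemma pot_scaleR: "0 < c \<Longrightarrow> pot h (c *\<^sub>R \<theta>) = c\<^sup>2 * pot h \<theta>"
  unfolding pot_def
  by (subst integral_mult_right_zero[symmetric]) (simp add: phi_scaleR mult_ac)

lemma vel_scaleR: "0 < c \<Longrightarrow> vel h (c *\<^sub>R \<theta>) = c *\<^sub>R vel h \<theta>"
  unfolding vel_def
  by (subst integral_scaleR_right[symmetric]) (simp add: grad_phi_scaleR mult_ac)

lemma norm_integral_le_wt:
  fixes f :: "(real ^ 'd) \<times> real \<Rightarrow> 'b::euclidean_space"
  assumes "integrable P f" "integrable P g" and "\<And>z. norm (f z) \<le> g z"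
  shows "norm (\<integral>z. f z \<partial>P) \<le> (\<integral>z. g z \<partial>P)"
  by (rule Bochner_Integration.integral_norm_bound_integral[OF assms(1,2)]) (rule assms(3))

lemma pot_diff_le:
  assumes "bounded_density C h" "bounded_density C h'"
  shows "\<bar>pot h \<theta> - pot h' \<theta>\<bar> \<le> (norm \<theta>)\<^sup>2 * L1dist h h'"
proof -
  have "\<bar>\<integral>z. h z * phi \<theta> (fst z) - h' z * phi \<theta> (fst z) \<partial>P\<bar> \<le> (\<integral>z. (norm \<theta>)\<^sup>2 * (\<bar>h z - h' z\<bar> * wt z) \<partial>P)"
  proof (rule norm_integral_le_wt[where 'b=real, unfolded real_norm_def])
    fix z
    have "\<bar>h z - h' z\<bar> * \<bar>phi \<theta> (fst z)\<bar> \<le> \<bar>h z - h' z\<bar> * ((norm \<theta>)\<^sup>2 * wt z)"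
      by (intro mult_left_mono) (auto simp: wt_def phi_abs_le)
    then show "\<bar>h z * phi \<theta> (fst z) - h' z * phi \<theta> (fst z)\<bar> \<le> (norm \<theta>)\<^sup>2 * (\<bar>h z - h' z\<bar> * wt z)"
      by (simp add: mult_ac flip: abs_mult left_diff_distrib)
  qed (intro Bochner_Integration.integrable_diff integrable_pot[OF assms(1)] integrable_pot[OF assms(2)]
      integrable_mult_right integrable_L1dist[OF assms])+
  then show ?thesis
    unfolding pot_def L1dist_def
    using integrable_pot[OF assms(1)] integrable_pot[OF assms(2)] by simp
qed

lemma vel_diff_le:
  assumes "bounded_density C h" "bounded_density C h'"
  shows "norm (vel h \<theta> - vel h' \<theta>) \<le> 2 * norm \<theta> * L1dist h h'"
proof -
  have "norm (\<integral>z. h z *\<^sub>R grad_phi \<theta> (fst z) - h' z *\<^sub>R grad_phi \<theta> (fst z) \<partial>P)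
      \<le> (\<integral>z. 2 * norm \<theta> * (\<bar>h z - h' z\<bar> * wt z) \<partial>P)"
  proof (rule norm_integral_le_wt)
    fix z
    have "\<bar>h z - h' z\<bar> * norm (grad_phi \<theta> (fst z)) \<le> \<bar>h z - h' z\<bar> * (2 * norm \<theta> * wt z)"
      by (intro mult_left_mono) (auto simp: wt_def grad_phi_norm_le)
    then show "norm (h z *\<^sub>R grad_phi \<theta> (fst z) - h' z *\<^sub>R grad_phi \<theta> (fst z)) \<le> 2 * norm \<theta> * (\<bar>h z - h' z\<bar> * wt z)"
      by (simp add: mult_ac flip: scaleR_diff_left)
  qed (intro Bochner_Integration.integrable_diff integrable_vel[OF assms(1)] integrable_vel[OF assms(2)]
      integrable_mult_right integrable_L1dist[OF assms])+
  then show ?thesis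
    unfolding vel_def L1dist_def
    using integrable_vel[OF assms(1)] integrable_vel[OF assms(2)] by simp
qed

lemma norm_vel_le:
  assumes "bounded_density C h"
  shows "norm (vel h \<theta>) \<le> 2 * C * mom * norm \<theta>"
proof -
  have "norm (vel h \<theta>) \<le> (\<integral>z. C * (2 * norm \<theta>) * wt z \<partial>P)"
    unfolding vel_def
    by (rule norm_integral_le_wt[OF integrable_vel[OF assms] _ norm_vel_integrand_le[OF assms]])
       (intro integrable_mult_right integrable_wt)
  then show ?thesis by (simp add: mom_def mult_ac)
qed

lemma pot_lipschitz:
  assumes "bounded_density C h"
  shows "\<bar>pot h \<theta> - pot h \<theta>'\<bar> \<le> C * mom * (norm \<theta> + norm \<theta>') * norm (\<theta> - \<theta>')"
proof -
  let ?c = "(norm \<theta> + norm \<theta>') * norm (\<theta> - \<theta>')"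
  have "\<bar>\<integral>z. h z * phi \<theta> (fst z) - h z * phi \<theta>' (fst z) \<partial>P\<bar> \<le> (\<integral>z. C * ?c * wt z \<partial>P)"
  proof (rule norm_integral_le_wt[where 'b=real, unfolded real_norm_def])
    fix z
    show "\<bar>h z * phi \<theta> (fst z) - h z * phi \<theta>' (fst z)\<bar> \<le> C * ?c * wt z"
      unfolding right_diff_distrib[symmetric]
      by (rule bounded_density_mult_wt_le[OF assms]) (auto simp: wt_def phi_diff_le)
  qed (intro Bochner_Integration.integrable_diff integrable_pot[OF assms] integrable_mult_right integrable_wt)+
  then show ?thesis
    unfolding pot_def using integrable_pot[OF assms] by (simp add: mom_def mult_ac)
qed

section \<open>Half-spaces, slabs and the spatial Lipschitz bound for the velocity\<close>

definition halfspace_dist :: "(real ^ 'd) \<times> real \<Rightarrow> (real ^ 'd) \<times> real \<Rightarrow> real" where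
  "halfspace_dist u v = (\<integral>z. wt z * \<bar>relu' (u \<bullet> lift1 (fst z)) - relu' (v \<bullet> lift1 (fst z))\<bar> \<partial>P)"

lemma integrable_halfspace:
  "integrable P (\<lambda>z. wt z * \<bar>relu' (u \<bullet> lift1 (fst z)) - relu' (v \<bullet> lift1 (fst z))\<bar>)"
  by (rule integrable_le_wt[where c=1])
     (auto simp: relu'_def wt_nonneg)

lemma halfspace_dist_le_mom: "halfspace_dist u v \<le> mom"
  unfolding halfspace_dist_def mom_def
  by (intro integral_mono integrable_halfspace integrable_wt) (auto simp: relu'_def wt_nonneg)

lemma halfspace_dist_le:
  assumes "u \<noteq> 0" "v \<noteq> 0"
  shows "halfspace_dist u v \<le> 2 * L * norm (u - v) / norm v"
proof -
  have "relu' ((w /\<^sub>R norm w) \<bullet> lift1 x) = relu' (w \<bullet> lift1 x)" if "w \<noteq> 0" for w and x :: "real ^ 'd"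
    using relu'_mult[of "1 / norm w" "w \<bullet> lift1 x"] that by (simp add: divide_inverse)
  then have "halfspace_dist u v = halfspace_dist (u /\<^sub>R norm u) (v /\<^sub>R norm v)"
    using assms by (simp add: halfspace_dist_def)
  also have "\<dots> \<le> L * norm (u /\<^sub>R norm u - v /\<^sub>R norm v)"
    unfolding halfspace_dist_def wt_def using assms by (intro halfspace_sphere) auto
  also have "\<dots> \<le> L * (2 * norm (u - v) / norm v)"
    by (intro mult_left_mono norm_normalize_diff_le assms L_nonneg)
  finally show ?thesis by (simp add: mult_ac)
qed

text \<open>A thin slab lies in the symmetric difference of the two half-spaces obtained by moving
  the bias up and down; the Lipschitz condition on half-spaces then bounds its weighted mass
  linearly in \<tau>.\<close>

lemma slab_le:
  assumes "u \<noteq> 0" "0 < \<tau>" "4 * \<tau> \<le> norm u"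
  shows "(\<integral>z. wt z * indicator {z. \<bar>u \<bullet> lift1 (fst z)\<bar> \<le> \<tau>} z \<partial>P) \<le> 16 * L * \<tau> / norm u"
proof -
  \<comment> \<open>A shift by 2 \<tau> instead of \<tau> makes both signs strict on the closed
    slab, and \<open>4 * \<tau> \<le> norm u\<close> keeps both shifted vectors at least half as
    long as \<open>u\<close>.\<close>
  define v where "v = u + (0, 2 * \<tau>)"
  define v' where "v' = u - (0, 2 * \<tau>)"
  have n: "norm (0 :: real ^ 'd, r) = \<bar>r\<bar>" for r :: real by (simp add: norm_prod_def)
  have v: "norm u / 2 \<le> norm v" and v': "norm u / 2 \<le> norm v'"
    using norm_diff_ineq[of u "(0, 2 * \<tau>)"] norm_triangle_ineq2[of u "(0, 2 * \<tau>)"] n[of "2 * \<tau>"] assms(2,3)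
    unfolding v_def v'_def by linarith+
  then have nz: "v \<noteq> 0" "v' \<noteq> 0" using assms(1) by (metis half_gt_zero norm_zero not_less zero_less_norm_iff)+
  have "(\<integral>z. wt z * indicator {z. \<bar>u \<bullet> lift1 (fst z)\<bar> \<le> \<tau>} z \<partial>P) \<le> halfspace_dist v v'"
    unfolding halfspace_dist_def
  proof (intro integral_mono integrable_halfspace)
    show "integrable P (\<lambda>z. wt z * indicat_real {z. \<bar>u \<bullet> lift1 (fst z)\<bar> \<le> \<tau>} z)"
      by (rule integrable_le_wt[where c=1]) (auto simp: wt_nonneg indicator_def)
    fix z
    show "wt z * indicator {z. \<bar>u \<bullet> lift1 (fst z)\<bar> \<le> \<tau>} z
        \<le> wt z * \<bar>relu' (v \<bullet> lift1 (fst z)) - relu' (v' \<bullet> lift1 (fst z))\<bar>"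
      using assms(2) wt_nonneg
      by (auto simp: v_def v'_def indicator_def relu'_def inner_add_left inner_diff_left lift1_def inner_prod_def)
  qed
  also have "\<dots> \<le> 2 * L * norm (v - v') / norm v'" by (rule halfspace_dist_le[OF nz])
  also have "norm (v - v') = 4 * \<tau>"
    using assms(2) n[of "4 * \<tau>"] by (simp add: v_def v'_def)
  also have "2 * L * (4 * \<tau>) / norm v' \<le> 2 * L * (4 * \<tau>) / (norm u / 2)"
    using v' assms L_nonneg by (intro divide_left_mono) (auto intro!: mult_pos_pos nz simp: nz)
  finally show ?thesis by simp
qed

text \<open>Write \<theta> = (a, u) and \<theta>' = (a', u'). The jump of \<open>relu'\<close>
  contributes |a'| times a half-space distance, and passing from the sphere to u, u' costs the
  singular factor 1 / |u'|. The condition on \<open>qf\<close> says |a'| \<le> |u'|, which cancels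
  it. One point in the cone suffices, because the product difference can be arranged so that the
  jump is weighted by the outer weight of that point.\<close>

lemma vel_lipschitz:
  assumes h: "bounded_density C h" and q: "0 \<le> qf \<theta>'"
  shows "norm (vel h \<theta> - vel h \<theta>') \<le> C * (3 * mom + 2 * L) * norm (\<theta> - \<theta>')"
proof -
  let ?s = "\<lambda>z. snd \<theta> \<bullet> lift1 (fst z)" and ?s' = "\<lambda>z. snd \<theta>' \<bullet> lift1 (fst z)"
  let ?b = "\<lambda>z. 2 * norm (\<theta> - \<theta>') * wt z + \<bar>fst \<theta>'\<bar> * (wt z * \<bar>relu' (?s z) - relu' (?s' z)\<bar>)"
  have pt: "norm (grad_phi \<theta> (fst z) - grad_phi \<theta>' (fst z)) \<le> ?b z" for z
  proof -
    have l: "norm (lift1 (fst z)) \<le> wt z" by (simp add: wt_def norm_lift1)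
    have 1: "\<bar>relu (?s z) - relu (?s' z)\<bar> \<le> norm (\<theta> - \<theta>') * wt z"
      using relu_lipschitz[of "?s z" "?s' z"] inner_lift1_le[of "snd (\<theta> - \<theta>')" "fst z"]
        mult_right_mono[OF norm_snd_param[of "\<theta> - \<theta>'"] wt_nonneg[of z]]
      by (simp add: inner_diff_left wt_def)
    have "fst \<theta> * relu' (?s z) - fst \<theta>' * relu' (?s' z)
        = fst (\<theta> - \<theta>') * relu' (?s z) + fst \<theta>' * (relu' (?s z) - relu' (?s' z))"
      by (simp add: algebra_simps)
    moreover have "\<bar>fst (\<theta> - \<theta>') * relu' (?s z)\<bar> \<le> norm (\<theta> - \<theta>') * 1"
      unfolding abs_mult by (intro mult_mono norm_fst_param relu'_abs_le) auto
    ultimately have "\<bar>fst \<theta> * relu' (?s z) - fst \<theta>' * relu' (?s' z)\<bar>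
        \<le> norm (\<theta> - \<theta>') + \<bar>fst \<theta>'\<bar> * \<bar>relu' (?s z) - relu' (?s' z)\<bar>"
      using abs_triangle_ineq[of "fst (\<theta> - \<theta>') * relu' (?s z)" "fst \<theta>' * (relu' (?s z) - relu' (?s' z))"]
      by (simp add: abs_mult)
    then have "\<bar>fst \<theta> * relu' (?s z) - fst \<theta>' * relu' (?s' z)\<bar> * norm (lift1 (fst z))
        \<le> (norm (\<theta> - \<theta>') + \<bar>fst \<theta>'\<bar> * \<bar>relu' (?s z) - relu' (?s' z)\<bar>) * wt z"
      by (intro mult_mono l) auto
    then have 2: "norm ((fst \<theta> * relu' (?s z) - fst \<theta>' * relu' (?s' z)) *\<^sub>R lift1 (fst z))
        \<le> (norm (\<theta> - \<theta>') + \<bar>fst \<theta>'\<bar> * \<bar>relu' (?s z) - relu' (?s' z)\<bar>) * wt z"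
      by simp
    have "grad_phi \<theta> (fst z) - grad_phi \<theta>' (fst z) = (relu (?s z) - relu (?s' z),
        (fst \<theta> * relu' (?s z) - fst \<theta>' * relu' (?s' z)) *\<^sub>R lift1 (fst z))"
      by (simp add: grad_phi_eq scaleR_diff_left)
    then have "norm (grad_phi \<theta> (fst z) - grad_phi \<theta>' (fst z)) \<le> norm (relu (?s z) - relu (?s' z)) +
        norm ((fst \<theta> * relu' (?s z) - fst \<theta>' * relu' (?s' z)) *\<^sub>R lift1 (fst z))"
      using norm_Pair_le by metis
    with 1 2 show ?thesis by (simp add: algebra_simps)
  qed
  have int: "integrable P (\<lambda>z. C * ?b z)"
    by (intro integrable_mult_right Bochner_Integration.integrable_add integrable_wt integrable_halfspace)
  have "norm (\<integral>z. h z *\<^sub>R grad_phi \<theta> (fst z) - h z *\<^sub>R grad_phi \<theta>' (fst z) \<partial>P) \<le> (\<integral>z. C * ?b z \<partial>P)"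
  proof (rule norm_integral_le_wt[OF Bochner_Integration.integrable_diff[OF integrable_vel[OF h] integrable_vel[OF h]] int])
    fix z
    have "\<bar>h z\<bar> * norm (grad_phi \<theta> (fst z) - grad_phi \<theta>' (fst z)) \<le> C * ?b z"
      using bounded_densityD[OF h] pt by (intro mult_mono) auto
    then show "norm (h z *\<^sub>R grad_phi \<theta> (fst z) - h z *\<^sub>R grad_phi \<theta>' (fst z)) \<le> C * ?b z"
      by (simp flip: scaleR_diff_right)
  qed
  then have "norm (vel h \<theta> - vel h \<theta>') \<le> C * (\<integral>z. ?b z \<partial>P)"
    unfolding vel_def using integrable_vel[OF h] by simp
  also have "(\<integral>z. ?b z \<partial>P) = 2 * norm (\<theta> - \<theta>') * mom + \<bar>fst \<theta>'\<bar> * halfspace_dist (snd \<theta>) (snd \<theta>')"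
    unfolding mom_def halfspace_dist_def
    by (subst Bochner_Integration.integral_add) (auto intro: integrable_mult_right integrable_wt integrable_halfspace)
  finally have main: "norm (vel h \<theta> - vel h \<theta>')
      \<le> C * (2 * norm (\<theta> - \<theta>') * mom + \<bar>fst \<theta>'\<bar> * halfspace_dist (snd \<theta>) (snd \<theta>'))" .
  have "\<bar>fst \<theta>'\<bar> * halfspace_dist (snd \<theta>) (snd \<theta>') \<le> (mom + 2 * L) * norm (\<theta> - \<theta>')"
  proof -
    have a: "\<bar>fst \<theta>'\<bar> \<le> norm (snd \<theta>')" using q by (rule qf_nonneg_fst_le)
    have u: "norm (snd \<theta> - snd \<theta>') \<le> norm (\<theta> - \<theta>')" using norm_snd_param[of "\<theta> - \<theta>'"] by simp
    have hn: "0 \<le> halfspace_dist (snd \<theta>) (snd \<theta>')"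
      unfolding halfspace_dist_def
      by (intro Bochner_Integration.integral_nonneg mult_nonneg_nonneg wt_nonneg) auto
    \<comment> \<open>A zero inner weight has no direction to normalise. If only
      \<open>snd \<theta>\<close> vanishes, the half-space distance is merely bounded by
      \<open>mom\<close>, and the small factor comes from |a'| \<le> |u'| = |u - u'|.\<close>
    consider "snd \<theta>' = 0" | "snd \<theta> = 0" "snd \<theta>' \<noteq> 0" | "snd \<theta> \<noteq> 0" "snd \<theta>' \<noteq> 0" by blast
    then show ?thesis
    proof cases
      case 1
      then show ?thesis using a mom_ge_1 L_nonneg by (simp add: mult_nonneg_nonneg)
    next
      case 2
      have "\<bar>fst \<theta>'\<bar> * halfspace_dist (snd \<theta>) (snd \<theta>') \<le> norm (\<theta> - \<theta>') * mom"
        using a u 2 hn by (intro mult_mono halfspace_dist_le_mom) auto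
      also have "\<dots> \<le> (mom + 2 * L) * norm (\<theta> - \<theta>')"
        using L_nonneg by (simp add: algebra_simps)
      finally show ?thesis .
    next
      case 3
      have "\<bar>fst \<theta>'\<bar> * halfspace_dist (snd \<theta>) (snd \<theta>')
          \<le> norm (snd \<theta>') * (2 * L * norm (snd \<theta> - snd \<theta>') / norm (snd \<theta>'))"
        using a hn by (intro mult_mono halfspace_dist_le 3) auto
      also have "\<dots> = 2 * L * norm (snd \<theta> - snd \<theta>')" using 3 by simp
      also have "\<dots> \<le> 2 * L * norm (\<theta> - \<theta>')" using u L_nonneg by (intro mult_left_mono) auto
      also have "\<dots> \<le> (mom + 2 * L) * norm (\<theta> - \<theta>')"
        using mom_ge_1 by (intro mult_right_mono) auto
      finally show ?thesis .
    qed
  qed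
  then have "C * (2 * norm (\<theta> - \<theta>') * mom + \<bar>fst \<theta>'\<bar> * halfspace_dist (snd \<theta>) (snd \<theta>'))
      \<le> C * (2 * norm (\<theta> - \<theta>') * mom + (mom + 2 * L) * norm (\<theta> - \<theta>'))"
    using bounded_densityD(3)[OF h] by (intro mult_left_mono) auto
  with main show ?thesis by (simp add: algebra_simps)
qed

lemma L1dist_tendsto_0:
  assumes "\<And>n. bounded_density C (h n)" "bounded_density C h'"
    and "\<And>z. (\<lambda>n. h n z) \<longlonglongrightarrow> h' z"
  shows "(\<lambda>n. L1dist (h n) h') \<longlonglongrightarrow> 0"
proof -
  note [measurable] = bounded_densityD(1)[OF assms(1)] bounded_densityD(1)[OF assms(2)]
  have "(\<lambda>n. \<integral>z. \<bar>h n z - h' z\<bar> * wt z \<partial>P) \<longlonglongrightarrow> (\<integral>z. 0 \<partial>P)"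
  proof (rule integral_dominated_convergence[where w="\<lambda>z. 2 * C * wt z"])
    show "integrable P (\<lambda>z. 2 * C * wt z)" by (intro integrable_mult_right integrable_wt)
    show "AE z in P. (\<lambda>n. \<bar>h n z - h' z\<bar> * wt z) \<longlonglongrightarrow> 0"
    proof (rule AE_I2)
      fix z
      have "(\<lambda>n. \<bar>h n z - h' z\<bar> * wt z) \<longlonglongrightarrow> \<bar>h' z - h' z\<bar> * wt z"
        by (intro tendsto_intros assms(3))
      then show "(\<lambda>n. \<bar>h n z - h' z\<bar> * wt z) \<longlonglongrightarrow> 0" by simp
    qed
    show "AE z in P. norm (\<bar>h n z - h' z\<bar> * wt z) \<le> 2 * C * wt z" for n
    proof (rule AE_I2)
      fix z
      have "\<bar>h n z - h' z\<bar> \<le> 2 * C"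
        using bounded_densityD(2)[OF assms(1), of n z] bounded_densityD(2)[OF assms(2), of z] by linarith
      then show "norm (\<bar>h n z - h' z\<bar> * wt z) \<le> 2 * C * wt z"
        using wt_nonneg[of z] by (auto intro!: mult_right_mono simp: abs_mult)
    qed
  qed auto
  then show ?thesis by (simp add: L1dist_def)
qed

end

subsection \<open>Couplings\<close>

lemma P2_D:
  assumes "\<mu> \<in> P2 A"
  shows "sets \<mu> = sets borel" "space \<mu> = UNIV" "prob_space \<mu>" "AE \<theta> in \<mu>. \<theta> \<in> A"
    "integrable \<mu> (\<lambda>\<theta>. (norm \<theta>)\<^sup>2)"
  using assms sets_eq_imp_space_eq[of \<mu> borel] by (auto simp: P2_def)

lemma couplings_D:
  assumes "\<gamma> \<in> couplings \<mu> \<nu>"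
  shows "sets \<gamma> = sets borel" "distr \<gamma> borel fst = \<mu>" "distr \<gamma> borel snd = \<nu>"
    and "fst \<in> \<gamma> \<rightarrow>\<^sub>M borel" "snd \<in> \<gamma> \<rightarrow>\<^sub>M borel"
proof -
  show s: "sets \<gamma> = sets borel" "distr \<gamma> borel fst = \<mu>" "distr \<gamma> borel snd = \<nu>"
    using assms by (auto simp: couplings_def)
  show "fst \<in> \<gamma> \<rightarrow>\<^sub>M borel" "snd \<in> \<gamma> \<rightarrow>\<^sub>M borel"
    unfolding measurable_cong_sets[OF s(1) refl] borel_prod[symmetric] by measurable
qed

lemma nn_integral_coupling:
  assumes "\<gamma> \<in> couplings \<mu> \<nu>" and [measurable]: "f \<in> borel_measurable borel"
  shows "(\<integral>\<^sup>+z. f (fst z) \<partial>\<gamma>) = (\<integral>\<^sup>+p. f p \<partial>\<mu>)" "(\<integral>\<^sup>+z. f (snd z) \<partial>\<gamma>) = (\<integral>\<^sup>+q. f q \<partial>\<nu>)"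
  using couplings_D[OF assms(1)] nn_integral_distr[of fst \<gamma> borel f] nn_integral_distr[of snd \<gamma> borel f]
  by auto

lemma integral_coupling:
  fixes f :: "'a::euclidean_space \<Rightarrow> real"
  assumes "\<gamma> \<in> couplings \<mu> \<nu>" and [measurable]: "f \<in> borel_measurable borel"
  shows "(\<integral>z. f (fst z) \<partial>\<gamma>) = (\<integral>p. f p \<partial>\<mu>)" "(\<integral>z. f (snd z) \<partial>\<gamma>) = (\<integral>q. f q \<partial>\<nu>)"
    and "integrable \<gamma> (\<lambda>z. f (fst z)) \<longleftrightarrow> integrable \<mu> f"
    and "integrable \<gamma> (\<lambda>z. f (snd z)) \<longleftrightarrow> integrable \<nu> f"
  using couplings_D[OF assms(1)] integral_distr[of fst \<gamma> borel f] integral_distr[of snd \<gamma> borel f]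
    integrable_distr_eq[of fst \<gamma> borel f] integrable_distr_eq[of snd \<gamma> borel f]
  by auto

lemma prob_space_coupling:
  assumes "\<gamma> \<in> couplings \<mu> \<nu>" "prob_space \<mu>"
  shows "prob_space \<gamma>"
  using prob_space_distrD[OF couplings_D(4)[OF assms(1)]] couplings_D(2)[OF assms(1)] assms(2) by simp

lemma norm_sq_le_dist: "(norm q)\<^sup>2 \<le> 2 * (norm p)\<^sup>2 + 2 * (dist p q)\<^sup>2"
  for p q :: "'a::real_normed_vector"
proof -
  have "norm q \<le> norm p + dist p q"
    using norm_triangle_sub[of q p] by (simp add: dist_norm norm_minus_commute)
  then have "(norm q)\<^sup>2 \<le> (norm p + dist p q)\<^sup>2" by (intro power_mono) auto
  also have "\<dots> \<le> 2 * (norm p)\<^sup>2 + 2 * (dist p q)\<^sup>2"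
    using sum_squares_bound[of "norm p" "dist p q"] by (simp add: power2_sum)
  finally show ?thesis .
qed

lemma dist_sq_le: "(dist p q)\<^sup>2 \<le> 2 * (norm p)\<^sup>2 + 2 * (norm q)\<^sup>2"
  for p q :: "'a::real_normed_vector"
proof -
  have "(dist p q)\<^sup>2 \<le> (norm p + norm q)\<^sup>2"
    by (intro power_mono) (auto simp: dist_norm norm_triangle_ineq4)
  also have "\<dots> \<le> 2 * (norm p)\<^sup>2 + 2 * (norm q)\<^sup>2"
    using sum_squares_bound[of "norm p" "norm q"] by (simp add: power2_sum)
  finally show ?thesis .
qed

lemma pair_measure_coupling:
  assumes "sets \<mu> = sets borel" "sets \<nu> = sets borel" "prob_space \<mu>" "prob_space \<nu>"
  shows "\<mu> \<Otimes>\<^sub>M \<nu> \<in> couplings \<mu> \<nu>"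
proof -
  interpret m: prob_space \<mu> by fact
  interpret n: prob_space \<nu> by fact
  interpret pair_prob_space \<mu> \<nu> ..
  have s: "sets (\<mu> \<Otimes>\<^sub>M \<nu>) = sets borel"
    by (rule trans[OF sets_pair_measure_cong[OF assms(1,2)] arg_cong[OF borel_prod, of sets]])
  have "distr (\<mu> \<Otimes>\<^sub>M \<nu>) borel fst = distr (\<mu> \<Otimes>\<^sub>M \<nu>) \<mu> fst"
    by (intro distr_cong) (auto simp: assms)
  moreover have "distr (\<mu> \<Otimes>\<^sub>M \<nu>) borel snd = distr (\<mu> \<Otimes>\<^sub>M \<nu>) \<nu> snd"
    by (intro distr_cong) (auto simp: assms)
  moreover have "distr (\<mu> \<Otimes>\<^sub>M \<nu>) \<nu> snd = \<nu>"
  proof (rule measure_eqI)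
    fix A assume "A \<in> sets (distr (\<mu> \<Otimes>\<^sub>M \<nu>) \<nu> snd)"
    then have A: "A \<in> sets \<nu>" by simp
    have "snd -` A \<inter> space (\<mu> \<Otimes>\<^sub>M \<nu>) = space \<mu> \<times> A"
      using sets.sets_into_space[OF A] by (auto simp: space_pair_measure)
    then show "emeasure (distr (\<mu> \<Otimes>\<^sub>M \<nu>) \<nu> snd) A = emeasure \<nu> A"
      using A by (simp add: emeasure_distr n.emeasure_pair_measure_Times m.emeasure_space_1)
  qed simp
  ultimately show ?thesis
    using s n.distr_pair_fst[of \<mu>] by (simp add: couplings_def)
qed

lemma W2_coupling:
  fixes \<mu> \<nu> :: "'a::euclidean_space measure"
  assumes "\<mu> \<in> P2 A" "\<nu> \<in> P2 B" "W2 \<mu> \<nu> < r"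
  obtains \<gamma> where "\<gamma> \<in> couplings \<mu> \<nu>" "prob_space \<gamma>" "integrable \<gamma> (\<lambda>z. (dist (fst z) (snd z))\<^sup>2)"
    "(\<integral>z. (dist (fst z) (snd z))\<^sup>2 \<partial>\<gamma>) < r\<^sup>2"
proof -
  note \<mu> = P2_D[OF assms(1)] and \<nu> = P2_D[OF assms(2)]
  define c where "c \<gamma> = (\<integral>\<^sup>+z. ennreal ((dist (fst z) (snd z))\<^sup>2) \<partial>\<gamma>)" for \<gamma> :: "('a \<times> 'a) measure"
  let ?I = "INF \<gamma>\<in>couplings \<mu> \<nu>. c \<gamma>"
  have W: "W2 \<mu> \<nu> = sqrt (enn2real ?I)"
    by (simp add: W2_def c_def[abs_def] case_prod_beta')
  have meas: "(\<lambda>z. dist (fst z) (snd z)) \<in> borel_measurable (borel :: ('a \<times> 'a) measure)"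
    by (intro borel_measurable_continuous_onI continuous_intros)
  have fin: "(\<integral>\<^sup>+p. ennreal (2 * (norm p)\<^sup>2) \<partial>\<rho>) < top" if "\<rho> \<in> P2 D" for \<rho> :: "'a measure" and D
  proof -
    have "integrable \<rho> (\<lambda>p. 2 * (norm p)\<^sup>2)" by (intro integrable_mult_right P2_D(5)[OF that])
    then have "(\<integral>\<^sup>+p. ennreal (norm (2 * (norm p)\<^sup>2)) \<partial>\<rho>) < \<infinity>"
      unfolding integrable_iff_bounded by blast
    then show ?thesis by (simp only: real_norm_def abs_mult abs_numeral abs_power2 infinity_ennreal_def)
  qed
  \<comment> \<open>The product measure is a coupling of finite cost, so the infimum is finite. This
    matters because \<open>enn2real\<close> would turn an infinite infimum into 0.\<close>
  let ?g = "\<mu> \<Otimes>\<^sub>M \<nu>"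
  have g: "?g \<in> couplings \<mu> \<nu>" by (intro pair_measure_coupling \<mu> \<nu>)
  have "c ?g \<le> (\<integral>\<^sup>+z. ennreal (2 * (norm (fst z))\<^sup>2) + ennreal (2 * (norm (snd z))\<^sup>2) \<partial>?g)"
    unfolding c_def
    by (intro nn_integral_mono) (simp add: dist_sq_le ennreal_leI flip: ennreal_plus)
  also have "\<dots> = (\<integral>\<^sup>+z. ennreal (2 * (norm (fst z))\<^sup>2) \<partial>?g) + (\<integral>\<^sup>+z. ennreal (2 * (norm (snd z))\<^sup>2) \<partial>?g)"
    by (intro nn_integral_add measurable_compose[OF couplings_D(4)[OF g]] measurable_compose[OF couplings_D(5)[OF g]]) auto
  also have "\<dots> = (\<integral>\<^sup>+p. ennreal (2 * (norm p)\<^sup>2) \<partial>\<mu>) + (\<integral>\<^sup>+q. ennreal (2 * (norm q)\<^sup>2) \<partial>\<nu>)"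
    using nn_integral_coupling[OF g, of "\<lambda>p. ennreal (2 * (norm p)\<^sup>2)"] by simp
  also have "\<dots> < \<infinity>"
    using fin[OF assms(1)] fin[OF assms(2)] by (simp add: infinity_ennreal_def)
  finally have "c ?g < \<infinity>" .
  then have "?I < \<infinity>" by (rule order_le_less_trans[OF INF_lower[OF g]])
  have "enn2real ?I < r\<^sup>2"
    using power_strict_mono[OF assms(3), of 2] unfolding W by simp
  then have "?I < ennreal (r\<^sup>2)"
    using \<open>?I < \<infinity>\<close> by (cases ?I) (auto simp: ennreal_less_iff)
  then obtain \<gamma> where \<gamma>: "\<gamma> \<in> couplings \<mu> \<nu>" "c \<gamma> < ennreal (r\<^sup>2)"
    by (auto simp: INF_less_iff)
  have m: "(\<lambda>z. (dist (fst z) (snd z))\<^sup>2) \<in> borel_measurable \<gamma>"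
    using meas unfolding measurable_cong_sets[OF couplings_D(1)[OF \<gamma>(1)] refl] by measurable
  have int: "integrable \<gamma> (\<lambda>z. (dist (fst z) (snd z))\<^sup>2)"
    by (rule integrableI_bounded[OF m]) (use order_less_trans[OF \<gamma>(2) ennreal_less_top] in \<open>simp add: c_def\<close>)
  have "ennreal (\<integral>z. (dist (fst z) (snd z))\<^sup>2 \<partial>\<gamma>) = c \<gamma>"
    unfolding c_def using nn_integral_eq_integral[OF int] by simp
  then have "(\<integral>z. (dist (fst z) (snd z))\<^sup>2 \<partial>\<gamma>) < r\<^sup>2"
    using \<gamma>(2) by (simp add: ennreal_less_iff Bochner_Integration.integral_nonneg flip: \<open>ennreal _ = c \<gamma>\<close>)
  with \<gamma>(1) prob_space_coupling[OF \<gamma>(1) \<mu>(3)] int show ?thesis by (rule that)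
qed

section \<open>Second moments and integrals under couplings\<close>

definition sq_moment :: "'a::euclidean_space measure \<Rightarrow> real" where
  "sq_moment \<mu> = (\<integral>\<theta>. (norm \<theta>)\<^sup>2 \<partial>\<mu>)"

lemma sq_moment_nonneg: "0 \<le> sq_moment \<mu>"
  unfolding sq_moment_def by (intro Bochner_Integration.integral_nonneg) auto

lemma coupling_integrable_norm_sq:
  fixes \<mu> \<nu> :: "'a::euclidean_space measure"
  assumes "\<mu> \<in> P2 A" "\<nu> \<in> P2 B" "\<gamma> \<in> couplings \<mu> \<nu>"
  shows "integrable \<gamma> (\<lambda>z. (norm (fst z))\<^sup>2)" "integrable \<gamma> (\<lambda>z. (norm (snd z))\<^sup>2)"
    "(\<integral>z. (norm (fst z))\<^sup>2 \<partial>\<gamma>) = sq_moment \<mu>" "(\<integral>z. (norm (snd z))\<^sup>2 \<partial>\<gamma>) = sq_moment \<nu>"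
  using integral_coupling[OF assms(3), of "\<lambda>p. (norm p)\<^sup>2"] P2_D(5)[OF assms(1)] P2_D(5)[OF assms(2)]
  by (simp_all add: sq_moment_def)

lemma sq_moment_le:
  assumes "\<mu> \<in> P2 A" "\<nu> \<in> P2 B" "W2 \<mu> \<nu> < r"
  shows "sq_moment \<nu> \<le> 2 * sq_moment \<mu> + 2 * r\<^sup>2" "sq_moment \<mu> \<le> 2 * sq_moment \<nu> + 2 * r\<^sup>2"
proof -
  obtain \<gamma> where g: "\<gamma> \<in> couplings \<mu> \<nu>" "prob_space \<gamma>" "integrable \<gamma> (\<lambda>z. (dist (fst z) (snd z))\<^sup>2)"
    "(\<integral>z. (dist (fst z) (snd z))\<^sup>2 \<partial>\<gamma>) < r\<^sup>2" using W2_coupling[OF assms] .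
  note i = coupling_integrable_norm_sq[OF assms(1,2) g(1)]
  have "(\<integral>z. (norm (snd z))\<^sup>2 \<partial>\<gamma>) \<le> (\<integral>z. 2 * (norm (fst z))\<^sup>2 + 2 * (dist (fst z) (snd z))\<^sup>2 \<partial>\<gamma>)"
    using i g by (intro integral_mono norm_sq_le_dist) auto
  then show "sq_moment \<nu> \<le> 2 * sq_moment \<mu> + 2 * r\<^sup>2" using i g by simp
  have "(\<integral>z. (norm (fst z))\<^sup>2 \<partial>\<gamma>) \<le> (\<integral>z. 2 * (norm (snd z))\<^sup>2 + 2 * (dist (fst z) (snd z))\<^sup>2 \<partial>\<gamma>)"
    using i g norm_sq_le_dist by (intro integral_mono) (auto simp: dist_commute)
  then show "sq_moment \<mu> \<le> 2 * sq_moment \<nu> + 2 * r\<^sup>2" using i g by simp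
qed

lemma integral_diff_coupling:
  fixes f :: "'a::euclidean_space \<Rightarrow> real"
  assumes "\<gamma> \<in> couplings \<mu> \<nu>" "f \<in> borel_measurable borel" "integrable \<mu> f" "integrable \<nu> f"
    and "integrable \<gamma> g" "\<And>p q. \<bar>f p - f q\<bar> \<le> g (p, q)"
  shows "\<bar>(\<integral>p. f p \<partial>\<mu>) - (\<integral>q. f q \<partial>\<nu>)\<bar> \<le> (\<integral>z. g z \<partial>\<gamma>)"
proof -
  note c = integral_coupling[OF assms(1,2)]
  have i: "integrable \<gamma> (\<lambda>z. f (fst z))" "integrable \<gamma> (\<lambda>z. f (snd z))" using c(3,4) assms by auto
  have "norm (\<integral>z. f (fst z) - f (snd z) \<partial>\<gamma>) \<le> (\<integral>z. g z \<partial>\<gamma>)"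
    by (rule Bochner_Integration.integral_norm_bound_integral[OF _ assms(5)])
       (use i assms(6) in \<open>auto\<close>)
  then show ?thesis using i c(1,2) by simp
qed

text \<open>Pairs closer than \<open>d\<close> are handled by uniform continuity of
  \<open>f\<close>, all others by a Chebyshev bound on the transport cost. The radius depends on
  \<open>f\<close> and \<open>e\<close> but not on the measures.\<close>

lemma W2_weak_continuity:
  fixes f :: "'a::euclidean_space \<Rightarrow> real"
  assumes f: "continuous_on UNIV f" "compact K" "\<And>x. x \<notin> K \<Longrightarrow> f x = 0" and e: "0 < e"
  obtains r where "0 < r" "\<And>\<mu> \<nu>. \<mu> \<in> P2 A \<Longrightarrow> \<nu> \<in> P2 A \<Longrightarrow> W2 \<mu> \<nu> < r \<Longrightarrow>
    \<bar>(\<integral>\<theta>. f \<theta> \<partial>\<mu>) - (\<integral>\<theta>. f \<theta> \<partial>\<nu>)\<bar> \<le> e"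
proof -
  have fm: "f \<in> borel_measurable borel" using f(1) by (rule borel_measurable_continuous_onI)
  obtain R where R: "\<And>x. x \<in> K \<Longrightarrow> norm x \<le> R"
    using compact_imp_bounded[OF f(2)] unfolding bounded_iff by blast
  obtain K' where K': "compact K'" "\<And>x. x \<notin> K' \<Longrightarrow> f x = 0" "K' \<noteq> {}" 
    and un: "\<And>x y. x \<in> K \<Longrightarrow> dist x y < 1 \<Longrightarrow> y \<in> K'" "K \<subseteq> K'"
  proof (rule that)
    show "compact (cball (0::'a) (\<bar>R\<bar> + 1))" "cball (0::'a) (\<bar>R\<bar> + 1) \<noteq> {}" by auto
    show sub: "K \<subseteq> cball 0 (\<bar>R\<bar> + 1)" using R by (fastforce intro: order_trans)
    then show "\<And>x. x \<notin> cball 0 (\<bar>R\<bar> + 1) \<Longrightarrow> f x = 0" using f(3) by blast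
    show "y \<in> cball 0 (\<bar>R\<bar> + 1)" if "x \<in> K" "dist x y < 1" for x y
      using R[OF that(1)] that(2) norm_triangle_ineq4[of x "x - y"] by (auto simp: dist_norm)
  qed
  have uc: "uniformly_continuous_on K' f"
    using f(1) K'(1) by (intro compact_uniformly_continuous) (auto intro: continuous_on_subset)
  obtain d0 where d0: "0 < d0" "\<And>x y. x \<in> K' \<Longrightarrow> y \<in> K' \<Longrightarrow> dist y x < d0 \<Longrightarrow> dist (f y) (f x) < e / 2"
    using uc[unfolded uniformly_continuous_on_def, rule_format, of "e / 2"] e by auto
  define d where "d = min d0 1"
  have d: "0 < d" using d0(1) by (simp add: d_def)
  have close: "\<bar>f p - f q\<bar> \<le> e / 2" if "dist p q < d" for p q
  proof (cases "p \<in> K' \<and> q \<in> K'")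
    case True
    then show ?thesis using d0(2)[of q p] that by (auto simp: dist_norm d_def)
  next
    case False
    then have "f p = 0" "f q = 0"
      using un(1)[of p q] un(1)[of q p] that un(2) K'(2) f(3) by (auto simp: d_def dist_commute)
    then show ?thesis using e by simp
  qed
  have "bounded (f ` K')"
    using f(1) K'(1) by (intro compact_imp_bounded compact_continuous_image) (auto intro: continuous_on_subset)
  then obtain B0 where "\<And>x. x \<in> K' \<Longrightarrow> \<bar>f x\<bar> \<le> B0" by (auto simp: bounded_iff)
  then have B: "\<bar>f x\<bar> \<le> \<bar>B0\<bar>" for x using K'(2)[of x] by (cases "x \<in> K'") force+
  define B1 where "B1 = \<bar>B0\<bar> + 1"
  have B1: "0 < B1" "\<bar>f x\<bar> \<le> B1" for x using B[of x] by (auto simp: B1_def)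
  \<comment> \<open>Chosen so that the Chebyshev contribution 2 B1 r^2 / d^2 equals e / 2.\<close>
  define r where "r = d * sqrt (e / (4 * B1))"
  have r: "0 < r" using d e B1 by (simp add: r_def)
  have r2: "2 * B1 / d\<^sup>2 * r\<^sup>2 = e / 2"
    using d e B1 by (simp add: r_def power_mult_distrib)
  show ?thesis
  proof (rule that[OF r])
    fix \<mu> \<nu> :: "'a measure" assume m: "\<mu> \<in> P2 A" "\<nu> \<in> P2 A" "W2 \<mu> \<nu> < r"
    obtain \<gamma> where g: "\<gamma> \<in> couplings \<mu> \<nu>" "prob_space \<gamma>" "integrable \<gamma> (\<lambda>z. (dist (fst z) (snd z))\<^sup>2)"
      "(\<integral>z. (dist (fst z) (snd z))\<^sup>2 \<partial>\<gamma>) < r\<^sup>2" using W2_coupling[OF m] .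
    interpret g: prob_space \<gamma> by (rule g(2))
    have fin: "integrable \<rho> f" if "\<rho> \<in> P2 A" for \<rho>
    proof -
      interpret prob_space \<rho> using P2_D[OF that] by simp
      show ?thesis
        by (rule integrable_const_bound[of _ B1])
           (use B1 fm in \<open>auto simp: measurable_cong_sets[OF P2_D(1)[OF that] refl]\<close>)
    qed
    have "\<bar>(\<integral>\<theta>. f \<theta> \<partial>\<mu>) - (\<integral>\<theta>. f \<theta> \<partial>\<nu>)\<bar> \<le> (\<integral>z. e / 2 + 2 * B1 / d\<^sup>2 * (dist (fst z) (snd z))\<^sup>2 \<partial>\<gamma>)"
    proof (rule integral_diff_coupling[OF g(1) fm fin[OF m(1)] fin[OF m(2)]])
      show "integrable \<gamma> (\<lambda>z. e / 2 + 2 * B1 / d\<^sup>2 * (dist (fst z) (snd z))\<^sup>2)"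
        by (intro Bochner_Integration.integrable_add integrable_mult_right g(3)) auto
      fix p q
      show "\<bar>f p - f q\<bar> \<le> e / 2 + 2 * B1 / d\<^sup>2 * (dist (fst (p, q)) (snd (p, q)))\<^sup>2"
      proof (cases "dist p q < d")
        case True
        have "0 \<le> 2 * B1 / d\<^sup>2 * (dist p q)\<^sup>2" using B1 by simp
        then show ?thesis using close[OF True] by simp
      next
        case False
        then have "1 \<le> (dist p q)\<^sup>2 / d\<^sup>2" using d by (simp add: power_mono)
        then have "2 * B1 * 1 \<le> 2 * B1 * ((dist p q)\<^sup>2 / d\<^sup>2)" using B1(1) by (intro mult_left_mono) auto
        moreover have "\<bar>f p - f q\<bar> \<le> 2 * B1" using B1(2)[of p] B1(2)[of q] by linarith
        ultimately show ?thesis using e by simp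
      qed
    qed
    also have "\<dots> = e / 2 + 2 * B1 / d\<^sup>2 * (\<integral>z. (dist (fst z) (snd z))\<^sup>2 \<partial>\<gamma>)"
      using g(3) by (simp add: g.prob_space)
    also have "\<dots> \<le> e / 2 + 2 * B1 / d\<^sup>2 * r\<^sup>2"
      using g(4) B1(1) by (intro add_left_mono mult_left_mono) auto
    finally show "\<bar>(\<integral>\<theta>. f \<theta> \<partial>\<mu>) - (\<integral>\<theta>. f \<theta> \<partial>\<nu>)\<bar> \<le> e" using r2 by simp
  qed
qed

subsection \<open>The network function\<close>

lemma continuous_on_phi_param: "continuous_on UNIV (\<lambda>\<theta>. phi \<theta> x)"
  unfolding phi_eq relu_def by (intro continuous_intros)

lemma integrable_phi:
  assumes "\<mu> \<in> P2 A"
  shows "integrable \<mu> (\<lambda>\<theta>. phi \<theta> x)"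
proof (rule Bochner_Integration.integrable_bound)
  show "integrable \<mu> (\<lambda>\<theta>. (norm \<theta>)\<^sup>2 * (1 + norm x))"
    by (intro integrable_mult_left P2_D(5)[OF assms])
  show "(\<lambda>\<theta>. phi \<theta> x) \<in> borel_measurable \<mu>"
    unfolding measurable_cong_sets[OF P2_D(1)[OF assms] refl]
    by (rule borel_measurable_continuous_onI[OF continuous_on_phi_param])
qed (use phi_abs_le in \<open>auto intro!: AE_I2 order_trans[OF _ abs_ge_self]\<close>)

lemma f_net_lipschitz:
  assumes "\<mu> \<in> P2 A"
  shows "\<bar>f_net \<mu> x - f_net \<mu> x'\<bar> \<le> sq_moment \<mu> * norm (x - x')"
proof -
  have "norm (\<integral>\<theta>. phi \<theta> x - phi \<theta> x' \<partial>\<mu>) \<le> (\<integral>\<theta>. (norm \<theta>)\<^sup>2 * norm (x - x') \<partial>\<mu>)"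
    by (rule Bochner_Integration.integral_norm_bound_integral)
       (auto intro!: Bochner_Integration.integrable_diff integrable_phi[OF assms] integrable_mult_left P2_D(5)[OF assms]
         simp: phi_diff_arg_le)
  then show ?thesis
    using integrable_phi[OF assms] by (simp add: f_net_def sq_moment_def)
qed

lemma f_net_abs_le:
  assumes "\<mu> \<in> P2 A"
  shows "\<bar>f_net \<mu> x\<bar> \<le> sq_moment \<mu> * (1 + norm x)"
proof -
  have "norm (\<integral>\<theta>. phi \<theta> x \<partial>\<mu>) \<le> (\<integral>\<theta>. (norm \<theta>)\<^sup>2 * (1 + norm x) \<partial>\<mu>)"
    by (rule Bochner_Integration.integral_norm_bound_integral)
       (auto intro!: integrable_phi[OF assms] integrable_mult_left P2_D(5)[OF assms] simp: phi_abs_le)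
  then show ?thesis by (simp add: f_net_def sq_moment_def)
qed

lemma f_net_measurable:
  assumes "\<mu> \<in> P2 A"
  shows "f_net \<mu> \<in> borel_measurable borel"
proof (rule borel_measurable_continuous_onI)
  have "(sq_moment \<mu>)-lipschitz_on UNIV (f_net \<mu>)"
    using f_net_lipschitz[OF assms] sq_moment_nonneg by (intro lipschitz_onI) (auto simp: dist_norm)
  then show "continuous_on UNIV (f_net \<mu>)" by (rule lipschitz_on_continuous_on)
qed

text \<open>Neurons are Lipschitz only up to the factor |p| + |q|. Young's inequality with weight
  \<open>r\<close> splits the product of this factor and the distance: the second moments are
  multiplied by \<open>r\<close>, while the transport cost, which is below r^2, is divided by
  \<open>r\<close>.\<close>

lemma f_net_W2_le:
  assumes "\<mu> \<in> P2 A" "\<nu> \<in> P2 A" "W2 \<mu> \<nu> < r" "0 < r"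
  shows "\<bar>f_net \<mu> x - f_net \<nu> x\<bar> \<le> (1 + norm x) * r * (3 * sq_moment \<nu> + 2 * r\<^sup>2 + 1)"
proof -
  obtain \<gamma> where g: "\<gamma> \<in> couplings \<mu> \<nu>" "prob_space \<gamma>" "integrable \<gamma> (\<lambda>z. (dist (fst z) (snd z))\<^sup>2)"
    "(\<integral>z. (dist (fst z) (snd z))\<^sup>2 \<partial>\<gamma>) < r\<^sup>2" using W2_coupling[OF assms(1-3)] .
  note i = coupling_integrable_norm_sq[OF assms(1,2) g(1)]
  let ?g = "\<lambda>z. (1 + norm x) * (r * ((norm (fst z))\<^sup>2 + (norm (snd z))\<^sup>2) + (dist (fst z) (snd z))\<^sup>2 / r)"
  have "\<bar>f_net \<mu> x - f_net \<nu> x\<bar> \<le> (\<integral>z. ?g z \<partial>\<gamma>)"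
    unfolding f_net_def
  proof (rule integral_diff_coupling[OF g(1) borel_measurable_continuous_onI[OF continuous_on_phi_param]
        integrable_phi[OF assms(1)] integrable_phi[OF assms(2)]])
    show "integrable \<gamma> ?g"
      by (intro integrable_mult_right Bochner_Integration.integrable_add integrable_divide i g(3))
    fix p q :: "'a param"
    have "(norm p + norm q) * dist p q \<le> r * ((norm p)\<^sup>2 + (norm q)\<^sup>2) + (dist p q)\<^sup>2 / r"
    proof -
      have "2 * (r * (norm p + norm q)) * dist p q \<le> (r * (norm p + norm q))\<^sup>2 + (dist p q)\<^sup>2"
        by (rule sum_squares_bound)
      moreover have "(norm p + norm q)\<^sup>2 \<le> 2 * ((norm p)\<^sup>2 + (norm q)\<^sup>2)"
        using sum_squares_bound[of "norm p" "norm q"] by (simp add: power2_sum)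
      ultimately have "2 * (r * (norm p + norm q)) * dist p q \<le> r\<^sup>2 * (2 * ((norm p)\<^sup>2 + (norm q)\<^sup>2)) + (dist p q)\<^sup>2"
        unfolding power_mult_distrib using mult_left_mono[of _ _ "r\<^sup>2"] by fastforce
      moreover have "2 * r * (r * ((norm p)\<^sup>2 + (norm q)\<^sup>2) + (dist p q)\<^sup>2 / r)
          = r\<^sup>2 * (2 * ((norm p)\<^sup>2 + (norm q)\<^sup>2)) + 2 * (dist p q)\<^sup>2"
        using assms(4) by (simp add: power2_eq_square field_simps)
      ultimately have "2 * r * ((norm p + norm q) * dist p q) \<le> 2 * r * (r * ((norm p)\<^sup>2 + (norm q)\<^sup>2) + (dist p q)\<^sup>2 / r)"
        using zero_le_power2[of "dist p q"] by (simp only: mult_ac) linarith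
      then show ?thesis using assms(4) by (simp only: mult_le_cancel_left_pos mult_pos_pos zero_less_numeral)
    qed
    then have "(1 + norm x) * ((norm p + norm q) * dist p q) \<le> ?g (p, q)"
      by (intro mult_left_mono) auto
    then show "\<bar>phi p x - phi q x\<bar> \<le> ?g (p, q)"
      using phi_diff_le[of p x q] by (simp add: dist_norm mult_ac)
  qed
  also have "\<dots> = (1 + norm x) * (r * (sq_moment \<mu> + sq_moment \<nu>) + (\<integral>z. (dist (fst z) (snd z))\<^sup>2 \<partial>\<gamma>) / r)"
    using i(1,2) g(3) by (simp add: i(3,4)[symmetric])
  also have "\<dots> \<le> (1 + norm x) * (r * (3 * sq_moment \<nu> + 2 * r\<^sup>2) + r\<^sup>2 / r)"
  proof -
    have "r * (sq_moment \<mu> + sq_moment \<nu>) \<le> r * (3 * sq_moment \<nu> + 2 * r\<^sup>2)"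
      using sq_moment_le(2)[OF assms(1-3)] assms(4) by (intro mult_left_mono) auto
    moreover have "(\<integral>z. (dist (fst z) (snd z))\<^sup>2 \<partial>\<gamma>) / r \<le> r\<^sup>2 / r"
      using g(4) assms(4) by (intro divide_right_mono) auto
    ultimately have "r * (sq_moment \<mu> + sq_moment \<nu>) + (\<integral>z. (dist (fst z) (snd z))\<^sup>2 \<partial>\<gamma>) / r
        \<le> r * (3 * sq_moment \<nu> + 2 * r\<^sup>2) + r\<^sup>2 / r" by (rule add_mono)
    then show ?thesis by (rule mult_left_mono) simp
  qed
  also have "\<dots> = (1 + norm x) * r * (3 * sq_moment \<nu> + 2 * r\<^sup>2 + 1)"
    using assms(4) by (simp add: power2_eq_square algebra_simps)
  finally show ?thesis .
qed

lemma f_net_tendsto: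
  assumes "\<And>n. \<mu> n \<in> P2 A" "\<nu> \<in> P2 A" "(\<lambda>n. W2 (\<mu> n) \<nu>) \<longlonglongrightarrow> 0"
  shows "(\<lambda>n. f_net (\<mu> n) x) \<longlonglongrightarrow> f_net \<nu> x"
proof -
  have W0: "0 \<le> W2 (\<mu> n) \<nu>" for n by (simp add: W2_def)
  define r where "r n = W2 (\<mu> n) \<nu> + 1 / real (Suc n)" for n
  have r: "r \<longlonglongrightarrow> 0"
    using tendsto_add[OF assms(3) LIMSEQ_Suc[OF lim_1_over_n]] unfolding r_def by simp
  have rp: "0 < r n" "W2 (\<mu> n) \<nu> < r n" for n
    using W0[of n] by (auto simp: r_def intro: add_nonneg_pos)
  have "(\<lambda>n. (1 + norm x) * r n * (3 * sq_moment \<nu> + 2 * (r n)\<^sup>2 + 1)) \<longlonglongrightarrow>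
      (1 + norm x) * 0 * (3 * sq_moment \<nu> + 2 * 0\<^sup>2 + 1)"
    by (intro tendsto_mult tendsto_add tendsto_power tendsto_const r)
  then have lim: "(\<lambda>n. (1 + norm x) * r n * (3 * sq_moment \<nu> + 2 * (r n)\<^sup>2 + 1)) \<longlonglongrightarrow> 0" by simp
  have "(\<lambda>n. f_net (\<mu> n) x - f_net \<nu> x) \<longlonglongrightarrow> 0"
  proof (rule Lim_null_comparison[OF always_eventually lim], rule allI)
    fix n
    show "norm (f_net (\<mu> n) x - f_net \<nu> x) \<le> (1 + norm x) * r n * (3 * sq_moment \<nu> + 2 * (r n)\<^sup>2 + 1)"
      unfolding real_norm_def by (rule f_net_W2_le[OF assms(1,2) rp(2,1)])
  qed
  then show ?thesis by (rule LIM_zero_cancel)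
qed

subsection \<open>The risk and its gradient flow\<close>

lemma loss_has_real_derivative:
  assumes "loss_assm l"
  shows "((\<lambda>u. l u y) has_real_derivative d1 l u y) (at u)"
    and "continuous_on UNIV (\<lambda>u. d1 l u y)"
proof -
  obtain D where D: "\<And>u. ((\<lambda>u. l u y) has_real_derivative D u) (at u)" "continuous_on UNIV D"
    using assms unfolding loss_assm_def C1_differentiable_on_def
    by (metis UNIV_I has_real_derivative_iff_has_vector_derivative)
  have "D = (\<lambda>u. d1 l u y)"
    unfolding d1_def using DERIV_imp_deriv[OF D(1)] by auto
  with D show "((\<lambda>u. l u y) has_real_derivative d1 l u y) (at u)" "continuous_on UNIV (\<lambda>u. d1 l u y)"
    by auto
qed

lemma loss_measurable:
  assumes "loss_assm l"
  shows "(\<lambda>z. l (fst z) (snd z)) \<in> borel_measurable borel"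
    and "(\<lambda>z. d1 l (fst z) (snd z)) \<in> borel_measurable borel"
proof -
  have c: "continuous_on UNIV (\<lambda>z. l (fst z) (snd z))"
    using assms by (simp add: loss_assm_def case_prod_beta')
  then show "(\<lambda>z. l (fst z) (snd z)) \<in> borel_measurable borel"
    by (rule borel_measurable_continuous_onI)
  \<comment> \<open>The derivative is continuous in its first argument only, so joint measurability
    is obtained from difference quotients of the jointly continuous loss.\<close>
  show "(\<lambda>z. d1 l (fst z) (snd z)) \<in> borel_measurable borel"
  proof (rule borel_measurable_LIMSEQ_real)
    fix z :: "real \<times> real"
    have "((\<lambda>h. (l (fst z + h) (snd z) - l (fst z) (snd z)) / h) \<longlongrightarrow> d1 l (fst z) (snd z)) (at 0)"
      using loss_has_real_derivative(1)[OF assms] by (simp add: DERIV_def)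
    moreover have "filterlim (\<lambda>n. 1 / real (Suc n)) (at 0) sequentially"
      unfolding filterlim_at using LIMSEQ_Suc[OF lim_1_over_n] by simp
    ultimately show "(\<lambda>n. (l (fst z + 1 / real (Suc n)) (snd z) - l (fst z) (snd z)) / (1 / real (Suc n)))
        \<longlonglongrightarrow> d1 l (fst z) (snd z)"
      by (rule filterlim_compose)
  next
    fix n
    have "continuous_on UNIV (\<lambda>z. l (fst (fst z + 1 / real (Suc n), snd z)) (snd (fst z + 1 / real (Suc n), snd z)))"
      by (rule continuous_on_compose2[OF c]) (auto intro!: continuous_intros)
    then show "(\<lambda>z. (l (fst z + 1 / real (Suc n)) (snd z) - l (fst z) (snd z)) / (1 / real (Suc n)))
        \<in> borel_measurable borel"
      using c by (intro borel_measurable_continuous_onI continuous_intros) auto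
  qed
qed

lemma Cc_inf_grad:
  assumes "\<psi> \<in> Cc_inf U"
  shows "continuous_on UNIV (grad \<psi>)"
    and "closed K \<Longrightarrow> (\<And>x. x \<notin> K \<Longrightarrow> \<psi> x = 0) \<Longrightarrow> y \<notin> K \<Longrightarrow> grad \<psi> y = 0"
proof -
  have ck: "Ck k \<psi>" for k using assms by (simp add: Cc_inf_def)
  have "continuous_on UNIV (\<lambda>x. frechet_derivative \<psi> (at x) v)" for v
    using ck[of 1] by simp
  then show "continuous_on UNIV (grad \<psi>)"
    unfolding grad_def[abs_def] by (intro continuous_intros)
  assume K: "closed K" "\<And>x. x \<notin> K \<Longrightarrow> \<psi> x = 0" "y \<notin> K"
  have "((\<lambda>x. 0) has_derivative (\<lambda>v. 0 \<bullet> v)) (at y)" by simp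
  then have "(\<psi> has_derivative (\<lambda>v. 0 \<bullet> v)) (at y)"
    by (rule has_derivative_transform_within_open[of _ _ _ _ "- K"]) (use K in auto)
  then show "grad \<psi> y = 0" by (rule grad_eq)
qed

locale relu_risk = relu_data P L for P :: "((real ^ 'd::finite) \<times> real) measure" and L +
  fixes l :: "real \<Rightarrow> real \<Rightarrow> real" and C :: real
  assumes loss: "loss_assm l" and d1_bound: "\<And>u y. \<bar>d1 l u y\<bar> \<le> C"
begin

definition dens :: "'d param measure \<Rightarrow> (real ^ 'd) \<times> real \<Rightarrow> real" where
  "dens \<mu> z = d1 l (f_net \<mu> (fst z)) (snd z)"

lemma C_nonneg: "0 \<le> C"
  using d1_bound[of 0 0] by linarith

lemma bounded_density_dens:
  assumes "\<mu> \<in> P2 A"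
  shows "bounded_density C (dens \<mu>)"
proof -
  have [measurable]: "f_net \<mu> \<in> borel_measurable borel" by (rule f_net_measurable[OF assms])
  have [measurable]: "(fst :: (real ^ 'd) \<times> real \<Rightarrow> _) \<in> borel \<rightarrow>\<^sub>M borel" "(snd :: (real ^ 'd) \<times> real \<Rightarrow> _) \<in> borel \<rightarrow>\<^sub>M borel"
    unfolding borel_prod[symmetric] by measurable
  have "(\<lambda>z. (f_net \<mu> (fst z), snd z)) \<in> borel \<rightarrow>\<^sub>M (borel :: (real \<times> real) measure)"
    by (intro borel_measurable_Pair) measurable
  from measurable_compose[OF this loss_measurable(2)[OF loss]]
  show ?thesis unfolding bounded_density_def using d1_bound by (simp add: dens_def[abs_def])
qed

lemma delta_risk_eq: "delta_risk l P \<mu> = pot (dens \<mu>)"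
  by (simp add: fun_eq_iff delta_risk_def pot_def dens_def case_prod_beta')

lemma grad_delta_risk_eq: "grad_delta_risk l P \<mu> = vel (dens \<mu>)"
  by (simp add: fun_eq_iff grad_delta_risk_def vel_def dens_def case_prod_beta')

text \<open>Convergence in \<open>W2\<close> gives pointwise convergence of the networks, hence of
  the densities by continuity of the derivative of the loss; the uniform bound \<open>C\<close>
  allows dominated convergence.\<close>

lemma dens_L1dist_tendsto:
  assumes "\<And>n. \<mu> n \<in> P2 A" "\<nu> \<in> P2 A" "(\<lambda>n. W2 (\<mu> n) \<nu>) \<longlonglongrightarrow> 0"
  shows "(\<lambda>n. L1dist (dens (\<mu> n)) (dens \<nu>)) \<longlonglongrightarrow> 0"
proof (rule L1dist_tendsto_0[OF bounded_density_dens[OF assms(1)] bounded_density_dens[OF assms(2)]])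
  fix z
  have "isCont (\<lambda>u. d1 l u (snd z)) (f_net \<nu> (fst z))"
    using loss_has_real_derivative(2)[OF loss] by (simp add: continuous_on_eq_continuous_at)
  from isCont_tendsto_compose[OF this f_net_tendsto[OF assms]]
  show "(\<lambda>n. dens (\<mu> n) z) \<longlonglongrightarrow> dens \<nu> z" unfolding dens_def .
qed

end

locale gradient_flow = relu_risk P L l C
  for P :: "((real ^ 'd::finite) \<times> real) measure" and L l C +
  fixes \<pi> :: "real \<Rightarrow> 'd param measure"
  assumes flow: "wasserstein_gradient_flow l P (\<pi> 0) \<pi>"
begin

abbreviation V :: "real \<Rightarrow> 'd param \<Rightarrow> 'd param" where "V t \<equiv> vel (dens (\<pi> t))"

section \<open>Continuity of the flow and of its velocity field; testing with subsolutions\<close>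

lemma flow_P2: "0 \<le> t \<Longrightarrow> \<pi> t \<in> P2 (closure Theta)"
  using flow by (simp add: wasserstein_gradient_flow_def)

lemma flow_W2: "0 \<le> t \<Longrightarrow> ((\<lambda>s. W2 (\<pi> s) (\<pi> t)) \<longlongrightarrow> 0) (at t within {0..})"
  using flow by (simp add: wasserstein_gradient_flow_def)

lemma flow_equation:
  "\<psi> \<in> Cc_inf Theta \<Longrightarrow> 0 < t \<Longrightarrow>
    ((\<lambda>s. \<integral>\<theta>. \<psi> \<theta> \<partial>\<pi> s) has_real_derivative - (\<integral>\<theta>. grad \<psi> \<theta> \<bullet> V t \<theta> \<partial>\<pi> t)) (at t)"
  using flow by (simp add: wasserstein_gradient_flow_def grad_delta_risk_eq)

lemma bounded_density_flow: "0 \<le> t \<Longrightarrow> bounded_density C (dens (\<pi> t))"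
  using bounded_density_dens flow_P2 by blast

lemma prob_space_flow: "0 \<le> t \<Longrightarrow> prob_space (\<pi> t)"
  using flow_P2 P2_D by blast

text \<open>Continuity is asked for on the compact set only, since products of a test gradient with
  the velocity field are controlled just there.\<close>

lemma integrable_continuous_compact_support:
  fixes f :: "'d param \<Rightarrow> real"
  assumes "0 \<le> t" "continuous_on K f" "compact K" "\<And>x. x \<notin> K \<Longrightarrow> f x = 0"
  shows "integrable (\<pi> t) f"
proof -
  interpret p: prob_space "\<pi> t" using assms(1) by (rule prob_space_flow)
  have "bounded (f ` K)" using assms by (intro compact_imp_bounded compact_continuous_image)
  then obtain B where "\<And>x. x \<in> K \<Longrightarrow> \<bar>f x\<bar> \<le> B" by (auto simp: bounded_iff)
  then have B: "\<bar>f x\<bar> \<le> \<bar>B\<bar>" for x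
    using assms(4)[of x] order_trans[OF _ abs_ge_self, of "\<bar>f x\<bar>" B] by (cases "x \<in> K") auto
  have "(\<lambda>x. indicator K x *\<^sub>R f x) \<in> borel_measurable borel"
    using assms(2) by (intro borel_measurable_continuous_on_indicator borel_closed compact_imp_closed[OF assms(3)])
  moreover have "(\<lambda>x. indicator K x *\<^sub>R f x) = f"
    using assms(4) by (auto simp: fun_eq_iff indicator_def)
  ultimately have "f \<in> borel_measurable borel" by metis
  then have "f \<in> borel_measurable (\<pi> t)"
    unfolding measurable_cong_sets[OF P2_D(1)[OF flow_P2[OF assms(1)]] refl] .
  then show ?thesis
    by (intro p.integrable_const_bound[of _ "\<bar>B\<bar>"] AE_I2) (simp add: B)
qed

lemma flow_weakly_continuous:
  fixes f :: "'d param \<Rightarrow> real"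
  assumes "0 \<le> t" "continuous_on UNIV f" "compact K" "\<And>x. x \<notin> K \<Longrightarrow> f x = 0"
  shows "((\<lambda>s. \<integral>\<theta>. f \<theta> \<partial>\<pi> s) \<longlongrightarrow> (\<integral>\<theta>. f \<theta> \<partial>\<pi> t)) (at t within {0..})"
proof (rule tendstoI)
  fix e :: real assume e: "0 < e"
  then have "0 < e / 2" by simp
  from W2_weak_continuity[OF assms(2-4) this, where A="closure Theta"] obtain r where
    r: "0 < r" "\<And>\<mu> \<nu>. \<mu> \<in> P2 (closure Theta) \<Longrightarrow> \<nu> \<in> P2 (closure Theta) \<Longrightarrow> W2 \<mu> \<nu> < r \<Longrightarrow>
      \<bar>(\<integral>\<theta>. f \<theta> \<partial>\<mu>) - (\<integral>\<theta>. f \<theta> \<partial>\<nu>)\<bar> \<le> e / 2" by blast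
  have "eventually (\<lambda>s. W2 (\<pi> s) (\<pi> t) < r) (at t within {0..})"
    using order_tendstoD(2)[OF flow_W2[OF assms(1)] r(1)] .
  moreover have "eventually (\<lambda>s. 0 \<le> s) (at t within {0..})"
    by (simp add: eventually_at_filter)
  ultimately show "eventually (\<lambda>s. dist (\<integral>\<theta>. f \<theta> \<partial>\<pi> s) (\<integral>\<theta>. f \<theta> \<partial>\<pi> t) < e) (at t within {0..})"
  proof eventually_elim
    case (elim s)
    show ?case using r(2)[OF flow_P2 flow_P2[OF assms(1)], of s] elim e by (simp add: dist_real_def)
  qed
qed

lemma flow_L1dist:
  assumes "0 \<le> t"
  shows "((\<lambda>s. L1dist (dens (\<pi> s)) (dens (\<pi> t))) \<longlongrightarrow> 0) (at t within {0..})"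
  unfolding tendsto_at_iff_sequentially comp_def
proof (intro allI impI)
  fix X :: "nat \<Rightarrow> real"
  assume X: "\<forall>i. X i \<in> {0..} - {t}" "X \<longlonglongrightarrow> t"
  have "(\<lambda>n. W2 (\<pi> (X n)) (\<pi> t)) \<longlonglongrightarrow> 0"
    using flow_W2[OF assms] X unfolding tendsto_at_iff_sequentially comp_def by blast
  then show "(\<lambda>n. L1dist (dens (\<pi> (X n))) (dens (\<pi> t))) \<longlonglongrightarrow> 0"
    using X by (intro dens_L1dist_tendsto[where A="closure Theta"] flow_P2 assms) auto
qed

text \<open>The added 1 keeps the Lipschitz constant strictly positive even if \<open>C\<close> is
  0, as needed for the exponential weight in \<open>picard_lindelof\<close>.\<close>

definition K :: real where "K = C * (3 * mom + 2 * L) + 1"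

lemma K_pos: "0 < K"
  unfolding K_def using C_nonneg mom_ge_1 L_nonneg by (intro add_nonneg_pos mult_nonneg_nonneg) auto

lemma V_lipschitz:
  assumes "0 \<le> t" "0 \<le> qf \<theta>'"
  shows "norm (V t \<theta> - V t \<theta>') \<le> K * norm (\<theta> - \<theta>')"
  by (rule order_trans[OF vel_lipschitz[OF bounded_density_flow[OF assms(1)] assms(2)]])
     (auto simp: K_def intro: mult_right_mono)

lemma V_continuous: "continuous_on ({0..} \<times> {\<theta>. 0 \<le> qf \<theta>}) (\<lambda>(t, \<theta>). V t \<theta>)"
  unfolding continuous_on_def
proof (intro ballI)
  fix p :: "real \<times> 'd param" assume p: "p \<in> {0..} \<times> {\<theta>. 0 \<le> qf \<theta>}"
  define t \<theta> where "t = fst p" and "\<theta> = snd p"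
  have t: "0 \<le> t" and q: "0 \<le> qf \<theta>" and pe: "p = (t, \<theta>)" using p by (auto simp: t_def \<theta>_def)
  let ?F = "at p within {0..} \<times> {\<theta>. 0 \<le> qf \<theta>}"
  have f: "(fst \<longlongrightarrow> t) ?F" and s: "(snd \<longlongrightarrow> \<theta>) ?F"
    unfolding t_def \<theta>_def by (intro tendsto_fst tendsto_snd tendsto_ident_at)+
  have fl: "eventually (\<lambda>s. L1dist (dens (\<pi> s)) (dens (\<pi> t)) < e) (at t within {0..})" if "0 < e" for e
    using order_tendstoD(2)[OF flow_L1dist[OF t] that] .
  have L1: "((\<lambda>y. L1dist (dens (\<pi> (fst y))) (dens (\<pi> t))) \<longlongrightarrow> 0) ?F"
  proof (rule tendstoI)
    fix e :: real assume e: "0 < e"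
    \<comment> \<open>A punctured neighbourhood of the pair still contains points with the same time
      and a different parameter, so the punctured limit in time has to be completed by the value at
      \<open>t\<close> itself.\<close>
    have "L1dist (dens (\<pi> t)) (dens (\<pi> t)) = 0" by (simp add: L1dist_def)
    then have "s \<in> {0..} \<longrightarrow> L1dist (dens (\<pi> s)) (dens (\<pi> t)) < e"
      if "s \<in> {0..} - {t} \<longrightarrow> L1dist (dens (\<pi> s)) (dens (\<pi> t)) < e" for s
      using that e by (cases "s = t") auto
    moreover have "eventually (\<lambda>s. s \<in> {0..} - {t} \<longrightarrow> L1dist (dens (\<pi> s)) (dens (\<pi> t)) < e) (nhds t)"
      using fl[OF e] unfolding at_within_def eventually_inf_principal .
    ultimately have "eventually (\<lambda>s. L1dist (dens (\<pi> s)) (dens (\<pi> t)) < e) (inf (nhds t) (principal {0..}))"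
      unfolding eventually_inf_principal by (rule eventually_mono[rotated])
    moreover have "filterlim fst (inf (nhds t) (principal {0..})) ?F"
    proof -
      have "eventually (\<lambda>y. y \<in> {0..} \<times> {\<theta>. 0 \<le> qf \<theta>}) ?F" by (simp add: eventually_at_filter)
      then have "eventually (\<lambda>y. fst y \<in> {0..}) ?F" by (rule eventually_mono) auto
      then show ?thesis unfolding filterlim_inf filterlim_principal using f by blast
    qed
    ultimately have "eventually (\<lambda>y. L1dist (dens (\<pi> (fst y))) (dens (\<pi> t)) < e) ?F"
      by (rule eventually_compose_filterlim)
    then show "eventually (\<lambda>y. dist (L1dist (dens (\<pi> (fst y))) (dens (\<pi> t))) 0 < e) ?F"
      by (rule eventually_mono) (simp add: L1dist_nonneg)
  qed
  have "((\<lambda>y. 2 * norm (snd y) * L1dist (dens (\<pi> (fst y))) (dens (\<pi> t)) + K * norm (snd y - \<theta>))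
      \<longlongrightarrow> 2 * norm \<theta> * 0 + K * norm (\<theta> - \<theta>)) ?F"
    by (intro tendsto_intros L1 s)
  then have lim: "((\<lambda>y. 2 * norm (snd y) * L1dist (dens (\<pi> (fst y))) (dens (\<pi> t)) + K * norm (snd y - \<theta>)) \<longlongrightarrow> 0) ?F"
    by simp
  have "((\<lambda>y. V (fst y) (snd y) - V t \<theta>) \<longlongrightarrow> 0) ?F"
  proof (rule Lim_null_comparison[OF _ lim])
    have "eventually (\<lambda>y. y \<in> {0..} \<times> {\<theta>. 0 \<le> qf \<theta>}) ?F"
      by (simp add: eventually_at_filter)
    then show "eventually (\<lambda>y. norm (V (fst y) (snd y) - V t \<theta>)
        \<le> 2 * norm (snd y) * L1dist (dens (\<pi> (fst y))) (dens (\<pi> t)) + K * norm (snd y - \<theta>)) ?F"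
    proof eventually_elim
      case (elim y)
      have "norm (V (fst y) (snd y) - V t (snd y)) \<le> 2 * norm (snd y) * L1dist (dens (\<pi> (fst y))) (dens (\<pi> t))"
        by (rule vel_diff_le[OF bounded_density_flow bounded_density_flow[OF t]]) (use elim in auto)
      moreover have "norm (V t (snd y) - V t \<theta>) \<le> K * norm (snd y - \<theta>)" by (rule V_lipschitz[OF t q])
      ultimately show ?case
        using norm_triangle_ineq[of "V (fst y) (snd y) - V t (snd y)" "V t (snd y) - V t \<theta>"] by simp
    qed
  qed
  then show "((\<lambda>(t, \<theta>). V t \<theta>) \<longlongrightarrow> (\<lambda>(t, \<theta>). V t \<theta>) p) ?F"
    unfolding pe case_prod_beta' fst_conv snd_conv by (rule LIM_zero_cancel)
qed

text \<open>The material derivative of \<open>\<Psi>\<close> along the characteristics is nonnegative, so \<open>\<Psi>\<close> is a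
  subsolution of the adjoint transport equation.\<close>

lemma subsolution_integral_mono:
  fixes \<Psi> D :: "real \<Rightarrow> 'd param \<Rightarrow> real"
  assumes T: "0 \<le> T0" "T0 \<le> T1" and M: "compact M"
    and \<Psi>: "\<And>t. t \<in> {T0..T1} \<Longrightarrow> \<Psi> t \<in> Cc_inf Theta"
    and supp: "\<And>t \<theta>. t \<in> {T0..T1} \<Longrightarrow> \<theta> \<notin> M \<Longrightarrow> \<Psi> t \<theta> = 0"
      "\<And>t \<theta>. t \<in> {T0..T1} \<Longrightarrow> \<theta> \<notin> M \<Longrightarrow> D t \<theta> = 0"
    and MT: "M \<subseteq> Theta"
    and D: "\<And>t \<theta>. t \<in> {T0..T1} \<Longrightarrow> ((\<lambda>s. \<Psi> s \<theta>) has_real_derivative D t \<theta>) (at t within {T0..T1})"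
    and D_cont: "continuous_on ({T0..T1} \<times> UNIV) (\<lambda>(t, \<theta>). D t \<theta>)"
    and ineq: "\<And>t \<theta>. T0 < t \<Longrightarrow> t < T1 \<Longrightarrow> \<theta> \<in> Theta \<Longrightarrow> grad (\<Psi> t) \<theta> \<bullet> V t \<theta> \<le> D t \<theta>"
  shows "(\<integral>\<theta>. \<Psi> T0 \<theta> \<partial>\<pi> T0) \<le> (\<integral>\<theta>. \<Psi> T1 \<theta> \<partial>\<pi> T1)"
proof -
  have \<Psi>_cont: "continuous_on UNIV (\<Psi> t)" if "t \<in> {T0..T1}" for t
  proof -
    have "Ck 0 (\<Psi> t)" using \<Psi>[OF that] unfolding Cc_inf_def by blast
    then show ?thesis by simp
  qed
  have Dt_cont: "continuous_on UNIV (D t)" if "t \<in> {T0..T1}" for t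
  proof -
    have "continuous_on UNIV (\<lambda>\<theta>::'d param. (t, \<theta>))" by (intro continuous_intros)
    have "continuous_on UNIV (\<lambda>\<theta>. (\<lambda>(t, \<theta>). D t \<theta>) (t, \<theta>))"
      by (rule continuous_on_compose2[OF D_cont \<open>continuous_on UNIV (Pair t)\<close>]) (use that in auto)
    then show ?thesis by simp
  qed
  have \<Psi>_int: "integrable (\<pi> s) (\<Psi> t)" if "t \<in> {T0..T1}" "0 \<le> s" for s t
    using that supp M by (intro integrable_continuous_compact_support continuous_on_subset[OF \<Psi>_cont]) auto
  have D_int: "integrable (\<pi> s) (D t)" if "t \<in> {T0..T1}" "0 \<le> s" for s t
    using that supp M by (intro integrable_continuous_compact_support continuous_on_subset[OF Dt_cont]) auto
  have "uniformly_continuous_on ({T0..T1} \<times> M) (\<lambda>(t, \<theta>). D t \<theta>)"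
    using M by (intro compact_uniformly_continuous continuous_on_subset[OF D_cont] compact_Times) auto
  then have "\<exists>d>0. \<forall>t\<in>{T0..T1}. \<forall>s\<in>{T0..T1}. \<forall>\<theta>. \<bar>s - t\<bar> < d \<longrightarrow> \<bar>D s \<theta> - D t \<theta>\<bar> \<le> e" if e: "0 < e" for e
  proof -
    assume "uniformly_continuous_on ({T0..T1} \<times> M) (\<lambda>(t, \<theta>). D t \<theta>)"
    from this[unfolded uniformly_continuous_on_def, rule_format, OF e]
    obtain d where d: "0 < d" "\<And>p p'. p \<in> {T0..T1} \<times> M \<Longrightarrow> p' \<in> {T0..T1} \<times> M \<Longrightarrow> dist p' p < d \<Longrightarrow>
        dist ((\<lambda>(t, \<theta>). D t \<theta>) p') ((\<lambda>(t, \<theta>). D t \<theta>) p) < e"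
      by blast
    have "\<bar>D s \<theta> - D t \<theta>\<bar> \<le> e" if "t \<in> {T0..T1}" "s \<in> {T0..T1}" "\<bar>s - t\<bar> < d" for s t \<theta>
    proof (cases "\<theta> \<in> M")
      case True
      then show ?thesis using d(2)[of "(t, \<theta>)" "(s, \<theta>)"] that by (simp add: dist_Pair_Pair dist_real_def)
    next
      case False
      then show ?thesis using supp(2) that e by simp
    qed
    with d(1) show ?thesis by blast
  qed
  note D_unif = this
  \<comment> \<open>A first-order expansion in time, uniform in the parameter: compactness of
    \<open>M\<close> makes \<open>D\<close> uniformly continuous, and off \<open>M\<close>
    everything vanishes. Uniformity is what allows integration against the varying measure
    \<open>\<pi> s\<close>.\<close>
  have taylor: "\<exists>d>0. \<forall>s\<in>{T0..T1}. \<forall>\<theta>. \<bar>s - t\<bar> < d \<longrightarrow> \<bar>\<Psi> s \<theta> - \<Psi> t \<theta> - (s - t) * D t \<theta>\<bar> \<le> e * \<bar>s - t\<bar>"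
    if t: "t \<in> {T0..T1}" and e: "0 < e" for t e
  proof -
    obtain d where d: "0 < d" "\<And>s \<theta>. s \<in> {T0..T1} \<Longrightarrow> \<bar>s - t\<bar> < d \<Longrightarrow> \<bar>D s \<theta> - D t \<theta>\<bar> \<le> e"
      using D_unif[OF e] t by blast
    have "\<bar>\<Psi> s \<theta> - \<Psi> t \<theta> - (s - t) * D t \<theta>\<bar> \<le> e * \<bar>s - t\<bar>" if s: "s \<in> {T0..T1}" "\<bar>s - t\<bar> < d" for s \<theta>
    proof -
      let ?S = "{T0..T1} \<inter> ball t d"
      have "norm ((\<Psi> s \<theta> - s * D t \<theta>) - (\<Psi> t \<theta> - t * D t \<theta>)) \<le> e * norm (s - t)"
      proof (rule field_differentiable_bound[of ?S _ "\<lambda>r. D r \<theta> - D t \<theta>"])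
        show "convex ?S" by (intro convex_Int) auto
        show "s \<in> ?S" "t \<in> ?S" using s t d(1) by (auto simp: dist_real_def abs_minus_commute)
        fix r assume r: "r \<in> ?S"
        show "norm (D r \<theta> - D t \<theta>) \<le> e"
          using d(2)[of r \<theta>] r by (simp add: dist_real_def abs_minus_commute)
        show "((\<lambda>r. \<Psi> r \<theta> - r * D t \<theta>) has_real_derivative D r \<theta> - D t \<theta>) (at r within ?S)"
          using r by (auto intro!: derivative_eq_intros DERIV_subset[OF D])
      qed
      then show ?thesis by (simp add: algebra_simps)
    qed
    with d(1) show ?thesis by blast
  qed
  define F where "F t = (\<integral>\<theta>. \<Psi> t \<theta> \<partial>\<pi> t)" for t
  have quot: "((\<lambda>s. (\<integral>\<theta>. \<Psi> s \<theta> - \<Psi> t \<theta> - (s - t) * D t \<theta> \<partial>\<pi> s) / (s - t)) \<longlongrightarrow> 0) (at t within {T0..T1})"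
    if t: "t \<in> {T0..T1}" for t
  proof (rule tendstoI)
    fix e :: real assume "0 < e"
    then have e: "0 < e / 2" by simp
    from taylor[OF t this] obtain d where d: "0 < d"
      "\<And>s \<theta>. s \<in> {T0..T1} \<Longrightarrow> \<bar>s - t\<bar> < d \<Longrightarrow> \<bar>\<Psi> s \<theta> - \<Psi> t \<theta> - (s - t) * D t \<theta>\<bar> \<le> e / 2 * \<bar>s - t\<bar>" by blast
    show "eventually (\<lambda>s. dist ((\<integral>\<theta>. \<Psi> s \<theta> - \<Psi> t \<theta> - (s - t) * D t \<theta> \<partial>\<pi> s) / (s - t)) 0 < e) (at t within {T0..T1})"
      unfolding eventually_at
    proof (intro exI[of _ d] conjI ballI impI d(1))
      fix s assume s: "s \<in> {T0..T1}" "s \<noteq> t \<and> dist s t < d"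
      have s0: "0 \<le> s" using s T by simp
      interpret ps: prob_space "\<pi> s" by (rule prob_space_flow[OF s0])
      have "norm (\<integral>\<theta>. \<Psi> s \<theta> - \<Psi> t \<theta> - (s - t) * D t \<theta> \<partial>\<pi> s) \<le> (\<integral>\<theta>. e / 2 * \<bar>s - t\<bar> \<partial>\<pi> s)"
        by (rule Bochner_Integration.integral_norm_bound_integral)
           (use s d(2) in \<open>auto intro!: Bochner_Integration.integrable_diff integrable_mult_right \<Psi>_int D_int s0 t simp: dist_real_def\<close>)
      also have "\<dots> = e / 2 * \<bar>s - t\<bar>" by (simp add: ps.prob_space)
      finally have "\<bar>\<integral>\<theta>. \<Psi> s \<theta> - \<Psi> t \<theta> - (s - t) * D t \<theta> \<partial>\<pi> s\<bar> / \<bar>s - t\<bar> \<le> e / 2"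
        using s by (simp add: divide_le_eq)
      then show "dist ((\<integral>\<theta>. \<Psi> s \<theta> - \<Psi> t \<theta> - (s - t) * D t \<theta> \<partial>\<pi> s) / (s - t)) 0 < e"
        using e by (simp only: dist_real_def diff_0_right abs_divide)
    qed
  qed
  have split: "F s = (\<integral>\<theta>. \<Psi> s \<theta> - \<Psi> t \<theta> - (s - t) * D t \<theta> \<partial>\<pi> s) + (\<integral>\<theta>. \<Psi> t \<theta> \<partial>\<pi> s) + (s - t) * (\<integral>\<theta>. D t \<theta> \<partial>\<pi> s)"
    if "s \<in> {T0..T1}" "t \<in> {T0..T1}" for s t
  proof -
    have "0 \<le> s" using that T by simp
    then show ?thesis unfolding F_def using that
      by (simp add: \<Psi>_int D_int)
  qed
  have lim\<Psi>: "((\<lambda>s. \<integral>\<theta>. \<Psi> t \<theta> \<partial>\<pi> s) \<longlongrightarrow> (\<integral>\<theta>. \<Psi> t \<theta> \<partial>\<pi> t)) (at t within {T0..T1})"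
    and limD: "((\<lambda>s. \<integral>\<theta>. D t \<theta> \<partial>\<pi> s) \<longlongrightarrow> (\<integral>\<theta>. D t \<theta> \<partial>\<pi> t)) (at t within {T0..T1})"
    if "t \<in> {T0..T1}" for t
    using that T supp M
    by (auto intro!: tendsto_within_subset[OF flow_weakly_continuous[of _ _ M]] \<Psi>_cont Dt_cont)
  have F_cont: "continuous_on {T0..T1} F"
    unfolding continuous_on_def
  proof (intro ballI)
    fix t assume t: "t \<in> {T0..T1}"
    have "((\<lambda>s. (\<integral>\<theta>. \<Psi> s \<theta> - \<Psi> t \<theta> - (s - t) * D t \<theta> \<partial>\<pi> s) / (s - t) * (s - t) + (\<integral>\<theta>. \<Psi> t \<theta> \<partial>\<pi> s) + (s - t) * (\<integral>\<theta>. D t \<theta> \<partial>\<pi> s))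
        \<longlongrightarrow> 0 * (t - t) + (\<integral>\<theta>. \<Psi> t \<theta> \<partial>\<pi> t) + (t - t) * (\<integral>\<theta>. D t \<theta> \<partial>\<pi> t)) (at t within {T0..T1})"
      by (intro tendsto_add tendsto_mult tendsto_diff tendsto_const tendsto_ident_at quot lim\<Psi> limD t)
    then have "((\<lambda>s. (\<integral>\<theta>. \<Psi> s \<theta> - \<Psi> t \<theta> - (s - t) * D t \<theta> \<partial>\<pi> s) / (s - t) * (s - t) + (\<integral>\<theta>. \<Psi> t \<theta> \<partial>\<pi> s) + (s - t) * (\<integral>\<theta>. D t \<theta> \<partial>\<pi> s))
        \<longlongrightarrow> F t) (at t within {T0..T1})" by (simp add: F_def)
    then show "(F \<longlongrightarrow> F t) (at t within {T0..T1})"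
      by (rule Lim_transform_eventually) (auto simp: eventually_at_filter split[OF _ t])
  qed
  have F_deriv: "(F has_real_derivative (\<integral>\<theta>. D t \<theta> \<partial>\<pi> t) - (\<integral>\<theta>. grad (\<Psi> t) \<theta> \<bullet> V t \<theta> \<partial>\<pi> t)) (at t)"
    if t: "T0 < t" "t < T1" for t
  proof -
    have tT: "t \<in> {T0..T1}" and t0: "0 < t" using t T by auto
    have at: "at t within {T0..T1} = at t" using t by (intro at_within_interior) (auto simp: interior_atLeastAtMost_real)
    have eq: "((\<lambda>s. ((\<integral>\<theta>. \<Psi> t \<theta> \<partial>\<pi> s) - (\<integral>\<theta>. \<Psi> t \<theta> \<partial>\<pi> t)) / (s - t)) \<longlongrightarrow> - (\<integral>\<theta>. grad (\<Psi> t) \<theta> \<bullet> V t \<theta> \<partial>\<pi> t)) (at t)"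
      using flow_equation[OF \<Psi>[OF tT] t0] by (simp add: has_field_derivative_iff)
    have "((\<lambda>s. (\<integral>\<theta>. \<Psi> s \<theta> - \<Psi> t \<theta> - (s - t) * D t \<theta> \<partial>\<pi> s) / (s - t)
        + ((\<integral>\<theta>. \<Psi> t \<theta> \<partial>\<pi> s) - (\<integral>\<theta>. \<Psi> t \<theta> \<partial>\<pi> t)) / (s - t) + (\<integral>\<theta>. D t \<theta> \<partial>\<pi> s))
        \<longlongrightarrow> 0 + - (\<integral>\<theta>. grad (\<Psi> t) \<theta> \<bullet> V t \<theta> \<partial>\<pi> t) + (\<integral>\<theta>. D t \<theta> \<partial>\<pi> t)) (at t)"
      by (intro tendsto_add quot[OF tT, unfolded at] eq limD[OF tT, unfolded at])
    then have lim: "((\<lambda>s. (\<integral>\<theta>. \<Psi> s \<theta> - \<Psi> t \<theta> - (s - t) * D t \<theta> \<partial>\<pi> s) / (s - t)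
        + ((\<integral>\<theta>. \<Psi> t \<theta> \<partial>\<pi> s) - (\<integral>\<theta>. \<Psi> t \<theta> \<partial>\<pi> t)) / (s - t) + (\<integral>\<theta>. D t \<theta> \<partial>\<pi> s))
        \<longlongrightarrow> (\<integral>\<theta>. D t \<theta> \<partial>\<pi> t) - (\<integral>\<theta>. grad (\<Psi> t) \<theta> \<bullet> V t \<theta> \<partial>\<pi> t)) (at t)" by simp
    have "eventually (\<lambda>s. s \<in> {T0<..<T1}) (nhds t)"
      using t by (intro eventually_nhds_in_open) auto
    then have ev: "eventually (\<lambda>s. s \<in> {T0<..<T1} \<and> s \<noteq> t) (at t)"
      by (auto simp: eventually_at_filter elim: eventually_mono)
    have "((\<lambda>s. (F s - F t) / (s - t)) \<longlongrightarrow> (\<integral>\<theta>. D t \<theta> \<partial>\<pi> t) - (\<integral>\<theta>. grad (\<Psi> t) \<theta> \<bullet> V t \<theta> \<partial>\<pi> t)) (at t)"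
    proof (rule Lim_transform_eventually[OF lim eventually_mono[OF ev]])
      fix s assume s: "s \<in> {T0<..<T1} \<and> s \<noteq> t"
      then have sT: "s \<in> {T0..T1}" and nz: "s - t \<noteq> 0" by auto
      show "(\<integral>\<theta>. \<Psi> s \<theta> - \<Psi> t \<theta> - (s - t) * D t \<theta> \<partial>\<pi> s) / (s - t)
        + ((\<integral>\<theta>. \<Psi> t \<theta> \<partial>\<pi> s) - (\<integral>\<theta>. \<Psi> t \<theta> \<partial>\<pi> t)) / (s - t) + (\<integral>\<theta>. D t \<theta> \<partial>\<pi> s) = (F s - F t) / (s - t)"
        unfolding split[OF sT tT] F_def[of t] using nz by (simp add: add_divide_distrib diff_divide_distrib)
    qed
    then show ?thesis by (simp add: has_field_derivative_iff)
  qed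
  have nonneg: "0 \<le> (\<integral>\<theta>. D t \<theta> \<partial>\<pi> t) - (\<integral>\<theta>. grad (\<Psi> t) \<theta> \<bullet> V t \<theta> \<partial>\<pi> t)" if t: "T0 < t" "t < T1" for t
  proof -
    have tT: "t \<in> {T0..T1}" and t0: "0 \<le> t" using t T by auto
    have MV: "continuous_on M (V t)"
    proof -
      have "continuous_on M (\<lambda>\<theta>. (t, \<theta>))" by (intro continuous_intros)
      from continuous_on_compose2[OF V_continuous this] show ?thesis
        using MT t0 unfolding Theta_eq by force
    qed
    have g0: "\<theta> \<notin> M \<Longrightarrow> grad (\<Psi> t) \<theta> = 0" for \<theta>
      using Cc_inf_grad(2)[OF \<Psi>[OF tT] compact_imp_closed[OF M]] supp(1)[OF tT] by blast
    have gi: "integrable (\<pi> t) (\<lambda>\<theta>. grad (\<Psi> t) \<theta> \<bullet> V t \<theta>)"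
      using g0 by (intro integrable_continuous_compact_support[OF t0 _ M] continuous_on_inner MV
          continuous_on_subset[OF Cc_inf_grad(1)[OF \<Psi>[OF tT]]]) auto
    have "grad (\<Psi> t) \<theta> \<bullet> V t \<theta> \<le> D t \<theta>" for \<theta>
      using ineq[OF t, of \<theta>] g0[of \<theta>] supp(2)[OF tT, of \<theta>] MT by (cases "\<theta> \<in> M") auto
    then have "(\<integral>\<theta>. grad (\<Psi> t) \<theta> \<bullet> V t \<theta> \<partial>\<pi> t) \<le> (\<integral>\<theta>. D t \<theta> \<partial>\<pi> t)"
      by (intro integral_mono gi D_int[OF tT t0])
    then show ?thesis by simp
  qed
  \<comment> \<open>The flow equation holds at strictly positive times only, so monotonicity is
    drawn from derivatives in the open interval and continuity up to its endpoints.\<close>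
  have "F T0 \<le> F T1"
    by (rule DERIV_nonneg_imp_increasing_open[OF T(2)]) (use F_deriv nonneg F_cont in blast)+
  then show ?thesis by (simp add: F_def)
qed

end

subsection \<open>Propagation of omni-directionality\<close>

text \<open>As \<open>bump\<close> is nondecreasing, the gradient is only multiplied by a
  nonnegative factor, so the sign of a derivative along characteristics survives the cut-off; the
  factor vanishes wherever the cut-off itself does.\<close>

lemma has_derivative_inner_bump:
  assumes "(f has_derivative (\<lambda>v. G \<bullet> v)) (at x)"
  shows "((\<lambda>x. bump (f x)) has_derivative (\<lambda>v. (bump' (f x) *\<^sub>R G) \<bullet> v)) (at x)"
  using has_derivative_compose[OF assms, of bump "\<lambda>v. bump' (f x) * v"] bump_has_real_derivative[of "f x"]
  by (simp add: has_field_derivative_def)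

lemma has_derivative_inner_mult:
  fixes f g :: "'a::real_inner \<Rightarrow> real"
  assumes "(f has_derivative (\<lambda>v. F \<bullet> v)) (at x)" "(g has_derivative (\<lambda>v. G \<bullet> v)) (at x)"
  shows "((\<lambda>x. f x * g x) has_derivative (\<lambda>v. (f x *\<^sub>R G + g x *\<^sub>R F) \<bullet> v)) (at x)"
  using has_derivative_mult[OF assms] by (simp add: inner_add_left mult.commute)

lemma has_derivative_dist_sq:
  fixes c x :: "'a::real_inner"
  shows "((\<lambda>x. (x - c) \<bullet> (x - c)) has_derivative (\<lambda>v. (2 *\<^sub>R (x - c)) \<bullet> v)) (at x)"
  by (auto intro!: derivative_eq_intros simp: inner_commute)

lemma has_derivative_qf: "(qf has_derivative (\<lambda>v. (2 *\<^sub>R (- fst \<theta>, snd \<theta>)) \<bullet> v)) (at \<theta>)"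
  unfolding qf_def[abs_def]
  by (auto intro!: derivative_eq_intros simp: inner_prod_def inner_commute)

lemma Ck_dist_sq: "Ck k (\<lambda>x. (x - c) \<bullet> (x - c))"
proof -
  have "Ck k (\<lambda>x. x \<bullet> x - 2 * (x \<bullet> c) + c \<bullet> c)"
    by (intro Ck_add Ck_diff Ck_mult Ck_const Ck_inner_self Ck_linear bounded_linear_inner_left)
  then show ?thesis by (simp add: inner_diff_left inner_diff_right inner_commute algebra_simps)
qed

lemma Ck_qf: "Ck k qf"
proof -
  have "Ck k (\<lambda>\<theta>::'a param. \<theta> \<bullet> \<theta> - 2 * (fst \<theta> * fst \<theta>))"
    by (intro Ck_diff Ck_mult Ck_const Ck_inner_self Ck_linear bounded_linear_fst)
  moreover have "(\<lambda>\<theta>::'a param. \<theta> \<bullet> \<theta> - 2 * (fst \<theta> * fst \<theta>)) = qf"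
    by (auto simp: fun_eq_iff qf_def inner_prod_def power2_eq_square)
  ultimately show ?thesis by simp
qed

text \<open>The velocity fields are Lipschitz continuous only on the closure of \<^const>\<open>Theta\<close>; composing them with
  this retraction makes the Picard-Lindeloef theorem applicable.\<close>

definition clamp_param :: "'d::finite param \<Rightarrow> 'd param" where
  "clamp_param \<theta> = (max (- norm (snd \<theta>)) (min (norm (snd \<theta>)) (fst \<theta>)), snd \<theta>)"

lemma qf_clamp_param: "0 \<le> qf (clamp_param \<theta>)"
proof -
  have "\<bar>max (- norm (snd \<theta>)) (min (norm (snd \<theta>)) (fst \<theta>))\<bar> \<le> norm (snd \<theta>)"
    by (auto simp: max_def min_def abs_le_iff)
  then have "(max (- norm (snd \<theta>)) (min (norm (snd \<theta>)) (fst \<theta>)))\<^sup>2 \<le> (norm (snd \<theta>))\<^sup>2"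
    by (simp add: abs_le_square_iff[symmetric])
  then show ?thesis by (simp add: qf_def clamp_param_def flip: power2_norm_eq_inner)
qed

lemma clamp_param_id: "0 \<le> qf \<theta> \<Longrightarrow> clamp_param \<theta> = \<theta>"
  using qf_nonneg_fst_le[of \<theta>] by (auto simp: clamp_param_def prod_eq_iff)

lemma clamp_param_lipschitz: "norm (clamp_param \<theta> - clamp_param \<theta>') \<le> 2 * norm (\<theta> - \<theta>')"
proof -
  have s: "norm (snd \<theta> - snd \<theta>') \<le> norm (\<theta> - \<theta>')" using norm_snd_param[of "\<theta> - \<theta>'"] by simp
  have a: "\<bar>fst \<theta> - fst \<theta>'\<bar> \<le> norm (\<theta> - \<theta>')" using norm_fst_param[of "\<theta> - \<theta>'"] by simp
  have "\<bar>norm (snd \<theta>) - norm (snd \<theta>')\<bar> \<le> norm (\<theta> - \<theta>')" using s norm_triangle_ineq3 order_trans by blast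
  then have "\<bar>fst (clamp_param \<theta> - clamp_param \<theta>')\<bar> \<le> norm (\<theta> - \<theta>')"
    using a norm_ge_zero[of "snd \<theta>"] norm_ge_zero[of "snd \<theta>'"]
    unfolding clamp_param_def fst_diff fst_conv by (smt (verit) max_def min_def)
  moreover have "norm (snd (clamp_param \<theta> - clamp_param \<theta>')) \<le> norm (\<theta> - \<theta>')"
    using s by (simp add: clamp_param_def)
  ultimately show ?thesis
    using norm_Pair_le[of "fst (clamp_param \<theta> - clamp_param \<theta>')" "snd (clamp_param \<theta> - clamp_param \<theta>')"]
    unfolding prod.collapse real_norm_def by linarith
qed

lemma emeasure_pos_countable_Union:
  assumes "0 < emeasure M (\<Union>i::nat. A i)" "\<And>i. A i \<in> sets M"
  obtains i where "0 < emeasure M (A i)"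
proof -
  have "\<exists>i. emeasure M (A i) \<noteq> 0"
  proof (rule ccontr)
    assume "\<not> ?thesis"
    then have "emeasure M (\<Union>i. A i) = 0" using assms(2) by (intro emeasure_UN_eq_0) auto
    then show False using assms(1) by simp
  qed
  then show ?thesis using that by (auto simp: zero_less_iff_neq_zero)
qed

lemma integral_pos_iff:
  fixes f :: "'a \<Rightarrow> real"
  assumes "integrable M f" "\<And>x. 0 \<le> f x"
  shows "0 < (\<integral>x. f x \<partial>M) \<longleftrightarrow> 0 < emeasure M {x \<in> space M. f x \<noteq> 0}"
proof -
  have "(\<integral>x. f x \<partial>M) = 0 \<longleftrightarrow> (AE x in M. f x = 0)"
    using assms by (intro integral_nonneg_eq_0_iff_AE) auto
  also have "\<dots> \<longleftrightarrow> emeasure M {x \<in> space M. f x \<noteq> 0} = 0"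
    using assms(1) by (intro AE_iff_measurable[OF _ refl]) auto
  finally show ?thesis
    using Bochner_Integration.integral_nonneg[of M f] assms(2) by (auto simp: zero_less_iff_neq_zero less_le)
qed

context gradient_flow
begin

text \<open>Mass moves with velocity - V, and the endpoint is prescribed. Reversing time gives an
  initial value problem with field +V, and conservation of \<open>qf\<close> prevents its solution
  from reaching the boundary of \<open>Theta\<close>.\<close>

lemma backward_characteristic:
  assumes T: "0 \<le> T" and w: "\<omega> \<in> Theta"
  obtains \<gamma> where "\<gamma> T = \<omega>" "\<And>t. t \<in> {0..T} \<Longrightarrow> \<gamma> t \<in> Theta"
    "\<And>t. t \<in> {0..T} \<Longrightarrow> (\<gamma> has_vector_derivative - V t (\<gamma> t)) (at t within {0..T})"
proof -
  define W where "W r \<theta> = V (T - r) (clamp_param \<theta>)" for r \<theta>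
  have "continuous_on ({0..T} \<times> UNIV) (\<lambda>p :: real \<times> 'd param. (T - fst p, clamp_param (snd p)))"
    unfolding clamp_param_def by (intro continuous_intros)
  then have "continuous_on ({0..T} \<times> UNIV) (\<lambda>p. (\<lambda>(t, \<theta>). V t \<theta>) (T - fst p, clamp_param (snd p)))"
    by (rule continuous_on_compose2[OF V_continuous]) (auto simp: qf_clamp_param)
  then have cont: "continuous_on ({0..T} \<times> UNIV) (\<lambda>(t, x). W t x)"
    by (simp add: W_def case_prod_beta')
  have lip: "norm (W t x - W t y) \<le> (2 * K) * norm (x - y)" if "t \<in> {0..T}" for t x y
  proof -
    have "norm (W t x - W t y) \<le> K * norm (clamp_param x - clamp_param y)"
      unfolding W_def using that by (intro V_lipschitz qf_clamp_param) auto
    also have "\<dots> \<le> K * (2 * norm (x - y))"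
      using K_pos by (intro mult_left_mono clamp_param_lipschitz) auto
    finally show ?thesis by simp
  qed
  have K2: "0 < 2 * K" using K_pos by simp
  obtain \<beta> where \<beta>: "\<beta> 0 = \<omega>"
    "\<And>t. t \<in> {0..T} \<Longrightarrow> (\<beta> has_vector_derivative W t (\<beta> t)) (at t within {0..T})"
    using picard_lindelof[OF T K2 cont lip, of \<omega>] by blast
  \<comment> \<open>Half the initial value of \<open>qf\<close>:
    \<open>bump (qf \<theta> - c)\<close> is positive at the start, and its positivity later forces
    \<open>qf\<close> above \<open>c\<close>.\<close>
  define c where "c = qf \<omega> / 2"
  have c: "0 < c" using w by (simp add: c_def Theta_eq)
  \<comment> \<open>\<open>qf\<close> is conserved only while \<open>\<beta>\<close> stays in the closure of \<^const>\<open>Theta\<close>; where \<open>\<beta>\<close> might leave it, \<open>bump'\<close> vanishes.\<close>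
  have "((\<lambda>t. bump (qf (\<beta> t) - c)) has_real_derivative 0) (at t within {0..T})" if t: "t \<in> {0..T}" for t
  proof -
    have "((\<lambda>t. qf (\<beta> t) - c) has_derivative (\<lambda>h. (2 *\<^sub>R (- fst (\<beta> t), snd (\<beta> t))) \<bullet> (h *\<^sub>R W t (\<beta> t)))) (at t within {0..T})"
      using has_derivative_compose[OF \<beta>(2)[OF t, unfolded has_vector_derivative_def] has_derivative_qf]
      by (auto intro!: derivative_eq_intros)
    then have "((\<lambda>t. qf (\<beta> t) - c) has_real_derivative (2 *\<^sub>R (- fst (\<beta> t), snd (\<beta> t))) \<bullet> W t (\<beta> t)) (at t within {0..T})"
      unfolding has_field_derivative_def by (simp add: mult_commute_abs)
    from DERIV_chain2[OF bump_has_real_derivative this]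
    have d: "((\<lambda>t. bump (qf (\<beta> t) - c)) has_real_derivative
        bump' (qf (\<beta> t) - c) * ((2 *\<^sub>R (- fst (\<beta> t), snd (\<beta> t))) \<bullet> W t (\<beta> t))) (at t within {0..T})" .
    have "bump' (qf (\<beta> t) - c) * ((2 *\<^sub>R (- fst (\<beta> t), snd (\<beta> t))) \<bullet> W t (\<beta> t)) = 0"
    proof (cases "qf (\<beta> t) \<le> c")
      case True
      then show ?thesis by (simp add: bump'_eq_0)
    next
      case False
      then have "clamp_param (\<beta> t) = \<beta> t" using c by (intro clamp_param_id) auto
      then have "W t (\<beta> t) \<bullet> (- fst (\<beta> t), snd (\<beta> t)) = 0"
        unfolding W_def using vel_inner_conserved[OF bounded_density_flow[of "T - t"], of "\<beta> t"] t by simp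
      then show ?thesis unfolding inner_commute[of _ "W t (\<beta> t)"] inner_scaleR_right by simp
    qed
    with d show ?thesis by (simp only:)
  qed
  then have "\<exists>k. \<forall>t\<in>{0..T}. bump (qf (\<beta> t) - c) = k"
    by (intro has_field_derivative_zero_constant convex_real_interval)
  then obtain k where k: "\<And>t. t \<in> {0..T} \<Longrightarrow> bump (qf (\<beta> t) - c) = k" by blast
  have pos: "\<beta> t \<in> Theta" if "t \<in> {0..T}" for t
  proof -
    have "0 < bump (qf (\<beta> 0) - c)" using c by (simp add: bump_pos_iff \<beta>(1) c_def)
    then have "0 < bump (qf (\<beta> t) - c)" using k[OF that] k[of 0] T by simp
    then show ?thesis using c by (simp add: bump_pos_iff Theta_eq)
  qed
  show ?thesis
  proof (rule that[of "\<lambda>t. \<beta> (T - t)"])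
    show "\<beta> (T - T) = \<omega>" using \<beta>(1) by simp
    fix t assume t: "t \<in> {0..T}"
    then have t': "T - t \<in> {0..T}" by auto
    show "\<beta> (T - t) \<in> Theta" using t' by (rule pos)
    have "((\<lambda>t. T - t) has_vector_derivative - 1) (at t within {0..T})"
      by (auto intro!: derivative_eq_intros)
    moreover have "(\<beta> has_vector_derivative V t (\<beta> (T - t))) (at (T - t) within (\<lambda>t. T - t) ` {0..T})"
      using \<beta>(2)[OF t'] clamp_param_id[of "\<beta> (T - t)"] pos[OF t'] by (simp add: W_def Theta_eq)
    ultimately have "((\<beta> \<circ> (\<lambda>t. T - t)) has_vector_derivative (- 1) *\<^sub>R V t (\<beta> (T - t))) (at t within {0..T})"
      by (rule vector_diff_chain_within)
    then show "((\<lambda>t. \<beta> (T - t)) has_vector_derivative - V t (\<beta> (T - t))) (at t within {0..T})"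
      by (simp add: comp_def)
  qed
qed

text \<open>A Gronwall estimate in Eulerian form: neighbouring characteristics separate at relative
  rate at most \<open>K\<close>, so a ball around \<gamma> whose radius grows like exp(K t) loses no
  mass. In terms of A = r - |\<theta> - \<gamma>|^2 with r' = 2 K r, the material derivative of A is
  nonnegative wherever A is positive.\<close>

lemma moving_ball:
  assumes T: "0 \<le> T"
    and \<gamma>: "\<And>t. t \<in> {0..T} \<Longrightarrow> \<gamma> t \<in> Theta"
      "\<And>t. t \<in> {0..T} \<Longrightarrow> (\<gamma> has_vector_derivative - V t (\<gamma> t)) (at t within {0..T})"
    and \<rho>: "0 < \<rho>" and \<epsilon>: "0 < \<epsilon>"
    and pos: "0 < emeasure (\<pi> 0) (ball (\<gamma> 0) \<rho> \<inter> {\<theta>. \<epsilon> < qf \<theta>})"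
  shows "0 < emeasure (\<pi> T) (ball (\<gamma> T) (\<rho> * exp (K * T)) \<inter> Theta)"
proof -
  define r where "r t = (\<rho> * exp (K * t))\<^sup>2" for t
  define A :: "real \<Rightarrow> 'd param \<Rightarrow> real" where "A t \<theta> = r t - (\<theta> - \<gamma> t) \<bullet> (\<theta> - \<gamma> t)" for t \<theta>
  \<comment> \<open>The second factor is constant along characteristics; together with the ball it
    confines the support to a compact subset of \<open>Theta\<close>.\<close>
  define \<Psi> where "\<Psi> t \<theta> = bump (A t \<theta>) * bump (qf \<theta> - \<epsilon>)" for t \<theta>
  define D where "D t \<theta> = bump' (A t \<theta>) * (2 * K * r t - 2 * ((\<theta> - \<gamma> t) \<bullet> V t (\<gamma> t))) * bump (qf \<theta> - \<epsilon>)" for t \<theta>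
  have \<gamma>_cont: "continuous_on {0..T} \<gamma>"
    unfolding continuous_on_eq_continuous_within using has_vector_derivative_continuous[OF \<gamma>(2)] by blast
  obtain B where "\<forall>x\<in>\<gamma> ` {0..T}. norm x \<le> B"
    using compact_imp_bounded[OF compact_continuous_image[OF \<gamma>_cont compact_Icc]] unfolding bounded_iff by blast
  then have B: "\<And>t. t \<in> {0..T} \<Longrightarrow> norm (\<gamma> t) \<le> B" by blast
  define R where "R = B + \<rho> * exp (K * T)"
  define M where "M = {\<theta> :: 'd param. \<epsilon> \<le> qf \<theta>} \<inter> cball 0 R"
  have "closed {\<theta> :: 'd param. \<epsilon> \<le> qf \<theta>}"
    by (intro closed_Collect_le continuous_on_const continuous_on_qf)
  then have "compact M" unfolding M_def by (intro closed_Int_compact compact_cball)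
  moreover have "M \<subseteq> Theta" using \<epsilon> by (auto simp: M_def Theta_eq)
  ultimately have M: "compact M" "M \<subseteq> Theta" by blast+
  have A_pos: "norm (\<theta> - \<gamma> t) < \<rho> * exp (K * t)" if "0 < A t \<theta>" for t \<theta>
  proof -
    have "(norm (\<theta> - \<gamma> t))\<^sup>2 < (\<rho> * exp (K * t))\<^sup>2"
      using that by (simp add: A_def r_def power2_norm_eq_inner)
    then show ?thesis using \<rho> by (rule_tac power2_less_imp_less) auto
  qed
  have off: "A t \<theta> \<le> 0 \<or> qf \<theta> - \<epsilon> \<le> 0" if t: "t \<in> {0..T}" and "\<theta> \<notin> M" for t \<theta>
  proof (rule ccontr)
    assume "\<not> ?thesis"
    then have a: "0 < A t \<theta>" "\<epsilon> < qf \<theta>" by auto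
    have "exp (K * t) \<le> exp (K * T)" using t K_pos by simp
    then have "\<rho> * exp (K * t) \<le> \<rho> * exp (K * T)" using \<rho> by simp
    moreover have "norm \<theta> \<le> norm (\<theta> - \<gamma> t) + norm (\<gamma> t)" using norm_triangle_sub[of \<theta> "\<gamma> t"] by simp
    ultimately have "norm \<theta> \<le> R" using A_pos[OF a(1)] B[OF t] by (simp add: R_def)
    then show False using a(2) that(2) by (simp add: M_def)
  qed
  have "(\<integral>\<theta>. \<Psi> 0 \<theta> \<partial>\<pi> 0) \<le> (\<integral>\<theta>. \<Psi> T \<theta> \<partial>\<pi> T)"
  proof (rule subsolution_integral_mono[OF _ T M(1), where D=D])
    fix t and \<theta> :: "'d param" assume t: "t \<in> {0..T}"
    show "\<Psi> t \<in> Cc_inf Theta"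
    proof (rule Cc_infI[OF _ M])
      show "Ck k (\<Psi> t)" for k
        unfolding \<Psi>_def A_def
        by (intro Ck_mult Ck_compose[OF smooth_real_bump] Ck_diff Ck_const Ck_dist_sq Ck_qf)
      show "\<theta> \<notin> M \<Longrightarrow> \<Psi> t \<theta> = 0" for \<theta>
        using off[OF t, of \<theta>] by (auto simp: \<Psi>_def bump_eq_0)
    qed
    show "\<theta> \<notin> M \<Longrightarrow> \<Psi> t \<theta> = 0" "\<theta> \<notin> M \<Longrightarrow> D t \<theta> = 0"
      using off[OF t, of \<theta>] by (auto simp: \<Psi>_def D_def bump_eq_0 bump'_eq_0)
    have "((\<lambda>s. A s \<theta>) has_real_derivative 2 * K * r t - 2 * ((\<theta> - \<gamma> t) \<bullet> V t (\<gamma> t))) (at t within {0..T})"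
    proof -
      have 1: "(r has_real_derivative 2 * K * r t) (at t within {0..T})"
        unfolding r_def by (auto intro!: derivative_eq_intros simp: power2_eq_square)
      have "((\<lambda>s. \<theta> - \<gamma> s) has_derivative (\<lambda>h. h *\<^sub>R V t (\<gamma> t))) (at t within {0..T})"
        using \<gamma>(2)[OF t] unfolding has_vector_derivative_def
        by (auto intro!: derivative_eq_intros)
      from has_derivative_inner[OF this this]
      have "((\<lambda>s. (\<theta> - \<gamma> s) \<bullet> (\<theta> - \<gamma> s)) has_real_derivative 2 * ((\<theta> - \<gamma> t) \<bullet> V t (\<gamma> t))) (at t within {0..T})"
        unfolding has_field_derivative_def
        by (rule has_derivative_eq_rhs) (simp add: fun_eq_iff inner_commute algebra_simps)
      from DERIV_diff[OF 1 this] show ?thesis unfolding A_def .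
    qed
    from DERIV_cmult_right[OF DERIV_chain2[OF bump_has_real_derivative this]]
    show "((\<lambda>s. \<Psi> s \<theta>) has_real_derivative D t \<theta>) (at t within {0..T})"
      unfolding \<Psi>_def D_def .
  next
    have c\<gamma>: "continuous_on ({0..T} \<times> UNIV) (\<lambda>p. \<gamma> (fst p))"
      by (rule continuous_on_compose2[OF \<gamma>_cont]) (auto intro!: continuous_intros)
    have "continuous_on ({0..T} \<times> UNIV) (\<lambda>p. (\<lambda>(t, \<theta>). V t \<theta>) (fst p, \<gamma> (fst p)))"
      by (rule continuous_on_compose2[OF V_continuous])
        (use \<gamma>(1) in \<open>auto intro!: continuous_intros c\<gamma> simp: Theta_eq less_imp_le\<close>)
    then have cV: "continuous_on ({0..T} \<times> UNIV) (\<lambda>p. V (fst p) (\<gamma> (fst p)))" by simp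
    have cA: "continuous_on ({0..T} \<times> UNIV) (\<lambda>p. A (fst p) (snd p))"
      unfolding A_def r_def by (intro continuous_intros c\<gamma>)
    have bc: "continuous_on UNIV bump"
      by (rule DERIV_continuous_on[OF has_field_derivative_at_within[OF bump_has_real_derivative]])
    have cq: "continuous_on ({0..T} \<times> UNIV) (\<lambda>p. qf (snd p))"
      by (rule continuous_on_compose2[OF continuous_on_qf]) (auto intro!: continuous_intros)
    show "continuous_on ({0..T} \<times> UNIV) (\<lambda>(t, \<theta>). D t \<theta>)"
      unfolding D_def case_prod_beta' r_def
      by (intro continuous_intros c\<gamma> cV continuous_on_compose2[OF bump'_continuous cA]
          continuous_on_compose2[OF bc] cq) auto
  next
    fix t and \<theta> :: "'d param" assume t: "0 < t" "t < T" and \<theta>: "\<theta> \<in> Theta"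
    have tT: "t \<in> {0..T}" and t0: "0 \<le> t" using t by auto
    let ?G = "bump (A t \<theta>) *\<^sub>R (bump' (qf \<theta> - \<epsilon>) *\<^sub>R (2 *\<^sub>R (- fst \<theta>, snd \<theta>)))
      + bump (qf \<theta> - \<epsilon>) *\<^sub>R (bump' (A t \<theta>) *\<^sub>R (- 2 *\<^sub>R (\<theta> - \<gamma> t)))"
    have dA: "((\<lambda>\<theta>. A t \<theta>) has_derivative (\<lambda>v. (- 2 *\<^sub>R (\<theta> - \<gamma> t)) \<bullet> v)) (at \<theta>)"
      unfolding A_def using has_derivative_diff[OF has_derivative_const has_derivative_dist_sq] by simp
    have dq: "((\<lambda>\<theta>. qf \<theta> - \<epsilon>) has_derivative (\<lambda>v. (2 *\<^sub>R (- fst \<theta>, snd \<theta>)) \<bullet> v)) (at \<theta>)"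
      using has_derivative_diff[OF has_derivative_qf has_derivative_const] by simp
    have "((\<lambda>\<theta>. \<Psi> t \<theta>) has_derivative (\<lambda>v. ?G \<bullet> v)) (at \<theta>)"
      unfolding \<Psi>_def
      by (rule has_derivative_inner_mult[OF has_derivative_inner_bump[OF dA] has_derivative_inner_bump[OF dq]])
    then have "grad (\<Psi> t) \<theta> = ?G" by (rule grad_eq)
    moreover have "(- fst \<theta>, snd \<theta>) \<bullet> V t \<theta> = 0"
      using vel_inner_conserved[OF bounded_density_flow[OF t0], of \<theta>] by (simp add: inner_commute)
    ultimately have g: "grad (\<Psi> t) \<theta> \<bullet> V t \<theta> = bump' (A t \<theta>) * (- 2 * ((\<theta> - \<gamma> t) \<bullet> V t \<theta>)) * bump (qf \<theta> - \<epsilon>)"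
      by (simp only: inner_add_left inner_scaleR_left mult_zero_right add_0_left mult.assoc mult.left_commute mult.commute)
    have "bump' (A t \<theta>) * (- 2 * ((\<theta> - \<gamma> t) \<bullet> V t \<theta>)) \<le> bump' (A t \<theta>) * (2 * K * r t - 2 * ((\<theta> - \<gamma> t) \<bullet> V t (\<gamma> t)))"
    proof (cases "0 < A t \<theta>")
      case True
      have "(\<theta> - \<gamma> t) \<bullet> (V t (\<gamma> t) - V t \<theta>) \<le> norm (\<theta> - \<gamma> t) * norm (V t (\<gamma> t) - V t \<theta>)"
        by (rule norm_cauchy_schwarz)
      also have "\<dots> \<le> norm (\<theta> - \<gamma> t) * (K * norm (\<gamma> t - \<theta>))"
        using \<theta> by (intro mult_left_mono V_lipschitz[OF t0]) (auto simp: Theta_eq)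
      also have "\<dots> = K * (norm (\<theta> - \<gamma> t))\<^sup>2" by (simp add: norm_minus_commute power2_eq_square)
      also have "\<dots> \<le> K * r t"
        using K_pos True by (intro mult_left_mono) (auto simp: A_def power2_norm_eq_inner)
      finally show ?thesis
        by (intro mult_left_mono bump'_nonneg) (simp add: inner_diff_right)
    qed (simp add: bump'_eq_0)
    then show "grad (\<Psi> t) \<theta> \<bullet> V t \<theta> \<le> D t \<theta>"
      unfolding g D_def by (intro mult_right_mono bump_nonneg)
  qed (use M in auto)
  moreover have \<Psi>i: "integrable (\<pi> t) (\<Psi> t)" if t: "t \<in> {0..T}" for t
  proof (rule integrable_continuous_compact_support[OF _ _ M(1)])
    have "Ck 0 (\<Psi> t)"
      unfolding \<Psi>_def A_def
      by (intro Ck_mult Ck_compose[OF smooth_real_bump] Ck_diff Ck_const Ck_dist_sq Ck_qf)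
    then show "continuous_on M (\<Psi> t)" by (auto intro: continuous_on_subset)
    show "\<theta> \<notin> M \<Longrightarrow> \<Psi> t \<theta> = 0" for \<theta>
      using off[OF t, of \<theta>] by (auto simp: \<Psi>_def bump_eq_0)
  qed (use t in auto)
  have T0T: "0 \<in> {0..T}" "T \<in> {0..T}" using T by auto
  have \<Psi>_nonneg: "0 \<le> \<Psi> t \<theta>" for t \<theta> by (simp add: \<Psi>_def bump_nonneg)
  have sp: "space (\<pi> t) = UNIV" if "0 \<le> t" for t using P2_D(2)[OF flow_P2[OF that]] .
  have se: "sets (\<pi> t) = sets borel" if "0 \<le> t" for t using P2_D(1)[OF flow_P2[OF that]] .
  have "0 < (\<integral>\<theta>. \<Psi> 0 \<theta> \<partial>\<pi> 0)"
    unfolding integral_pos_iff[OF \<Psi>i[OF T0T(1)] \<Psi>_nonneg]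
  proof (rule less_le_trans[OF pos emeasure_mono])
    show "{x \<in> space (\<pi> 0). \<Psi> 0 x \<noteq> 0} \<in> sets (\<pi> 0)"
      using borel_measurable_integrable[OF \<Psi>i[OF T0T(1)]] by measurable
    show "ball (\<gamma> 0) \<rho> \<inter> {\<theta>. \<epsilon> < qf \<theta>} \<subseteq> {x \<in> space (\<pi> 0). \<Psi> 0 x \<noteq> 0}"
    proof (intro subsetI CollectI conjI)
      fix \<theta> assume \<theta>: "\<theta> \<in> ball (\<gamma> 0) \<rho> \<inter> {\<theta>. \<epsilon> < qf \<theta>}"
      then have "(norm (\<theta> - \<gamma> 0))\<^sup>2 < \<rho>\<^sup>2"
        by (intro power_strict_mono) (auto simp: dist_norm norm_minus_commute)
      then have "0 < A 0 \<theta>" by (simp add: A_def r_def power2_norm_eq_inner)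
      then have "0 < bump (A 0 \<theta>)" "0 < bump (qf \<theta> - \<epsilon>)" using \<theta> by (auto simp: bump_pos_iff)
      then show "\<Psi> 0 \<theta> \<noteq> 0" by (simp add: \<Psi>_def)
    qed (simp add: sp)
  qed
  ultimately have "0 < (\<integral>\<theta>. \<Psi> T \<theta> \<partial>\<pi> T)" by linarith
  then have "0 < emeasure (\<pi> T) {x \<in> space (\<pi> T). \<Psi> T x \<noteq> 0}"
    unfolding integral_pos_iff[OF \<Psi>i[OF T0T(2)] \<Psi>_nonneg] .
  also have "\<dots> \<le> emeasure (\<pi> T) (ball (\<gamma> T) (\<rho> * exp (K * T)) \<inter> Theta)"
  proof (rule emeasure_mono)
    show "{x \<in> space (\<pi> T). \<Psi> T x \<noteq> 0} \<subseteq> ball (\<gamma> T) (\<rho> * exp (K * T)) \<inter> Theta"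
    proof
      fix \<theta> assume "\<theta> \<in> {x \<in> space (\<pi> T). \<Psi> T x \<noteq> 0}"
      then have "0 < A T \<theta>" "\<epsilon> < qf \<theta>"
        using bump_eq_0[of "A T \<theta>"] bump_eq_0[of "qf \<theta> - \<epsilon>"] by (auto simp: \<Psi>_def not_le[symmetric])
      then show "\<theta> \<in> ball (\<gamma> T) (\<rho> * exp (K * T)) \<inter> Theta"
        using A_pos[of T \<theta>] \<epsilon> by (auto simp: Theta_eq dist_norm norm_minus_commute)
    qed
    show "ball (\<gamma> T) (\<rho> * exp (K * T)) \<inter> Theta \<in> sets (\<pi> T)"
      unfolding se[OF T] by (intro borel_open open_Int open_ball open_Theta)
  qed
  finally show ?thesis .
qed

text \<open>A point of the target cone is traced back to time 0. A ball around its origin may carry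
  no mass, since omni-directionality only speaks of cones, but the cone generated by that ball does.
  As velocities are homogeneous of degree 1, multiples of a characteristic are characteristics, so
  whichever scaled ball carries mass can be carried forward and lands in the target cone.\<close>

theorem omnidirectional_flow:
  assumes omni: "omnidirectional (\<pi> 0)" and T: "0 \<le> T"
  shows "omnidirectional (\<pi> T)"
  unfolding omnidirectional_def
proof (intro allI impI, elim conjE)
  fix U :: "'d param set"
  assume U: "open U" "U \<noteq> {}" "U \<subseteq> Theta" "\<forall>\<theta>\<in>U. \<forall>c>0. c *\<^sub>R \<theta> \<in> U"
  then obtain \<omega> where \<omega>: "\<omega> \<in> U" by blast
  then have "\<omega> \<in> Theta" using U(3) by blast
  from backward_characteristic[OF T this] obtain \<gamma> where \<gamma>: "\<gamma> T = \<omega>"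
    "\<And>t. t \<in> {0..T} \<Longrightarrow> \<gamma> t \<in> Theta"
    "\<And>t. t \<in> {0..T} \<Longrightarrow> (\<gamma> has_vector_derivative - V t (\<gamma> t)) (at t within {0..T})" by blast
  obtain \<rho>1 where \<rho>1: "0 < \<rho>1" "ball \<omega> \<rho>1 \<subseteq> U" using U(1) \<omega> by (auto simp: open_contains_ball)
  \<comment> \<open>Shrunk in advance by the factor exp(K T) by which the moving ball will have
    grown at time \<open>T\<close>.\<close>
  define \<rho> where "\<rho> = \<rho>1 * exp (- (K * T))"
  have \<rho>: "0 < \<rho>" using \<rho>1 by (simp add: \<rho>_def)
  define Q where "Q = (\<Union>c\<in>{0<..}. ball (c *\<^sub>R \<gamma> 0) (c * \<rho>)) \<inter> Theta"
  have dist_scale: "dist (c *\<^sub>R x) (c *\<^sub>R y) = c * dist x y" if "0 < c" for c and x y :: "'d param"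
    using that by (simp add: dist_norm flip: scaleR_diff_right)
  have Q_pos: "0 < emeasure (\<pi> 0) Q"
  proof (rule omni[unfolded omnidirectional_def, rule_format], intro conjI ballI allI impI)
    show "open Q"
      unfolding Q_def by (intro open_Int open_UN ballI open_ball open_Theta)
    have "\<gamma> 0 \<in> ball (1 *\<^sub>R \<gamma> 0) (1 * \<rho>)" using \<rho> by simp
    moreover have "\<gamma> 0 \<in> Theta" using \<gamma>(2)[of 0] T by simp
    ultimately have "\<gamma> 0 \<in> Q" unfolding Q_def using zero_less_one by blast
    then show "Q \<noteq> {}" by blast
    show "Q \<subseteq> Theta" by (simp add: Q_def)
    fix \<theta> and c :: real assume Q: "\<theta> \<in> Q" "0 < c"
    then obtain c' where c': "0 < c'" "\<theta> \<in> ball (c' *\<^sub>R \<gamma> 0) (c' * \<rho>)" "\<theta> \<in> Theta"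
      unfolding Q_def by blast
    have "dist ((c * c') *\<^sub>R \<gamma> 0) (c *\<^sub>R \<theta>) < (c * c') * \<rho>"
      using dist_scale[OF Q(2), of "c' *\<^sub>R \<gamma> 0" \<theta>] c'(2) Q(2) by simp
    then have "c *\<^sub>R \<theta> \<in> ball ((c * c') *\<^sub>R \<gamma> 0) ((c * c') * \<rho>)" by simp
    moreover have "c * c' \<in> {0<..}" using Q(2) c'(1) by simp
    ultimately show "c *\<^sub>R \<theta> \<in> Q" unfolding Q_def using Theta_scaleR[OF c'(3) Q(2)] by blast
  qed
  \<comment> \<open>Rational scales and margins 1 / (n + 1) in \<open>qf\<close>, enumerated
    together, so that countable subadditivity finds one ball with positive mass at a definite
    distance from the boundary.\<close>
  define cc :: "nat \<Rightarrow> real" where "cc i = real_of_rat (from_nat (fst (prod_decode i)))" for i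
  define ee :: "nat \<Rightarrow> real" where "ee i = 1 / real (Suc (snd (prod_decode i)))" for i
  define S where "S i = ball (cc i *\<^sub>R \<gamma> 0) (cc i * \<rho>) \<inter> {\<theta>. ee i < qf \<theta>}" for i
  have S_open: "open (S i)" for i
    unfolding S_def by (intro open_Int open_ball open_Collect_less continuous_on_qf continuous_on_const)
  have "Q \<subseteq> (\<Union>i. S i)"
  proof
    fix \<theta> assume "\<theta> \<in> Q"
    then obtain c where c: "0 < c" "dist (c *\<^sub>R \<gamma> 0) \<theta> < c * \<rho>" and \<theta>: "0 < qf \<theta>"
      unfolding Q_def Theta_eq by auto
    note c(2)
    moreover have "open {s. dist (s *\<^sub>R \<gamma> 0) \<theta> < s * \<rho>}"
      by (intro open_Collect_less continuous_intros)
    ultimately obtain e where e: "0 < e" "ball c e \<subseteq> {s. dist (s *\<^sub>R \<gamma> 0) \<theta> < s * \<rho>}"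
      unfolding open_contains_ball by blast
    obtain s where s: "s \<in> \<rat>" "c < s" "s < c + e" using Rats_dense_in_real[of c "c + e"] e(1) by auto
    then have "dist (s *\<^sub>R \<gamma> 0) \<theta> < s * \<rho>" using e(2) by (auto simp: dist_real_def subset_eq)
    moreover obtain k :: nat where k: "s = real_of_rat (from_nat k)"
    proof -
      obtain q where "s = real_of_rat q" using s(1) by (rule Rats_cases)
      moreover obtain k :: nat where "q = from_nat k" using surjD[OF surj_from_nat, of q] by blast
      ultimately show ?thesis using that by blast
    qed
    moreover obtain n where n: "1 / real (Suc n) < qf \<theta>"
      using reals_Archimedean[OF \<theta>] by (auto simp: inverse_eq_divide)
    ultimately have "\<theta> \<in> S (prod_encode (k, n))" by (simp add: S_def cc_def ee_def)
    then show "\<theta> \<in> (\<Union>i. S i)" by blast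
  qed
  then have "emeasure (\<pi> 0) Q \<le> emeasure (\<pi> 0) (\<Union>i. S i)"
    using S_open P2_D(1)[OF flow_P2[of 0]] by (intro emeasure_mono) (auto intro!: borel_open)
  with Q_pos have "0 < emeasure (\<pi> 0) (\<Union>i. S i)" by (rule less_le_trans)
  then obtain i where i: "0 < emeasure (\<pi> 0) (S i)"
    using S_open P2_D(1)[OF flow_P2[of 0]] by (elim emeasure_pos_countable_Union) (auto intro!: borel_open)
  \<comment> \<open>The enumeration contains nonpositive rationals too; for those the ball is empty,
    so positive mass forces a positive scale.\<close>
  then have "S i \<noteq> {}" by force
  then obtain \<theta> where "dist (cc i *\<^sub>R \<gamma> 0) \<theta> < cc i * \<rho>" unfolding S_def by auto
  then have "0 < cc i * \<rho>" by (rule le_less_trans[OF zero_le_dist])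
  then have c: "0 < cc i" using \<rho> by (simp add: zero_less_mult_iff)
  have "0 < emeasure (\<pi> T) (ball (cc i *\<^sub>R \<gamma> T) (cc i * \<rho> * exp (K * T)) \<inter> Theta)"
  proof (rule moving_ball[OF T, where \<epsilon>="ee i"])
    fix t assume t: "t \<in> {0..T}"
    show "cc i *\<^sub>R \<gamma> t \<in> Theta" using \<gamma>(2)[OF t] c by (rule Theta_scaleR)
    have "((\<lambda>t. cc i *\<^sub>R \<gamma> t) has_vector_derivative cc i *\<^sub>R (- V t (\<gamma> t))) (at t within {0..T})"
      using bounded_linear.has_vector_derivative[OF bounded_linear_scaleR_right \<gamma>(3)[OF t]] .
    then show "((\<lambda>t. cc i *\<^sub>R \<gamma> t) has_vector_derivative - V t (cc i *\<^sub>R \<gamma> t)) (at t within {0..T})"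
      using vel_scaleR[OF c] by simp
  qed (use c \<rho> i in \<open>auto simp: S_def ee_def\<close>)
  also have "\<dots> \<le> emeasure (\<pi> T) U"
  proof (rule emeasure_mono)
    show "U \<in> sets (\<pi> T)" using P2_D(1)[OF flow_P2[OF T]] U(1) by auto
    show "ball (cc i *\<^sub>R \<gamma> T) (cc i * \<rho> * exp (K * T)) \<inter> Theta \<subseteq> U"
    proof
      fix \<theta> assume "\<theta> \<in> ball (cc i *\<^sub>R \<gamma> T) (cc i * \<rho> * exp (K * T)) \<inter> Theta"
      moreover have "cc i * \<rho> * exp (K * T) = cc i * \<rho>1" by (simp add: \<rho>_def exp_minus)
      ultimately have d: "dist (cc i *\<^sub>R \<omega>) \<theta> < cc i * \<rho>1" by (simp add: \<gamma>(1))
      have "dist (cc i *\<^sub>R \<omega>) \<theta> = dist (cc i *\<^sub>R \<omega>) (cc i *\<^sub>R ((1 / cc i) *\<^sub>R \<theta>))" using c by simp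
      also have "\<dots> = cc i * dist \<omega> ((1 / cc i) *\<^sub>R \<theta>)" by (rule dist_scale[OF c])
      finally have "(1 / cc i) *\<^sub>R \<theta> \<in> ball \<omega> \<rho>1" using d c by simp
      then have "cc i *\<^sub>R ((1 / cc i) *\<^sub>R \<theta>) \<in> U" using \<rho>1(2) U(4) c by blast
      then show "\<theta> \<in> U" using c by simp
    qed
  qed
  finally show "0 < emeasure (\<pi> T) U" .
qed

end

subsection \<open>Smooth approximation of potentials\<close>

lemma softplus_lipschitz:
  assumes "0 < k"
  shows "\<bar>softplus k s - softplus k s'\<bar> \<le> \<bar>s - s'\<bar>"
proof -
  have "norm (softplus k s - softplus k s') \<le> 1 * norm (s - s')"
    by (rule field_differentiable_bound[of UNIV _ "\<lambda>z. logistic (k * z)"])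
       (use softplus_has_real_derivative[OF assms] logistic_bounds in \<open>auto simp: abs_of_nonneg\<close>)
  then show ?thesis by simp
qed

lemma logistic_lipschitz:
  assumes "0 < k"
  shows "\<bar>logistic (k * s) - logistic (k * s')\<bar> \<le> k * \<bar>s - s'\<bar>"
proof -
  have "\<bar>k * (logistic (k * z) * (1 - logistic (k * z)))\<bar> \<le> k" for z
  proof -
    have "\<bar>logistic (k * z) * (1 - logistic (k * z))\<bar> \<le> 1 * 1"
      unfolding abs_mult using logistic_bounds[of "k * z"] by (intro mult_mono) auto
    then show ?thesis using assms by (simp add: abs_mult)
  qed
  then have "norm (logistic (k * s) - logistic (k * s')) \<le> k * norm (s - s')"
    by (intro field_differentiable_bound[of UNIV _ "\<lambda>z. k * (logistic (k * z) * (1 - logistic (k * z)))"])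
       (auto simp: logistic_has_real_derivative)
  then show ?thesis by simp
qed

lemma logistic_diff_le_1: "\<bar>logistic z - logistic z'\<bar> \<le> 1"
  using logistic_bounds[of z] logistic_bounds[of z'] by linarith

lemma logistic_relu'_diff_le_1: "\<bar>logistic z - relu' s\<bar> \<le> 1"
  using logistic_bounds[of z] by (auto simp: relu'_def)

lemma inner_snd_le: "norm \<theta> \<le> R \<Longrightarrow> \<bar>snd \<theta> \<bullet> X - snd \<theta> \<bullet> Y\<bar> \<le> R * norm (X - Y)"
  for \<theta> :: "'d::finite param"
  unfolding inner_diff_right[symmetric]
  by (rule order_trans[OF Cauchy_Schwarz_ineq2]) (auto intro!: mult_right_mono order_trans[OF norm_snd_param])

text \<open>Here \<open>X\<close> is the true lifted input and \<open>Y\<close> its quantised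
  version. The gradient error comes from moving the input, from the resulting change in the logistic
  factor, and from replacing the step by the logistic function. The minimum with 1 keeps the second
  error dominated by |X| independently of \<open>k\<close>, which dominated convergence will
  need.\<close>

lemma softplus_neuron_approx:
  fixes \<theta> :: "'d::finite param"
  assumes k: "0 < k" and R: "norm \<theta> \<le> R"
  shows "\<bar>fst \<theta> * softplus k (snd \<theta> \<bullet> Y) - fst \<theta> * relu (snd \<theta> \<bullet> X)\<bar> \<le> R * (R * norm (X - Y) + 1 / k)"
    and "norm ((softplus k (snd \<theta> \<bullet> Y), (fst \<theta> * logistic (k * (snd \<theta> \<bullet> Y))) *\<^sub>R Y)
          - (relu (snd \<theta> \<bullet> X), (fst \<theta> * relu' (snd \<theta> \<bullet> X)) *\<^sub>R X))
        \<le> (R * norm (X - Y) + 1 / k)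
          + R * (norm (X - Y) + min 1 (k * R * norm (X - Y)) * norm X
            + \<bar>logistic (k * (snd \<theta> \<bullet> X)) - relu' (snd \<theta> \<bullet> X)\<bar> * norm X)"
proof -
  let ?s = "snd \<theta> \<bullet> X" and ?t = "snd \<theta> \<bullet> Y"
  have R0: "0 \<le> R" using R norm_ge_zero order_trans by blast
  have a: "\<bar>fst \<theta>\<bar> \<le> R" using norm_fst_param[of \<theta>] R by linarith
  have st: "\<bar>?t - ?s\<bar> \<le> R * norm (X - Y)" using inner_snd_le[OF R, of X Y] by (simp add: abs_minus_commute)
  have 1: "\<bar>softplus k ?t - relu ?s\<bar> \<le> R * norm (X - Y) + 1 / k"
    using softplus_lipschitz[OF k, of ?t ?s] softplus_approx[OF k, of ?s] st by linarith
  show "\<bar>fst \<theta> * softplus k ?t - fst \<theta> * relu ?s\<bar> \<le> R * (R * norm (X - Y) + 1 / k)"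
    unfolding right_diff_distrib[symmetric] abs_mult using 1 a R0 by (intro mult_mono) auto
  have L: "\<bar>logistic (k * ?t) - logistic (k * ?s)\<bar> \<le> min 1 (k * R * norm (X - Y))"
  proof -
    have "k * \<bar>?t - ?s\<bar> \<le> k * (R * norm (X - Y))" using k st by (intro mult_left_mono) auto
    then show ?thesis
      using logistic_lipschitz[OF k, of ?t ?s] logistic_diff_le_1[of "k * ?t" "k * ?s"] by simp
  qed
  have "logistic (k * ?t) *\<^sub>R Y - relu' ?s *\<^sub>R X = logistic (k * ?t) *\<^sub>R (Y - X)
      + (logistic (k * ?t) - logistic (k * ?s)) *\<^sub>R X + (logistic (k * ?s) - relu' ?s) *\<^sub>R X"
    by (simp add: algebra_simps)
  then have "norm (logistic (k * ?t) *\<^sub>R Y - relu' ?s *\<^sub>R X) \<le> norm (logistic (k * ?t) *\<^sub>R (Y - X))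
      + norm ((logistic (k * ?t) - logistic (k * ?s)) *\<^sub>R X) + norm ((logistic (k * ?s) - relu' ?s) *\<^sub>R X)"
    using norm_triangle_ineq[of "logistic (k * ?t) *\<^sub>R (Y - X) + (logistic (k * ?t) - logistic (k * ?s)) *\<^sub>R X"]
      norm_triangle_ineq[of "logistic (k * ?t) *\<^sub>R (Y - X)"] by (smt (verit))
  also have "\<dots> \<le> norm (X - Y) + min 1 (k * R * norm (X - Y)) * norm X + \<bar>logistic (k * ?s) - relu' ?s\<bar> * norm X"
  proof -
    have "logistic (k * ?t) * norm (Y - X) \<le> 1 * norm (Y - X)"
      using logistic_bounds by (intro mult_right_mono) auto
    moreover have "\<bar>logistic (k * ?t) - logistic (k * ?s)\<bar> * norm X \<le> min 1 (k * R * norm (X - Y)) * norm X"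
      using L by (intro mult_right_mono) auto
    ultimately show ?thesis using logistic_bounds(1)[of "k * ?t"] by (simp add: norm_minus_commute)
  qed
  finally have 2: "norm (logistic (k * ?t) *\<^sub>R Y - relu' ?s *\<^sub>R X) \<le> \<dots>" .
  have "(fst \<theta> * logistic (k * ?t)) *\<^sub>R Y - (fst \<theta> * relu' ?s) *\<^sub>R X
      = fst \<theta> *\<^sub>R (logistic (k * ?t) *\<^sub>R Y - relu' ?s *\<^sub>R X)"
    by (simp add: scaleR_diff_right)
  then have "norm ((fst \<theta> * logistic (k * ?t)) *\<^sub>R Y - (fst \<theta> * relu' ?s) *\<^sub>R X)
      = \<bar>fst \<theta>\<bar> * norm (logistic (k * ?t) *\<^sub>R Y - relu' ?s *\<^sub>R X)" by simp
  also have "\<dots> \<le> R * (norm (X - Y) + min 1 (k * R * norm (X - Y)) * norm X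
            + \<bar>logistic (k * ?s) - relu' ?s\<bar> * norm X)"
    using 2 a R0 by (intro mult_mono) auto
  finally have 3: "norm ((fst \<theta> * logistic (k * ?t)) *\<^sub>R Y - (fst \<theta> * relu' ?s) *\<^sub>R X) \<le> \<dots>" .
  have "norm ((softplus k ?t, (fst \<theta> * logistic (k * ?t)) *\<^sub>R Y) - (relu ?s, (fst \<theta> * relu' ?s) *\<^sub>R X))
      \<le> norm (softplus k ?t - relu ?s) + norm ((fst \<theta> * logistic (k * ?t)) *\<^sub>R Y - (fst \<theta> * relu' ?s) *\<^sub>R X)"
    unfolding diff_Pair by (rule norm_Pair_le)
  then show "norm ((softplus k ?t, (fst \<theta> * logistic (k * ?t)) *\<^sub>R Y) - (relu ?s, (fst \<theta> * relu' ?s) *\<^sub>R X))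
        \<le> (R * norm (X - Y) + 1 / k)
          + R * (norm (X - Y) + min 1 (k * R * norm (X - Y)) * norm X + \<bar>logistic (k * ?s) - relu' ?s\<bar> * norm X)"
    using 1 3 by simp
qed

lemma softplus_neuron_has_derivative:
  fixes \<theta> :: "'d::finite param"
  assumes "0 < k"
  shows "((\<lambda>\<theta>. fst \<theta> * softplus k (snd \<theta> \<bullet> Y)) has_derivative
    (\<lambda>v. (softplus k (snd \<theta> \<bullet> Y), (fst \<theta> * logistic (k * (snd \<theta> \<bullet> Y))) *\<^sub>R Y) \<bullet> v)) (at \<theta>)"
proof -
  have "((\<lambda>\<theta>. snd \<theta> \<bullet> Y) has_derivative (\<lambda>v. snd v \<bullet> Y)) (at \<theta>)"
    by (auto intro!: derivative_eq_intros)
  from has_derivative_compose[OF this, of "softplus k" "\<lambda>v. logistic (k * (snd \<theta> \<bullet> Y)) * v"]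
  have "((\<lambda>\<theta>. softplus k (snd \<theta> \<bullet> Y)) has_derivative (\<lambda>v. logistic (k * (snd \<theta> \<bullet> Y)) * (snd v \<bullet> Y))) (at \<theta>)"
    using softplus_has_real_derivative[OF assms, of "snd \<theta> \<bullet> Y"] by (simp add: has_field_derivative_def)
  from has_derivative_mult[OF has_derivative_fst[OF has_derivative_ident] this]
  show ?thesis
    by (rule has_derivative_eq_rhs) (auto simp: fun_eq_iff inner_prod_def[of "(_, _)"] inner_commute algebra_simps)
qed

lemma Ck_softplus_neuron:
  assumes "0 < k"
  shows "Ck n (\<lambda>\<theta>::'d::finite param. fst \<theta> * softplus k (snd \<theta> \<bullet> Y))"
proof -
  have "bounded_linear (\<lambda>\<theta>::'d param. snd \<theta> \<bullet> Y)"
    by (rule bounded_linear_inner_left_comp[OF bounded_linear_snd])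
  then show ?thesis
    by (rule Ck_mult[OF Ck_linear[OF bounded_linear_fst] Ck_compose[OF smooth_real_softplus[OF assms] Ck_linear]])
qed

context relu_data
begin

text \<open>Inside the slab of half-width \<tau> the integrand is at most the weight and the slab
  mass is O(\<tau>); outside, the logistic function is exponentially close to the step.\<close>

lemma logistic_slab_le:
  assumes u: "u \<noteq> 0" and \<tau>: "0 < \<tau>" "4 * \<tau> \<le> norm u" and k: "0 < k"
  shows "(\<integral>z. \<bar>logistic (k * (u \<bullet> lift1 (fst z))) - relu' (u \<bullet> lift1 (fst z))\<bar> * wt z \<partial>P)
    \<le> 16 * L * \<tau> / norm u + exp (- k * \<tau>) * mom"
proof -
  let ?S = "{z :: (real ^ 'd) \<times> real. \<bar>u \<bullet> lift1 (fst z)\<bar> \<le> \<tau>}"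
  have i1: "integrable P (\<lambda>z. wt z * indicator ?S z)"
    by (rule integrable_le_wt[where c=1]) (auto simp: wt_nonneg indicator_def)
  have "(\<integral>z. \<bar>logistic (k * (u \<bullet> lift1 (fst z))) - relu' (u \<bullet> lift1 (fst z))\<bar> * wt z \<partial>P)
      \<le> (\<integral>z. wt z * indicator ?S z + exp (- k * \<tau>) * wt z \<partial>P)"
  proof (rule integral_mono)
    have lm: "logistic \<in> borel_measurable borel"
      unfolding logistic_def[abs_def] by measurable
    then show "integrable P (\<lambda>z. \<bar>logistic (k * (u \<bullet> lift1 (fst z))) - relu' (u \<bullet> lift1 (fst z))\<bar> * wt z)"
    proof (intro integrable_le_wt[where c=1])
      fix z :: "(real ^ 'd) \<times> real"
      show "norm (\<bar>logistic (k * (u \<bullet> lift1 (fst z))) - relu' (u \<bullet> lift1 (fst z))\<bar> * wt z) \<le> 1 * wt z"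
        using mult_right_mono[OF logistic_relu'_diff_le_1 wt_nonneg[of z]] wt_nonneg[of z] by (simp add: abs_mult)
    next
      note [measurable] = lm
      show "(\<lambda>z. \<bar>logistic (k * (u \<bullet> lift1 (fst z))) - relu' (u \<bullet> lift1 (fst z))\<bar> * wt z) \<in> borel_measurable P"
        by measurable
    qed
    show "integrable P (\<lambda>z. wt z * indicator ?S z + exp (- k * \<tau>) * wt z)"
      by (intro Bochner_Integration.integrable_add i1 integrable_mult_right integrable_wt)
    fix z :: "(real ^ 'd) \<times> real"
    show "\<bar>logistic (k * (u \<bullet> lift1 (fst z))) - relu' (u \<bullet> lift1 (fst z))\<bar> * wt z
        \<le> wt z * indicator ?S z + exp (- k * \<tau>) * wt z"
    proof (cases "z \<in> ?S")
      case True
      from mult_right_mono[OF logistic_relu'_diff_le_1 wt_nonneg[of z]] show ?thesis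
        using True wt_nonneg[of z] by (simp add: add_increasing2)
    next
      case False
      then have "\<tau> \<le> \<bar>u \<bullet> lift1 (fst z)\<bar>" by simp
      from mult_right_mono[OF logistic_approx[OF k \<tau>(1) this] wt_nonneg[of z]] show ?thesis
        using False by simp
    qed
  qed
  also have "\<dots> = (\<integral>z. wt z * indicator ?S z \<partial>P) + exp (- k * \<tau>) * mom"
    unfolding mom_def using i1 integrable_wt by simp
  also have "(\<integral>z. wt z * indicator ?S z \<partial>P) \<le> 16 * L * \<tau> / norm u"
    by (rule slab_le[OF u \<tau>])
  finally show ?thesis by simp
qed

text \<open>Quantising the inputs to finitely many values turns the integral into a finite sum,
  whose smoothness in the parameter needs no differentiation under the integral sign.\<close>

lemma integral_simple_function_compose:
  fixes g :: "'b \<Rightarrow> 'c::euclidean_space"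
  assumes h: "bounded_density C h" and F: "simple_function P F"
  shows "(\<integral>z. h z *\<^sub>R g (F z) \<partial>P) = (\<Sum>y\<in>range F. (\<integral>z. h z * indicator (F -` {y}) z \<partial>P) *\<^sub>R g y)"
    and "integrable P (\<lambda>z. h z *\<^sub>R g (F z))"
proof -
  have fin: "finite (range F)" and meas: "F -` {y} \<in> sets P" for y
    using simple_functionD(1)[OF F] simple_functionD(2)[OF F, of "{y}"] by auto
  have int: "integrable P (\<lambda>z. h z * indicator (F -` {y}) z)" for y
  proof (rule integrable_const_bound[of _ C])
    note [measurable] = bounded_densityD(1)[OF h] meas[of y]
    show "(\<lambda>z. h z * indicator (F -` {y}) z) \<in> borel_measurable P" by measurable
  qed (use bounded_densityD(2,3)[OF h] in \<open>auto simp: indicator_def\<close>)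
  have eq: "h z *\<^sub>R g (F z) = (\<Sum>y\<in>range F. (h z * indicator (F -` {y}) z) *\<^sub>R g y)" for z
  proof -
    have "(\<Sum>y\<in>range F. (h z * indicator (F -` {y}) z) *\<^sub>R g y) = (\<Sum>y\<in>range F. if y = F z then h z *\<^sub>R g y else 0)"
      by (intro sum.cong) (auto simp: indicator_def)
    also have "\<dots> = h z *\<^sub>R g (F z)" using fin by (simp add: sum.delta)
    finally show ?thesis by simp
  qed
  show "(\<integral>z. h z *\<^sub>R g (F z) \<partial>P) = (\<Sum>y\<in>range F. (\<integral>z. h z * indicator (F -` {y}) z \<partial>P) *\<^sub>R g y)"
    unfolding eq by (subst Bochner_Integration.integral_sum) (simp_all add: int)
  show "integrable P (\<lambda>z. h z *\<^sub>R g (F z))"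
    unfolding eq by (intro Bochner_Integration.integrable_sum integrable_scaleR_left int)
qed

text \<open>Dominated convergence: the simple approximants of the input are bounded by twice its
  norm, and the truncated term by the weight.\<close>

lemma simple_function_lift1_approx:
  assumes "0 < e" and k: "0 \<le> k"
  obtains F where "simple_function P F"
    "integrable P (\<lambda>z. norm (lift1 (fst z) - lift1 (F z)) + min 1 (k * norm (lift1 (fst z) - lift1 (F z))) * wt z)"
    "(\<integral>z. norm (lift1 (fst z) - lift1 (F z)) + min 1 (k * norm (lift1 (fst z) - lift1 (F z))) * wt z \<partial>P) < e"
proof -
  obtain F where F: "\<And>i. simple_function P (F i)" "\<And>z. (\<lambda>i. F i z) \<longlonglongrightarrow> fst z"
    "\<And>i z. dist (F i z) 0 \<le> 2 * dist (fst z) 0"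
  proof -
    obtain F where F: "\<forall>i. simple_function P (F i)" "\<forall>x\<in>space P. (\<lambda>i. F i x) \<longlonglongrightarrow> fst x"
      "\<forall>i. \<forall>x\<in>space P. dist (F i x) 0 \<le> 2 * dist (fst x) 0"
      using borel_measurable_implies_sequence_metric[OF fst_P_measurable, of 0] by blast
    show ?thesis
    proof (rule that[of F])
      show "simple_function P (F i)" for i using F(1) by blast
      show "(\<lambda>i. F i z) \<longlonglongrightarrow> fst z" for z by (rule F(2)[rule_format]) simp
      show "dist (F i z) 0 \<le> 2 * dist (fst z) 0" for i z by (rule F(3)[rule_format]) simp
    qed
  qed
  define G where "G i z = norm (fst z - F i z) + min 1 (k * norm (fst z - F i z)) * wt z" for i z
  have G_eq: "norm (lift1 (fst z) - lift1 (F i z)) + min 1 (k * norm (lift1 (fst z) - lift1 (F i z))) * wt z = G i z" for i z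
    by (simp add: lift1_def norm_prod_def G_def)
  have [measurable]: "F i \<in> borel_measurable P" for i
    using F(1) by (rule borel_measurable_simple_function)
  have Gm: "G i \<in> borel_measurable P" for i
    unfolding G_def by measurable
  have bound: "norm (G i z) \<le> 4 * wt z" for i z
  proof -
    have "norm (fst z - F i z) \<le> 3 * norm (fst z)"
      using F(3)[of i z] norm_triangle_ineq4[of "fst z" "F i z"] by simp
    then have n: "norm (fst z - F i z) \<le> 3 * wt z" by (simp add: wt_def)
    have "0 \<le> min 1 (k * norm (fst z - F i z)) * wt z"
      using k wt_nonneg[of z] by simp
    moreover have "min 1 (k * norm (fst z - F i z)) * wt z \<le> 1 * wt z"
      by (intro mult_right_mono wt_nonneg) simp
    ultimately show ?thesis unfolding G_def using n by simp
  qed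
  have "(\<lambda>i. \<integral>z. G i z \<partial>P) \<longlonglongrightarrow> (\<integral>z. 0 \<partial>P)"
  proof (rule integral_dominated_convergence[where w="\<lambda>z. 4 * wt z"])
    show "AE z in P. (\<lambda>i. G i z) \<longlonglongrightarrow> 0"
    proof (rule AE_I2)
      fix z :: "(real ^ 'd) \<times> real"
      have "(\<lambda>i. G i z) \<longlonglongrightarrow> norm (fst z - fst z) + min 1 (k * norm (fst z - fst z)) * wt z"
        unfolding G_def
        by (intro tendsto_add tendsto_mult tendsto_min tendsto_norm tendsto_diff tendsto_const F(2))
      then show "(\<lambda>i. G i z) \<longlonglongrightarrow> 0" by simp
    qed
    show "AE z in P. norm (G i z) \<le> 4 * wt z" for i by (rule AE_I2) (rule bound)
  qed (use Gm integrable_wt in auto)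
  then have "eventually (\<lambda>i. (\<integral>z. G i z \<partial>P) < e) sequentially"
    using assms(1) by (intro order_tendstoD) auto
  then obtain i where "(\<integral>z. G i z \<partial>P) < e" by (auto simp: eventually_sequentially)
  then show ?thesis
    by (intro that[of "F i"] F(1)) (simp_all add: G_eq integrable_le_wt[OF Gm bound])
qed

text \<open>The ReLU is smoothed to softplus and the inputs are quantised. Closeness of the
  gradients requires a lower bound on the inner weights, since the slab around the kink has mass of
  order \<tau> / |u|; this bound is supplied by \<epsilon> \<le> \<open>qf\<close>.\<close>

lemma pot_smooth_approx:
  assumes h: "bounded_density C h" and pos: "0 < \<epsilon>" "0 < R" "0 < e"
  obtains p p' where "\<And>k. Ck k p" "\<And>\<theta>. (p has_derivative (\<lambda>v. p' \<theta> \<bullet> v)) (at \<theta>)"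
    "\<And>\<theta>. \<epsilon> \<le> qf \<theta> \<Longrightarrow> norm \<theta> \<le> R \<Longrightarrow> \<bar>p \<theta> - pot h \<theta>\<bar> \<le> e"
    "\<And>\<theta>. \<epsilon> \<le> qf \<theta> \<Longrightarrow> norm \<theta> \<le> R \<Longrightarrow> norm (p' \<theta> - vel h \<theta>) \<le> e"
proof -
  have C: "0 \<le> C" using bounded_densityD(3)[OF h] .
  define A where "A = (C + 1) * (1 + R)"
  have A: "1 \<le> A" "C * R \<le> A" "C \<le> A" "0 < A"
  proof -
    have "1 * 1 \<le> (C + 1) * (1 + R)" using C pos(2) by (intro mult_mono) auto
    then show "1 \<le> A" "0 < A" by (auto simp: A_def)
    show "C * R \<le> A" "C \<le> A" using C pos(2) by (auto simp: A_def algebra_simps)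
  qed
  \<comment> \<open>The parameters are fixed in the order \<tau>, \<open>k\<close>,
    \<open>F\<close>. Here the slab is made so thin that its contribution stays below e / 4 for
    every inner weight of norm at least sqrt \<epsilon>.\<close>
  define \<tau> where "\<tau> = min (sqrt \<epsilon> / 4) (e * sqrt \<epsilon> / (4 * A * (16 * L + 1)))"
  have \<tau>: "0 < \<tau>" "4 * \<tau> \<le> sqrt \<epsilon>" "A * (16 * L * \<tau> / sqrt \<epsilon>) \<le> e / 4"
  proof -
    have d: "0 < 4 * A * (16 * L + 1)" using A L_nonneg by (intro mult_pos_pos) auto
    then show "0 < \<tau>" "4 * \<tau> \<le> sqrt \<epsilon>" using pos by (auto simp: \<tau>_def)
    have "A * (16 * L * \<tau> / sqrt \<epsilon>) = 16 * L * A * (\<tau> / sqrt \<epsilon>)" by simp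
    also have "\<tau> / sqrt \<epsilon> \<le> e / (4 * A * (16 * L + 1))"
    proof -
      have "\<tau> / sqrt \<epsilon> \<le> (e * sqrt \<epsilon> / (4 * A * (16 * L + 1))) / sqrt \<epsilon>"
        by (intro divide_right_mono) (use pos in \<open>auto simp: \<tau>_def\<close>)
      then show ?thesis using pos by simp
    qed
    also have "16 * L * A * (e / (4 * A * (16 * L + 1))) = (e / 4) * (16 * L / (16 * L + 1))"
      using A(4) d by (simp add: divide_simps)
    also have "\<dots> \<le> e / 4 * 1" using L_nonneg pos by (intro mult_left_mono) auto
    finally show "A * (16 * L * \<tau> / sqrt \<epsilon>) \<le> e / 4" using L_nonneg A by (simp add: mult_left_mono)
  qed
  \<comment> \<open>With \<tau> fixed, a steep enough softplus brings both the 1 / k error and the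
    exponential error off the slab below e / 4.\<close>
  have "((\<lambda>k. A * (2 / k) + A * (exp (- k * \<tau>) * mom)) \<longlongrightarrow> A * 0 + A * (0 * mom)) at_top"
  proof (intro tendsto_intros)
    show "((\<lambda>k. 2 / k) \<longlongrightarrow> 0) (at_top :: real filter)" by real_asymp
    show "((\<lambda>k. exp (- k * \<tau>)) \<longlongrightarrow> 0) (at_top :: real filter)" using \<tau>(1) by real_asymp
  qed
  then have "eventually (\<lambda>k. A * (2 / k) + A * (exp (- k * \<tau>) * mom) < e / 4) at_top"
    using pos by (intro order_tendstoD) auto
  then have "eventually (\<lambda>k. 0 < k \<and> A * (2 / k) + A * (exp (- k * \<tau>) * mom) < e / 4) at_top"
    by (rule eventually_conj[OF eventually_gt_at_top])
  then obtain k where k: "0 < k" "A * (2 / k) + A * (exp (- k * \<tau>) * mom) < e / 4"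
    unfolding eventually_at_top_linorder by blast
  \<comment> \<open>The quantisation comes last, because its error is amplified by the slope
    \<open>k\<close> of the logistic factor.\<close>
  have e': "0 < e / (4 * (A * (2 + R)))" using pos A by (intro divide_pos_pos mult_pos_pos) auto
  obtain F where F: "simple_function P F"
    "integrable P (\<lambda>z. norm (lift1 (fst z) - lift1 (F z)) + min 1 (k * R * norm (lift1 (fst z) - lift1 (F z))) * wt z)"
    "(\<integral>z. norm (lift1 (fst z) - lift1 (F z)) + min 1 (k * R * norm (lift1 (fst z) - lift1 (F z))) * wt z \<partial>P)
      < e / (4 * (A * (2 + R)))"
    using simple_function_lift1_approx[OF e', of "k * R"] k(1) pos(2) by auto
  define \<Delta> where "\<Delta> z = norm (lift1 (fst z) - lift1 (F z)) + min 1 (k * R * norm (lift1 (fst z) - lift1 (F z))) * wt z" for z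
  have \<Delta>: "integrable P \<Delta>" "A * (2 + R) * (\<integral>z. \<Delta> z \<partial>P) \<le> e / 4"
  proof -
    show "integrable P \<Delta>" using F(2) by (simp add: \<Delta>_def[abs_def])
    have "A * (2 + R) * (\<integral>z. \<Delta> z \<partial>P) \<le> A * (2 + R) * (e / (4 * (A * (2 + R))))"
      using F(3) A pos by (intro mult_left_mono) (auto simp: \<Delta>_def[abs_def])
    also have "\<dots> = e / 4" using A pos by (simp add: divide_simps)
    finally show "A * (2 + R) * (\<integral>z. \<Delta> z \<partial>P) \<le> e / 4" .
  qed
  define N where "N \<theta> y = fst \<theta> * softplus k (snd \<theta> \<bullet> lift1 y)" for \<theta> :: "'d param" and y
  define N' where "N' \<theta> y = (softplus k (snd \<theta> \<bullet> lift1 y), (fst \<theta> * logistic (k * (snd \<theta> \<bullet> lift1 y))) *\<^sub>R lift1 y)"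
    for \<theta> :: "'d param" and y
  define c where "c y = (\<integral>z. h z * indicator (F -` {y}) z \<partial>P)" for y
  define p where "p \<theta> = (\<Sum>y\<in>range F. c y * N \<theta> y)" for \<theta>
  define p' where "p' \<theta> = (\<Sum>y\<in>range F. c y *\<^sub>R N' \<theta> y)" for \<theta>
  have fin: "finite (range F)" using simple_functionD(1)[OF F(1)] by simp
  have p_eq: "p \<theta> = (\<integral>z. h z * N \<theta> (F z) \<partial>P)" and pi: "integrable P (\<lambda>z. h z * N \<theta> (F z))" for \<theta>
    using integral_simple_function_compose[OF h F(1), of "N \<theta>"] by (simp_all add: p_def c_def)
  have p'_eq: "p' \<theta> = (\<integral>z. h z *\<^sub>R N' \<theta> (F z) \<partial>P)" and p'i: "integrable P (\<lambda>z. h z *\<^sub>R N' \<theta> (F z))" for \<theta>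
    using integral_simple_function_compose[OF h F(1), of "N' \<theta>"] by (simp_all add: p'_def c_def)
  have \<Delta>1: "norm (lift1 (fst z) - lift1 (F z)) \<le> \<Delta> z"
    and \<Delta>2: "norm (lift1 (fst z) - lift1 (F z)) + min 1 (k * R * norm (lift1 (fst z) - lift1 (F z))) * norm (lift1 (fst z)) \<le> \<Delta> z" for z
  proof -
    have m: "0 \<le> min 1 (k * R * norm (lift1 (fst z) - lift1 (F z)))" using k(1) pos(2) by simp
    have "norm (lift1 (fst z)) \<le> wt z" using norm_lift1[of "fst z"] by (simp add: wt_def)
    from mult_left_mono[OF this m] show
      "norm (lift1 (fst z) - lift1 (F z)) + min 1 (k * R * norm (lift1 (fst z) - lift1 (F z))) * norm (lift1 (fst z)) \<le> \<Delta> z"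
      by (simp add: \<Delta>_def)
    show "norm (lift1 (fst z) - lift1 (F z)) \<le> \<Delta> z" using m wt_nonneg[of z] by (simp add: \<Delta>_def)
  qed
  show ?thesis
  proof (rule that[of p p'])
    show "Ck n p" for n
      unfolding p_def N_def
      by (intro Ck_sum fin Ck_mult Ck_const Ck_softplus_neuron k(1))
    show "(p has_derivative (\<lambda>v. p' \<theta> \<bullet> v)) (at \<theta>)" for \<theta>
    proof -
      have "((\<lambda>\<theta>. \<Sum>y\<in>range F. c y * N \<theta> y) has_derivative (\<lambda>v. \<Sum>y\<in>range F. c y * (N' \<theta> y \<bullet> v))) (at \<theta>)"
        unfolding N_def N'_def
        by (intro has_derivative_sum has_derivative_mult_right softplus_neuron_has_derivative k(1))
      then show ?thesis by (simp add: p_def[abs_def] p'_def inner_sum_left)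
    qed
    fix \<theta> :: "'d param" assume q: "\<epsilon> \<le> qf \<theta>" and R: "norm \<theta> \<le> R"
    show "\<bar>p \<theta> - pot h \<theta>\<bar> \<le> e"
    proof -
      have "norm (\<integral>z. h z * N \<theta> (F z) - h z * phi \<theta> (fst z) \<partial>P) \<le> (\<integral>z. C * (R * (R * \<Delta> z + 1 / k)) \<partial>P)"
      proof (rule norm_integral_le_wt)
        show "integrable P (\<lambda>z. h z * N \<theta> (F z) - h z * phi \<theta> (fst z))"
          by (intro Bochner_Integration.integrable_diff pi integrable_pot[OF h])
        show "integrable P (\<lambda>z. C * (R * (R * \<Delta> z + 1 / k)))"
          by (intro integrable_mult_right Bochner_Integration.integrable_add \<Delta>(1)) auto
        fix z :: "(real ^ 'd) \<times> real"
        have "R * norm (lift1 (fst z) - lift1 (F z)) + 1 / k \<le> R * \<Delta> z + 1 / k"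
          using pos(2) \<Delta>1[of z] by (intro add_right_mono mult_left_mono) auto
        then have "R * (R * norm (lift1 (fst z) - lift1 (F z)) + 1 / k) \<le> R * (R * \<Delta> z + 1 / k)"
          using pos(2) by (intro mult_left_mono) auto
        then have "\<bar>N \<theta> (F z) - phi \<theta> (fst z)\<bar> \<le> R * (R * \<Delta> z + 1 / k)"
          using softplus_neuron_approx(1)[OF k(1) R, of "lift1 (F z)" "lift1 (fst z)"]
          unfolding N_def phi_eq by linarith
        then have "\<bar>h z\<bar> * \<bar>N \<theta> (F z) - phi \<theta> (fst z)\<bar> \<le> C * (R * (R * \<Delta> z + 1 / k))"
          using bounded_densityD(2)[OF h] C by (intro mult_mono) auto
        then show "norm (h z * N \<theta> (F z) - h z * phi \<theta> (fst z)) \<le> C * (R * (R * \<Delta> z + 1 / k))"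
          by (simp add: abs_mult flip: right_diff_distrib)
      qed
      then have "\<bar>p \<theta> - pot h \<theta>\<bar> \<le> C * (R * (R * (\<integral>z. \<Delta> z \<partial>P) + 1 / k))"
        unfolding p_eq pot_def using pi integrable_pot[OF h] \<Delta>(1) prob_space by simp
      also have "\<dots> = (C * R) * (R * (\<integral>z. \<Delta> z \<partial>P) + 1 / k)" by simp
      also have "\<dots> \<le> A * ((2 + R) * (\<integral>z. \<Delta> z \<partial>P) + 2 / k)"
      proof (rule mult_mono[OF A(2)])
        have I: "0 \<le> (\<integral>z. \<Delta> z \<partial>P)"
          using \<Delta>1 norm_ge_zero order_trans by (intro Bochner_Integration.integral_nonneg) blast
        then show "R * (\<integral>z. \<Delta> z \<partial>P) + 1 / k \<le> (2 + R) * (\<integral>z. \<Delta> z \<partial>P) + 2 / k"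
          using k(1) by (intro add_mono mult_right_mono divide_right_mono) auto
        show "0 \<le> R * (\<integral>z. \<Delta> z \<partial>P) + 1 / k" using I k(1) pos(2) by simp
      qed (use A in auto)
      also have "\<dots> = A * (2 + R) * (\<integral>z. \<Delta> z \<partial>P) + A * (2 / k)" by (simp add: algebra_simps)
      also have "\<dots> \<le> e"
      proof -
        have "0 \<le> A * (exp (- k * \<tau>) * mom)" using A mom_ge_1 by simp
        then show ?thesis using \<Delta>(2) k(2) pos(3) by linarith
      qed
      finally show ?thesis .
    qed
    show "norm (p' \<theta> - vel h \<theta>) \<le> e"
    proof -
      have q0: "sqrt \<epsilon> \<le> norm (snd \<theta>)"
      proof -
        have "\<epsilon> \<le> (norm (snd \<theta>))\<^sup>2"
          using q zero_le_power2[of "fst \<theta>"] unfolding qf_def power2_norm_eq_inner by linarith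
        from real_sqrt_le_mono[OF this] show ?thesis by simp
      qed
      have u: "snd \<theta> \<noteq> 0" using q0 pos(1) by auto
      let ?l = "\<lambda>z. \<bar>logistic (k * (snd \<theta> \<bullet> lift1 (fst z))) - relu' (snd \<theta> \<bullet> lift1 (fst z))\<bar> * wt z"
      let ?b = "\<lambda>z. C * (R * \<Delta> z + 1 / k + R * (\<Delta> z + ?l z))"
      have lint: "integrable P ?l"
      proof (rule integrable_le_wt[where c=1])
        have [measurable]: "logistic \<in> borel_measurable borel"
          unfolding logistic_def[abs_def] by measurable
        show "?l \<in> borel_measurable P" by measurable
        fix z :: "(real ^ 'd) \<times> real"
        show "norm (?l z) \<le> 1 * wt z"
          using mult_right_mono[OF logistic_relu'_diff_le_1 wt_nonneg[of z]] wt_nonneg[of z] by (simp add: abs_mult)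
      qed
      have bint: "integrable P ?b"
        by (intro integrable_mult_right Bochner_Integration.integrable_add \<Delta>(1) lint) auto
      have "norm (\<integral>z. h z *\<^sub>R N' \<theta> (F z) - h z *\<^sub>R grad_phi \<theta> (fst z) \<partial>P) \<le> (\<integral>z. ?b z \<partial>P)"
      proof (rule norm_integral_le_wt[OF _ bint])
        show "integrable P (\<lambda>z. h z *\<^sub>R N' \<theta> (F z) - h z *\<^sub>R grad_phi \<theta> (fst z))"
          by (intro Bochner_Integration.integrable_diff p'i integrable_vel[OF h])
        fix z :: "(real ^ 'd) \<times> real"
        have l: "\<bar>logistic (k * (snd \<theta> \<bullet> lift1 (fst z))) - relu' (snd \<theta> \<bullet> lift1 (fst z))\<bar> * norm (lift1 (fst z)) \<le> ?l z"
          using norm_lift1[of "fst z"] by (intro mult_left_mono) (auto simp: wt_def)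
        have "norm (N' \<theta> (F z) - grad_phi \<theta> (fst z)) \<le> R * \<Delta> z + 1 / k + R * (\<Delta> z + ?l z)"
          unfolding N'_def grad_phi_eq
          by (rule order_trans[OF softplus_neuron_approx(2)[OF k(1) R]])
             (use pos(2) l \<Delta>1[of z] \<Delta>2[of z] in \<open>auto intro!: add_mono mult_left_mono\<close>)
        then have "\<bar>h z\<bar> * norm (N' \<theta> (F z) - grad_phi \<theta> (fst z)) \<le> ?b z"
          using bounded_densityD(2)[OF h] C by (intro mult_mono) auto
        then show "norm (h z *\<^sub>R N' \<theta> (F z) - h z *\<^sub>R grad_phi \<theta> (fst z)) \<le> ?b z"
          by (simp flip: scaleR_diff_right)
      qed
      then have "norm (p' \<theta> - vel h \<theta>) \<le> C * (R * (\<integral>z. \<Delta> z \<partial>P) + 1 / k + R * ((\<integral>z. \<Delta> z \<partial>P) + (\<integral>z. ?l z \<partial>P)))"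
        unfolding p'_eq vel_def using p'i integrable_vel[OF h] \<Delta>(1) lint prob_space by simp
      also have "\<dots> = (C * R) * (2 * (\<integral>z. \<Delta> z \<partial>P)) + C * (1 / k) + (C * R) * (\<integral>z. ?l z \<partial>P)"
        by (simp add: algebra_simps)
      also have "\<dots> \<le> A * ((2 + R) * (\<integral>z. \<Delta> z \<partial>P)) + A * (2 / k) + A * (16 * L * \<tau> / sqrt \<epsilon> + exp (- k * \<tau>) * mom)"
      proof (intro add_mono)
        have I: "0 \<le> (\<integral>z. \<Delta> z \<partial>P)"
          using \<Delta>1 norm_ge_zero order_trans by (intro Bochner_Integration.integral_nonneg) blast
        then have "2 * (\<integral>z. \<Delta> z \<partial>P) \<le> (2 + R) * (\<integral>z. \<Delta> z \<partial>P)"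
          using pos(2) by (intro mult_right_mono) auto
        then show "(C * R) * (2 * (\<integral>z. \<Delta> z \<partial>P)) \<le> A * ((2 + R) * (\<integral>z. \<Delta> z \<partial>P))"
          using I A by (intro mult_mono[OF A(2)]) auto
        show "C * (1 / k) \<le> A * (2 / k)"
          using k(1) A by (intro mult_mono[OF A(3)] divide_right_mono) auto
        have "(\<integral>z. ?l z \<partial>P) \<le> 16 * L * \<tau> / norm (snd \<theta>) + exp (- k * \<tau>) * mom"
          by (rule logistic_slab_le[OF u \<tau>(1) _ k(1)]) (use \<tau>(2) q0 in linarith)
        also have "16 * L * \<tau> / norm (snd \<theta>) \<le> 16 * L * \<tau> / sqrt \<epsilon>"
          using q0 pos(1) L_nonneg \<tau>(1) u by (intro divide_left_mono) (auto intro!: mult_pos_pos)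
        finally have "(\<integral>z. ?l z \<partial>P) \<le> 16 * L * \<tau> / sqrt \<epsilon> + exp (- k * \<tau>) * mom" by simp
        moreover have "0 \<le> (\<integral>z. ?l z \<partial>P)"
          by (intro Bochner_Integration.integral_nonneg mult_nonneg_nonneg wt_nonneg) auto
        ultimately show "(C * R) * (\<integral>z. ?l z \<partial>P) \<le> A * (16 * L * \<tau> / sqrt \<epsilon> + exp (- k * \<tau>) * mom)"
          using A by (intro mult_mono[OF A(2)]) auto
      qed
      also have "\<dots> = A * (2 + R) * (\<integral>z. \<Delta> z \<partial>P) + A * (16 * L * \<tau> / sqrt \<epsilon>) + (A * (2 / k) + A * (exp (- k * \<tau>) * mom))"
        by (simp add: algebra_simps)
      also have "\<dots> \<le> e" using \<Delta>(2) k(2) \<tau>(3) pos(3) by linarith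
      finally show ?thesis .
    qed
  qed
qed

end

subsection \<open>Growth of the second moment\<close>

context relu_data
begin

lemma continuous_on_pot:
  assumes "bounded_density C h"
  shows "continuous_on A (pot h)"
  unfolding continuous_on_def
proof
  fix \<theta> assume "\<theta> \<in> A"
  have "((\<lambda>x. C * mom * (norm x + norm \<theta>) * norm (x - \<theta>)) \<longlongrightarrow> C * mom * (norm \<theta> + norm \<theta>) * norm (\<theta> - \<theta>)) (at \<theta> within A)"
    by (intro tendsto_intros)
  then have lim: "((\<lambda>x. C * mom * (norm x + norm \<theta>) * norm (x - \<theta>)) \<longlongrightarrow> 0) (at \<theta> within A)" by simp
  have "((\<lambda>x. pot h x - pot h \<theta>) \<longlongrightarrow> 0) (at \<theta> within A)"
    by (rule Lim_null_comparison[OF always_eventually lim]) (use pot_lipschitz[OF assms] in simp)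
  then show "(pot h \<longlongrightarrow> pot h \<theta>) (at \<theta> within A)" by (rule LIM_zero_cancel)
qed

lemma continuous_on_vel:
  assumes "bounded_density C h"
  shows "continuous_on {\<theta>. 0 \<le> qf \<theta>} (vel h)"
proof (rule lipschitz_on_continuous_on)
  show "(C * (3 * mom + 2 * L))-lipschitz_on {\<theta>. 0 \<le> qf \<theta>} (vel h)"
    using vel_lipschitz[OF assms] bounded_densityD(3)[OF assms] mom_ge_1 L_nonneg
    by (intro lipschitz_onI) (auto simp: dist_norm)
qed

text \<open>Pythagoras: by Euler's identity the radial component of the velocity on the sphere is 2
  \<open>pot h \<theta>\<close>.\<close>

lemma norm_tangential_sq:
  assumes "bounded_density C h" "norm \<theta> = 1"
  shows "(norm (tangential (vel h) \<theta>))\<^sup>2 = (norm (vel h \<theta>))\<^sup>2 - 4 * (pot h \<theta>)\<^sup>2"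
proof -
  have tt: "\<theta> \<bullet> \<theta> = 1" using assms(2) by (simp add: power2_norm_eq_inner[symmetric])
  have v: "\<theta> \<bullet> vel h \<theta> = 2 * pot h \<theta>" using vel_inner_self[OF assms(1)] by (simp add: inner_commute)
  show ?thesis
    unfolding power2_norm_eq_inner tangential_def inner_diff_left inner_diff_right inner_scaleR_left inner_scaleR_right
      tt inner_commute[of "vel h \<theta>" \<theta>] v by (simp add: power2_eq_square)
qed

text \<open>The right-hand side is (v - 2 s \<theta>) . v with v = \<open>vel h \<theta>\<close>,
  the rate at which g - s |\<theta>|^2 decreases along the limit field, where g =
  \<open>pot h\<close>. On the sphere it equals the squared tangential gradient plus 4 g (g - s).
  For g \<le> s < 0 the last term vanishes only on the level g = s, where the tangential gradient
  does not. Compactness and homogeneity of degree 2 give the constant.\<close>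

lemma dissipation_lower_bound:
  assumes h: "bounded_density C h" and s: "s < 0"
    and reg: "\<And>\<theta>. \<theta> \<in> sphere 0 1 \<inter> closure Theta \<Longrightarrow> pot h \<theta> = s \<Longrightarrow> tangential (vel h) \<theta> \<noteq> 0"
  obtains c where "0 < c" "\<And>\<theta>. \<theta> \<in> Theta \<Longrightarrow> pot h \<theta> \<le> s * (norm \<theta>)\<^sup>2 \<Longrightarrow>
    c * (norm \<theta>)\<^sup>2 \<le> (norm (vel h \<theta>))\<^sup>2 - 4 * s * pot h \<theta>"
proof -
  define Z where "Z = sphere (0::'d param) 1 \<inter> closure Theta \<inter> {\<theta>. pot h \<theta> \<le> s}"
  define G where "G \<theta> = (norm (vel h \<theta>))\<^sup>2 - 4 * s * pot h \<theta>" for \<theta>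
  have cl: "closed {\<theta>. pot h \<theta> \<le> s}"
    by (intro closed_Collect_le continuous_on_pot[OF h] continuous_on_const)
  have Z: "compact Z" unfolding Z_def by (intro compact_Int_closed compact_sphere closed_closure cl)
  have "Z \<subseteq> {\<theta>. 0 \<le> qf \<theta>}" unfolding Z_def using closure_Theta_qf by blast
  then have Gc: "continuous_on Z G"
    unfolding G_def by (intro continuous_intros continuous_on_pot[OF h] continuous_on_subset[OF continuous_on_vel[OF h]])
  have pos: "0 < G \<theta>" if "\<theta> \<in> Z" for \<theta>
  proof -
    have n: "norm \<theta> = 1" and le: "pot h \<theta> \<le> s" and mem: "\<theta> \<in> sphere 0 1 \<inter> closure Theta"
      using that by (auto simp: Z_def)
    have eq: "G \<theta> = (norm (tangential (vel h) \<theta>))\<^sup>2 + 4 * (pot h \<theta> * (pot h \<theta> - s))"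
      unfolding norm_tangential_sq[OF h n] G_def by (simp add: power2_eq_square algebra_simps)
    have "0 \<le> pot h \<theta> * (pot h \<theta> - s)" using le s by (intro mult_nonpos_nonpos) auto
    moreover have "0 < (norm (tangential (vel h) \<theta>))\<^sup>2" if "pot h \<theta> = s"
      using reg[OF mem that] by simp
    moreover have "0 < pot h \<theta> * (pot h \<theta> - s)" if "pot h \<theta> \<noteq> s"
      using le s that by (intro mult_neg_neg) auto
    ultimately show ?thesis unfolding eq
      by (cases "pot h \<theta> = s") (auto intro: add_pos_nonneg add_nonneg_pos)
  qed
  obtain c where c: "0 < c" "\<And>\<theta>. \<theta> \<in> Z \<Longrightarrow> c \<le> G \<theta>"
  proof (cases "Z = {}")
    case True
    then show ?thesis using that[of 1] by simp
  next
    case False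
    from continuous_attains_inf[OF Z False Gc] obtain z where "z \<in> Z" "\<And>\<theta>. \<theta> \<in> Z \<Longrightarrow> G z \<le> G \<theta>" by blast
    then show ?thesis using that[of "G z"] pos by blast
  qed
  show ?thesis
  proof (rule that[OF c(1)])
    fix \<theta> :: "'d param" assume \<theta>: "\<theta> \<in> Theta" and le: "pot h \<theta> \<le> s * (norm \<theta>)\<^sup>2"
    define r where "r = norm \<theta>"
    have "0 < qf \<theta>" using \<theta> by (simp add: Theta_eq)
    then have "\<theta> \<noteq> 0" by (auto simp: qf_def)
    then have r: "0 < r" by (simp add: r_def)
    define \<omega> where "\<omega> = (1 / r) *\<^sub>R \<theta>"
    have \<theta>\<omega>: "\<theta> = r *\<^sub>R \<omega>" using r by (simp add: \<omega>_def)
    have p: "pot h \<theta> = r\<^sup>2 * pot h \<omega>" and v: "vel h \<theta> = r *\<^sub>R vel h \<omega>"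
      unfolding \<theta>\<omega> by (rule pot_scaleR[OF r], rule vel_scaleR[OF r])
    have "\<omega> \<in> Theta" unfolding \<omega>_def using r \<theta> by (intro Theta_scaleR) auto
    moreover have "norm \<omega> = 1" using r by (simp add: \<omega>_def r_def)
    moreover have "pot h \<omega> \<le> s" using le r by (simp add: p r_def[symmetric] mult.commute)
    ultimately have "\<omega> \<in> Z" using closure_subset by (auto simp: Z_def)
    then have "c * r\<^sup>2 \<le> G \<omega> * r\<^sup>2" by (intro mult_right_mono c(2)) auto
    also have "\<dots> = (norm (vel h \<theta>))\<^sup>2 - 4 * s * pot h \<theta>"
      using r by (simp add: G_def p v power_mult_distrib algebra_simps)
    finally show "c * (norm \<theta>)\<^sup>2 \<le> (norm (vel h \<theta>))\<^sup>2 - 4 * s * pot h \<theta>" by (simp add: r_def)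
  qed
qed

end

context gradient_flow
begin

text \<open>The sublevel cone is open and hence charged; it is exhausted by countably many bounded
  pieces on which both strict inequalities hold with a margin. The margin is what the smooth
  cut-offs can use.\<close>

lemma sublevel_cone_positive_mass:
  assumes omni: "omnidirectional (\<pi> T)" and T: "0 \<le> T" and h: "bounded_density C h"
    and \<theta>1: "\<theta>1 \<in> Theta" "pot h \<theta>1 < s * (norm \<theta>1)\<^sup>2"
  obtains \<delta> R where "0 < \<delta>" "0 < R"
    "0 < emeasure (\<pi> T) {\<theta>. \<delta> < qf \<theta> \<and> pot h \<theta> < s * (norm \<theta>)\<^sup>2 - \<delta> \<and> norm \<theta> < R}"
proof -
  define N where "N n = {\<theta>. 1 / real (Suc n) < qf \<theta> \<and> pot h \<theta> < s * (norm \<theta>)\<^sup>2 - 1 / real (Suc n) \<and> norm \<theta> < real n}" for n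
  have N_open: "open (N n)" for n
    unfolding N_def
    by (intro open_Collect_conj open_Collect_less continuous_intros continuous_on_pot[OF h] continuous_on_qf)
  let ?U = "{\<theta>. 0 < qf \<theta> \<and> pot h \<theta> < s * (norm \<theta>)\<^sup>2}"
  have "0 < emeasure (\<pi> T) ?U"
  proof (rule omni[unfolded omnidirectional_def, rule_format], intro conjI ballI allI impI)
    show "open ?U"
      by (intro open_Collect_conj open_Collect_less continuous_intros continuous_on_pot[OF h] continuous_on_qf)
    have "\<theta>1 \<in> ?U" using \<theta>1 by (simp add: Theta_eq)
    then show "?U \<noteq> {}" by blast
    show "?U \<subseteq> Theta" by (auto simp: Theta_eq)
    fix \<theta> and c :: real assume \<theta>: "\<theta> \<in> ?U" and c: "0 < c"
    have "c\<^sup>2 * pot h \<theta> < c\<^sup>2 * (s * (norm \<theta>)\<^sup>2)" using \<theta> c by (intro mult_strict_left_mono) auto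
    then show "c *\<^sub>R \<theta> \<in> ?U" using \<theta> c
      by (simp add: qf_scaleR pot_scaleR power_mult_distrib mult.left_commute)
  qed
  also have "\<dots> \<le> emeasure (\<pi> T) (\<Union>n. N n)"
  proof (rule emeasure_mono)
    show "(\<Union>n. N n) \<in> sets (\<pi> T)"
      using P2_D(1)[OF flow_P2[OF T]] N_open by (auto intro!: borel_open)
    show "?U \<subseteq> (\<Union>n. N n)"
    proof
      fix \<theta> assume \<theta>: "\<theta> \<in> ?U"
      have a: "0 < min (qf \<theta>) (s * (norm \<theta>)\<^sup>2 - pot h \<theta>)" using \<theta> by simp
      obtain n1 where n1: "1 / real (Suc n1) < min (qf \<theta>) (s * (norm \<theta>)\<^sup>2 - pot h \<theta>)"
        using reals_Archimedean[OF a] by (auto simp: inverse_eq_divide)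
      obtain n2 where n2: "norm \<theta> < real n2" using reals_Archimedean2 by blast
      define n where "n = max n1 n2"
      have "1 / real (Suc n) \<le> 1 / real (Suc n1)" by (intro divide_left_mono) (auto simp: n_def)
      then have "1 / real (Suc n) < min (qf \<theta>) (s * (norm \<theta>)\<^sup>2 - pot h \<theta>)" using n1 by linarith
      moreover have "norm \<theta> < real n" using n2 by (simp add: n_def)
      ultimately have "\<theta> \<in> N n" by (simp add: N_def)
      then show "\<theta> \<in> (\<Union>n. N n)" by blast
    qed
  qed
  finally have "0 < emeasure (\<pi> T) (\<Union>n. N n)" .
  then obtain n where n: "0 < emeasure (\<pi> T) (N n)"
    using P2_D(1)[OF flow_P2[OF T]] N_open by (elim emeasure_pos_countable_Union) (auto intro!: borel_open)
  then have "N n \<noteq> {}" by force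
  then obtain \<theta> where "\<theta> \<in> N n" by blast
  then have "norm \<theta> < real n" by (simp add: N_def)
  then have "0 < real n" by (rule le_less_trans[OF norm_ge_zero])
  then show ?thesis using n by (intro that[of "1 / real (Suc n)" "real n"]) (auto simp: N_def)
qed

text \<open>The subsolution is exp(- 2 |s| (t - T)) |\<theta>|^2 times three cut-offs: to the
  sublevel cone, to \<open>qf\<close> above \<epsilon>, and to a growing ball. Every cut-off is
  nondecreasing along characteristics, and on the support |\<theta>|^2 grows at rate at least 2 |s|,
  which pays for the exponential. Since the cut-offs are at most 1, the integral is dominated by the
  discounted second moment.\<close>

lemma sq_moment_growth:
  assumes T: "0 \<le> T" and h: "bounded_density C h" and s: "s < 0" and c1: "0 < c1"
    and diss: "\<And>\<theta>. \<theta> \<in> Theta \<Longrightarrow> pot h \<theta> \<le> s * (norm \<theta>)\<^sup>2 \<Longrightarrow>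
      c1 * (norm \<theta>)\<^sup>2 \<le> (norm (vel h \<theta>))\<^sup>2 - 4 * s * pot h \<theta>"
    and e1: "0 < e1" "(2 * C * mom + 2 * \<bar>s\<bar>) * e1 \<le> c1 / 2" "4 * e1 \<le> 2 * \<bar>s\<bar>"
    and near: "\<And>t \<theta>. T \<le> t \<Longrightarrow> \<theta> \<in> Theta \<Longrightarrow> pot (dens (\<pi> t)) \<theta> \<le> pot h \<theta> + e1 * (norm \<theta>)\<^sup>2"
      "\<And>t \<theta>. T \<le> t \<Longrightarrow> \<theta> \<in> Theta \<Longrightarrow> norm (V t \<theta> - vel h \<theta>) \<le> e1 * norm \<theta>"
    and \<delta>: "0 < \<delta>" and R: "0 < R"
    and mass: "0 < emeasure (\<pi> T) {\<theta>. \<delta> < qf \<theta> \<and> pot h \<theta> < s * (norm \<theta>)\<^sup>2 - \<delta> \<and> norm \<theta> < R}"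
  obtains y where "0 < y" "\<And>t. T \<le> t \<Longrightarrow> y * exp (2 * \<bar>s\<bar> * (t - T)) \<le> sq_moment (\<pi> t)"
proof -
  define c where "c = 2 * \<bar>s\<bar>"
  define M0 where "M0 = 2 * C * mom"
  have M0: "0 \<le> M0" using C_nonneg mom_ge_1 by (simp add: M0_def)
  have VM: "norm (V t \<theta>) \<le> M0 * norm \<theta>" if "0 \<le> t" for t \<theta>
    using norm_vel_le[OF bounded_density_flow[OF that]] by (simp add: M0_def)
  define \<epsilon> where "\<epsilon> = \<delta> / 2"
  have \<epsilon>: "0 < \<epsilon>" using \<delta> by (simp add: \<epsilon>_def)
  \<comment> \<open>The first bound leaves a margin \<delta> / 2 in the cone cut-off on the initial
    piece. The second lets the gradient error be absorbed by the dissipation, since |\<theta>| is at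
    least sqrt \<epsilon> on the support.\<close>
  define e where "e = min (\<delta> / 4) (c1 * sqrt \<epsilon> / (2 * (M0 + 1)))"
  have e: "0 < e" "e \<le> \<delta> / 4" "M0 * e \<le> c1 / 2 * sqrt \<epsilon>"
  proof -
    have d: "0 < 2 * (M0 + 1)" using M0 by simp
    show "0 < e" using \<delta> \<epsilon> c1 d by (simp add: e_def)
    show "e \<le> \<delta> / 4" unfolding e_def by (rule min.cobounded1)
    have "M0 * e \<le> (M0 + 1) * (c1 * sqrt \<epsilon> / (2 * (M0 + 1)))"
      using \<open>0 < e\<close> M0 by (intro mult_mono) (auto simp: e_def)
    also have "\<dots> = c1 / 2 * sqrt \<epsilon>" using M0 by (simp add: divide_simps)
    finally show "M0 * e \<le> c1 / 2 * sqrt \<epsilon>" .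
  qed
  let ?N = "{\<theta>. \<delta> < qf \<theta> \<and> pot h \<theta> < s * (norm \<theta>)\<^sup>2 - \<delta> \<and> norm \<theta> < R}"
  have N_open: "open ?N"
    by (intro open_Collect_conj open_Collect_less continuous_intros continuous_on_pot[OF h] continuous_on_qf)
  \<comment> \<open>A lower bound for the initial integral: on the charged piece |\<theta>|^2
    exceeds \<delta> and the arguments of the three cut-offs are at least \<delta> / 2, \<delta> / 2
    and 1. It is fixed before the final time, on which the smooth approximation below
    depends.\<close>
  define y where "y = \<delta> * bump (\<delta> / 2) * bump (\<delta> / 2) * bump 1 * measure (\<pi> T) ?N"
  interpret pT: prob_space "\<pi> T" by (rule prob_space_flow[OF T])
  have "0 < measure (\<pi> T) ?N" using mass by (simp add: pT.emeasure_eq_measure)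
  then have y: "0 < y" unfolding y_def using \<delta> by (intro mult_pos_pos) (auto simp: bump_pos_iff)
  show ?thesis
  proof (rule that[OF y])
    fix t1 assume t1: "T \<le> t1"
    \<comment> \<open>Speeds are at most M0 |\<theta>|, so |\<theta>|^2 grows at most at rate 2 M0
      and \<kappa>(t) |\<theta>|^2 cannot increase along characteristics.\<close>
    define \<kappa> where "\<kappa> t = exp (- (2 * M0) * (t - T))" for t
    define R2 where "R2 = R\<^sup>2 + 1"
    \<comment> \<open>Radius of the growing ball at the final time, hence a bound for the supports
      at all earlier times; the \<open>1\<close> in \<open>R2\<close> gives
      \<open>B T \<theta> \<ge> 1\<close> on the initial piece.\<close>
    define Rm where "Rm = sqrt (R2 / \<kappa> t1)"
    have R2: "0 < R2" by (simp add: R2_def add_nonneg_pos)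
    have Rm: "0 < Rm" using R2 by (simp add: Rm_def \<kappa>_def)
    obtain p p' where p: "\<And>k. Ck k p" "\<And>\<theta>. (p has_derivative (\<lambda>v. p' \<theta> \<bullet> v)) (at \<theta>)"
      "\<And>\<theta>. \<epsilon> \<le> qf \<theta> \<Longrightarrow> norm \<theta> \<le> Rm \<Longrightarrow> \<bar>p \<theta> - pot h \<theta>\<bar> \<le> e"
      "\<And>\<theta>. \<epsilon> \<le> qf \<theta> \<Longrightarrow> norm \<theta> \<le> Rm \<Longrightarrow> norm (p' \<theta> - vel h \<theta>) \<le> e"
      using pot_smooth_approx[OF h \<epsilon> Rm e(1)] by blast
    \<comment> \<open>Subtracting \<open>e\<close> compensates the approximation error of
      \<open>p\<close>: where \<open>Z\<close> is positive on the range of the approximation, the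
      point lies in the true sublevel cone, so the dissipation bound applies.\<close>
    define Z where "Z \<theta> = s * (\<theta> \<bullet> \<theta>) - p \<theta> - e" for \<theta>
    define Q where "Q \<theta> = qf \<theta> - \<epsilon>" for \<theta> :: "'d param"
    define B where "B t \<theta> = R2 - \<kappa> t * (\<theta> \<bullet> \<theta>)" for t and \<theta> :: "'d param"
    define \<Phi> where "\<Phi> t \<theta> = (\<theta> \<bullet> \<theta>) * (bump (Z \<theta>) * (bump (Q \<theta>) * bump (B t \<theta>)))" for t \<theta>
    define \<Psi> where "\<Psi> t \<theta> = exp (- c * (t - T)) * \<Phi> t \<theta>" for t \<theta>
    define D where "D t \<theta> = exp (- c * (t - T)) * ((- c) * \<Phi> t \<theta>
      + (\<theta> \<bullet> \<theta>) * (bump (Z \<theta>) * (bump (Q \<theta>) * (bump' (B t \<theta>) * (2 * M0 * \<kappa> t * (\<theta> \<bullet> \<theta>))))))" for t \<theta>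
    define M where "M = {\<theta> :: 'd param. \<epsilon> \<le> qf \<theta>} \<inter> cball 0 Rm"
    have "closed {\<theta> :: 'd param. \<epsilon> \<le> qf \<theta>}"
      by (intro closed_Collect_le continuous_on_const continuous_on_qf)
    then have "compact M" unfolding M_def by (intro closed_Int_compact compact_cball)
    moreover have "M \<subseteq> Theta" using \<epsilon> by (auto simp: M_def Theta_eq)
    ultimately have M: "compact M" "M \<subseteq> Theta" by blast+
    have \<kappa>_mono: "\<kappa> t1 \<le> \<kappa> t" if "t \<le> t1" for t
      unfolding \<kappa>_def using that M0 by (simp add: mult_left_mono)
    have inM: "\<theta> \<in> M" if "t \<le> t1" "0 < Q \<theta>" "0 < B t \<theta>" for t \<theta>
    proof -
      have "\<kappa> t1 * (norm \<theta>)\<^sup>2 \<le> \<kappa> t * (norm \<theta>)\<^sup>2" by (intro mult_right_mono \<kappa>_mono that) auto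
      also have "\<dots> \<le> R2" using that(3) by (simp add: B_def power2_norm_eq_inner)
      finally have "(norm \<theta>)\<^sup>2 \<le> R2 / \<kappa> t1" by (simp add: pos_le_divide_eq \<kappa>_def mult.commute)
      then have "norm \<theta> \<le> Rm" unfolding Rm_def by (rule real_le_rsqrt)
      then show ?thesis using that(2) by (simp add: M_def Q_def)
    qed
    have off: "bump (Q \<theta>) * bump (B t \<theta>) = 0" "bump (Q \<theta>) * bump' (B t \<theta>) = 0" if "t \<le> t1" "\<theta> \<notin> M" for t \<theta>
    proof -
      have "Q \<theta> \<le> 0 \<or> B t \<theta> \<le> 0" using inM[OF that(1), of \<theta>] that(2) by linarith
      then show "bump (Q \<theta>) * bump (B t \<theta>) = 0" "bump (Q \<theta>) * bump' (B t \<theta>) = 0"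
        by (auto simp: bump_eq_0 bump'_eq_0)
    qed
    have off\<Phi>: "\<Phi> t \<theta> = 0" if "t \<le> t1" "\<theta> \<notin> M" for t \<theta>
      unfolding \<Phi>_def off(1)[OF that] by simp
    have Ck\<Psi>: "Ck k (\<Psi> t)" for k t
    proof -
      have "Ck k Z" unfolding Z_def by (intro Ck_diff Ck_mult Ck_const Ck_inner_self p(1))
      moreover have "Ck k Q" unfolding Q_def by (intro Ck_diff Ck_const Ck_qf)
      moreover have "Ck k (B t)" unfolding B_def by (intro Ck_diff Ck_mult Ck_const Ck_inner_self)
      ultimately show ?thesis
        unfolding \<Psi>_def \<Phi>_def
        by (intro Ck_mult Ck_const Ck_inner_self Ck_compose[OF smooth_real_bump])
    qed
    have main: "(\<integral>\<theta>. \<Psi> T \<theta> \<partial>\<pi> T) \<le> (\<integral>\<theta>. \<Psi> t1 \<theta> \<partial>\<pi> t1)"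
    proof (rule subsolution_integral_mono[OF T t1 M(1), where D=D])
      fix t and \<theta> :: "'d param" assume t: "t \<in> {T..t1}"
      show "\<Psi> t \<in> Cc_inf Theta"
        by (rule Cc_infI[OF Ck\<Psi> M]) (use t off\<Phi> in \<open>simp add: \<Psi>_def\<close>)
      show "\<theta> \<notin> M \<Longrightarrow> \<Psi> t \<theta> = 0" using t off\<Phi> by (simp add: \<Psi>_def)
      show "D t \<theta> = 0" if "\<theta> \<notin> M"
      proof -
        have "bump (Q \<theta>) = 0 \<or> bump' (B t \<theta>) = 0" using off(2)[OF _ that, of t] t by simp
        then show ?thesis unfolding D_def using off\<Phi>[OF _ that, of t] t by auto
      qed
      have \<kappa>d: "(\<kappa> has_real_derivative - (2 * M0) * \<kappa> t) (at t within {T..t1})"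
        unfolding \<kappa>_def by (auto intro!: derivative_eq_intros)
      have "((\<lambda>t. B t \<theta>) has_real_derivative 2 * M0 * \<kappa> t * (\<theta> \<bullet> \<theta>)) (at t within {T..t1})"
        unfolding B_def by (auto intro!: derivative_eq_intros \<kappa>d)
      from DERIV_chain2[OF bump_has_real_derivative this]
      have "((\<lambda>t. bump (B t \<theta>)) has_real_derivative bump' (B t \<theta>) * (2 * M0 * \<kappa> t * (\<theta> \<bullet> \<theta>))) (at t within {T..t1})" .
      then have "((\<lambda>t. \<Phi> t \<theta>) has_real_derivative
          (\<theta> \<bullet> \<theta>) * (bump (Z \<theta>) * (bump (Q \<theta>) * (bump' (B t \<theta>) * (2 * M0 * \<kappa> t * (\<theta> \<bullet> \<theta>)))))) (at t within {T..t1})"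
        unfolding \<Phi>_def by (intro DERIV_cmult)
      moreover have "((\<lambda>t. exp (- c * (t - T))) has_real_derivative (- c) * exp (- c * (t - T))) (at t within {T..t1})"
        by (auto intro!: derivative_eq_intros)
      ultimately show "((\<lambda>t. \<Psi> t \<theta>) has_real_derivative D t \<theta>) (at t within {T..t1})"
        unfolding \<Psi>_def D_def by (auto intro!: derivative_eq_intros simp: algebra_simps)
    next
      have bc: "continuous_on UNIV bump"
        by (rule DERIV_continuous_on[OF has_field_derivative_at_within[OF bump_has_real_derivative]])
      have pc: "continuous_on UNIV p" using p(1)[of 0] by simp
      have cq: "continuous_on ({T..t1} \<times> UNIV) (\<lambda>x. qf (snd x))"
        by (rule continuous_on_compose2[OF continuous_on_qf continuous_on_snd[OF continuous_on_id]]) auto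
      have cp: "continuous_on ({T..t1} \<times> UNIV) (\<lambda>x. p (snd x))"
        by (rule continuous_on_compose2[OF pc continuous_on_snd[OF continuous_on_id]]) auto
      have cZ: "continuous_on ({T..t1} \<times> UNIV) (\<lambda>x. Z (snd x))"
        unfolding Z_def by (intro continuous_intros cp)
      have cQ: "continuous_on ({T..t1} \<times> UNIV) (\<lambda>x. Q (snd x))"
        unfolding Q_def by (intro continuous_intros cq)
      have cB: "continuous_on ({T..t1} \<times> UNIV) (\<lambda>x. B (fst x) (snd x))"
        unfolding B_def \<kappa>_def by (intro continuous_intros)
      show "continuous_on ({T..t1} \<times> UNIV) (\<lambda>(t, \<theta>). D t \<theta>)"
        unfolding D_def \<Phi>_def case_prod_beta' \<kappa>_def
        by (intro continuous_intros continuous_on_compose2[OF bump'_continuous cB]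
            continuous_on_compose2[OF bc cZ] continuous_on_compose2[OF bc cQ] continuous_on_compose2[OF bc cB]) auto
    next
      fix t and \<theta> :: "'d param" assume t: "T < t" "t < t1" and \<theta>: "\<theta> \<in> Theta"
      have t0: "0 \<le> t" and tT: "T \<le> t" and tt: "t \<le> t1" using t T by auto
      let ?v = "vel h \<theta>" and ?V = "V t \<theta>" and ?n = "\<theta> \<bullet> \<theta>"
      let ?bZ = "bump (Z \<theta>)" and ?bQ = "bump (Q \<theta>)" and ?bB = "bump (B t \<theta>)"
      have dn: "((\<lambda>\<theta>. \<theta> \<bullet> \<theta>) has_derivative (\<lambda>v. (2 *\<^sub>R \<theta>) \<bullet> v)) (at \<theta>)"
        using has_derivative_dist_sq[of 0 \<theta>] by simp
      have dZ: "(Z has_derivative (\<lambda>v. ((2 * s) *\<^sub>R \<theta> - p' \<theta>) \<bullet> v)) (at \<theta>)"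
        unfolding Z_def[abs_def]
        by (rule has_derivative_eq_rhs[OF has_derivative_diff[OF has_derivative_diff[OF has_derivative_mult_right[OF dn] p(2)] has_derivative_const]])
           (auto simp: fun_eq_iff inner_diff_left)
      have dQ: "(Q has_derivative (\<lambda>v. (2 *\<^sub>R (- fst \<theta>, snd \<theta>)) \<bullet> v)) (at \<theta>)"
        unfolding Q_def[abs_def] using has_derivative_diff[OF has_derivative_qf has_derivative_const] by simp
      have dB: "(B t has_derivative (\<lambda>v. ((- 2 * \<kappa> t) *\<^sub>R \<theta>) \<bullet> v)) (at \<theta>)"
        unfolding B_def[abs_def]
        by (rule has_derivative_eq_rhs[OF has_derivative_diff[OF has_derivative_const has_derivative_mult_right[OF dn]]])
           (auto simp: fun_eq_iff)
      note dP = has_derivative_inner_mult[OF dn has_derivative_inner_mult[OF has_derivative_inner_bump[OF dZ]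
            has_derivative_inner_mult[OF has_derivative_inner_bump[OF dQ] has_derivative_inner_bump[OF dB]]]]
      have cons: "(- fst \<theta>, snd \<theta>) \<bullet> ?V = 0"
        using vel_inner_conserved[OF bounded_density_flow[OF t0], of \<theta>] by (simp add: inner_commute)
      define G where "G = ?n *\<^sub>R (?bZ *\<^sub>R (?bQ *\<^sub>R (bump' (B t \<theta>) *\<^sub>R ((- 2 * \<kappa> t) *\<^sub>R \<theta>))
          + ?bB *\<^sub>R (bump' (Q \<theta>) *\<^sub>R (2 *\<^sub>R (- fst \<theta>, snd \<theta>))))
          + (?bQ * ?bB) *\<^sub>R (bump' (Z \<theta>) *\<^sub>R ((2 * s) *\<^sub>R \<theta> - p' \<theta>)))
          + (?bZ * (?bQ * ?bB)) *\<^sub>R (2 *\<^sub>R \<theta>)"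
      have "(\<Phi> t has_derivative (\<lambda>v. G \<bullet> v)) (at \<theta>)"
        unfolding \<Phi>_def[abs_def] G_def by (rule dP)
      then have "(\<Psi> t has_derivative (\<lambda>v. exp (- c * (t - T)) * (G \<bullet> v))) (at \<theta>)"
        unfolding \<Psi>_def[abs_def] by (rule has_derivative_mult_right)
      then have "(\<Psi> t has_derivative (\<lambda>v. (exp (- c * (t - T)) *\<^sub>R G) \<bullet> v)) (at \<theta>)" by simp
      then have gr: "grad (\<Psi> t) \<theta> = exp (- c * (t - T)) *\<^sub>R G" by (rule grad_eq)
      have GV: "G \<bullet> ?V = ?n * (?bZ * (?bQ * (bump' (B t \<theta>) * ((- 2 * \<kappa> t) * (\<theta> \<bullet> ?V)))))
          + ?n * ((?bQ * ?bB) * (bump' (Z \<theta>) * (((2 * s) *\<^sub>R \<theta> - p' \<theta>) \<bullet> ?V)))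
          + (?bZ * (?bQ * ?bB)) * (2 * (\<theta> \<bullet> ?V))"
        unfolding G_def inner_add_left inner_scaleR_left cons by (simp only: mult_zero_right add_0_right distrib_left mult.assoc)
      have n0: "0 \<le> ?n" by simp
      have V1: "- (\<theta> \<bullet> ?V) \<le> M0 * ?n"
      proof -
        have "\<bar>\<theta> \<bullet> ?V\<bar> \<le> norm \<theta> * (M0 * norm \<theta>)"
          by (rule order_trans[OF Cauchy_Schwarz_ineq2]) (intro mult_left_mono VM t0 norm_ge_zero)
        also have "\<dots> = M0 * ?n" unfolding power2_norm_eq_inner[symmetric] power2_eq_square by simp
        finally show ?thesis by linarith
      qed
      have i1: "?n * (?bZ * (?bQ * (bump' (B t \<theta>) * ((- 2 * \<kappa> t) * (\<theta> \<bullet> ?V)))))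
          \<le> ?n * (?bZ * (?bQ * (bump' (B t \<theta>) * (2 * M0 * \<kappa> t * ?n))))"
      proof -
        have "- 2 * a * x \<le> 2 * M0 * a * m" if "0 \<le> a" "- x \<le> M0 * m" for a x m :: real
          using mult_left_mono[OF that(2), of "2 * a"] that(1) by (simp add: algebra_simps)
        from this[OF _ V1, of "\<kappa> t"] have "(- 2 * \<kappa> t) * (\<theta> \<bullet> ?V) \<le> 2 * M0 * \<kappa> t * ?n"
          unfolding \<kappa>_def by simp
        from mult_left_mono[OF mult_left_mono[OF mult_left_mono[OF mult_left_mono[OF this bump'_nonneg] bump_nonneg] bump_nonneg] n0]
        show ?thesis .
      qed
      \<comment> \<open>The two facts needed on the support: \<open>Z\<close> does not decrease
        along characteristics, and |\<theta>|^2 grows at least at rate \<open>c\<close>.\<close>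
      have zero_or: "0 < Z \<theta> \<Longrightarrow> 0 < Q \<theta> \<Longrightarrow> 0 < B t \<theta> \<Longrightarrow>
          ((2 * s) *\<^sub>R \<theta> - p' \<theta>) \<bullet> ?V \<le> 0 \<and> 2 * (\<theta> \<bullet> ?V) \<le> - c * ?n"
      proof -
        assume a: "0 < Z \<theta>" "0 < Q \<theta>" "0 < B t \<theta>"
        have "\<theta> \<in> M" using inM[OF tt a(2,3)] .
        then have q: "\<epsilon> \<le> qf \<theta>" and nR: "norm \<theta> \<le> Rm" by (auto simp: M_def)
        note pe = p(3)[OF q nR] and p'e = p(4)[OF q nR]
        have nn: "?n = (norm \<theta>)\<^sup>2" by (simp add: power2_norm_eq_inner)
        have le: "pot h \<theta> \<le> s * (norm \<theta>)\<^sup>2" using a(1) pe unfolding Z_def nn by linarith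
        have sq\<epsilon>: "sqrt \<epsilon> \<le> norm \<theta>"
          using real_sqrt_le_mono[OF order_trans[OF q qf_le]] by simp
        have vM: "norm ?v \<le> M0 * norm \<theta>" using norm_vel_le[OF h, of \<theta>] by (simp add: M0_def)
        have d: "c1 * ?n \<le> (?v - (2 * s) *\<^sub>R \<theta>) \<bullet> ?v"
        proof -
          have "(?v - (2 * s) *\<^sub>R \<theta>) \<bullet> ?v = (norm ?v)\<^sup>2 - 4 * s * pot h \<theta>"
            unfolding inner_diff_left inner_scaleR_left power2_norm_eq_inner
            using vel_inner_self[OF h, of \<theta>] by (simp add: inner_commute)
          then show ?thesis using diss[OF \<theta> le] unfolding nn by simp
        qed
        have d1: "- (c1 / 2 * ?n) \<le> (?v - (2 * s) *\<^sub>R \<theta>) \<bullet> (?V - ?v)"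
        proof -
          have "norm (?v - (2 * s) *\<^sub>R \<theta>) \<le> norm ?v + norm ((2 * s) *\<^sub>R \<theta>)" by (rule norm_triangle_ineq4)
          also have "\<dots> \<le> (M0 + 2 * \<bar>s\<bar>) * norm \<theta>" using vM by (simp add: abs_mult algebra_simps)
          finally have "norm (?v - (2 * s) *\<^sub>R \<theta>) * norm (?V - ?v) \<le> ((M0 + 2 * \<bar>s\<bar>) * norm \<theta>) * (e1 * norm \<theta>)"
            using near(2)[OF tT \<theta>] M0 by (intro mult_mono) auto
          also have "\<dots> = ((M0 + 2 * \<bar>s\<bar>) * e1) * ?n" by (simp add: nn power2_eq_square)
          also have "\<dots> \<le> c1 / 2 * ?n" using e1(2) by (intro mult_right_mono) (auto simp: M0_def)
          finally show ?thesis using Cauchy_Schwarz_ineq2[of "?v - (2 * s) *\<^sub>R \<theta>" "?V - ?v"] by linarith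
        qed
        have d2: "- (c1 / 2 * ?n) \<le> (p' \<theta> - ?v) \<bullet> ?V"
        proof -
          have "norm (p' \<theta> - ?v) * norm ?V \<le> e * (M0 * norm \<theta>)"
            using p'e VM[OF t0, of \<theta>] e(1) by (intro mult_mono) auto
          also have "\<dots> = (M0 * e) * norm \<theta>" by simp
          also have "\<dots> \<le> (c1 / 2 * sqrt \<epsilon>) * norm \<theta>" by (intro mult_right_mono e(3)) auto
          also have "\<dots> \<le> (c1 / 2 * norm \<theta>) * norm \<theta>" using sq\<epsilon> c1 by (intro mult_right_mono mult_left_mono) auto
          also have "\<dots> = c1 / 2 * ?n" by (simp add: nn power2_eq_square)
          finally show ?thesis using Cauchy_Schwarz_ineq2[of "p' \<theta> - ?v" ?V] by linarith
        qed
        \<comment> \<open>The exact dissipation of the limit field is at least c1 |\<theta>|^2;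
          replacing the limit velocity by the current one and the limit gradient by that of
          \<open>p\<close> costs at most half of it each.\<close>
        have "((2 * s) *\<^sub>R \<theta> - p' \<theta>) \<bullet> ?V = - ((?v - (2 * s) *\<^sub>R \<theta>) \<bullet> ?v + (?v - (2 * s) *\<^sub>R \<theta>) \<bullet> (?V - ?v) + (p' \<theta> - ?v) \<bullet> ?V)"
          by (simp add: inner_diff_left inner_diff_right algebra_simps)
        also have "\<dots> \<le> 0" using d d1 d2 by linarith
        finally have r1: "((2 * s) *\<^sub>R \<theta> - p' \<theta>) \<bullet> ?V \<le> 0" .
        \<comment> \<open>Euler's identity gives the rate 4 |s| inside the limit cone; half of it is
          given away to the deviation of the current potential from its limit.\<close>
        have "2 * (\<theta> \<bullet> ?V) = 4 * pot (dens (\<pi> t)) \<theta>"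
          using vel_inner_self[OF bounded_density_flow[OF t0], of \<theta>] by (simp add: inner_commute)
        also have "\<dots> \<le> 4 * (s * ?n + e1 * ?n)" using near(1)[OF tT \<theta>] le unfolding nn by simp
        also have "\<dots> = (4 * s + 4 * e1) * ?n" by (simp add: algebra_simps)
        also have "\<dots> \<le> (- c) * ?n" using e1(3) s by (intro mult_right_mono) (auto simp: c_def)
        finally show ?thesis using r1 by blast
      qed
      have i2: "?n * ((?bQ * ?bB) * (bump' (Z \<theta>) * (((2 * s) *\<^sub>R \<theta> - p' \<theta>) \<bullet> ?V))) \<le> 0"
      proof (cases "0 < Z \<theta> \<and> 0 < Q \<theta> \<and> 0 < B t \<theta>")
        case True
        then have "((2 * s) *\<^sub>R \<theta> - p' \<theta>) \<bullet> ?V \<le> 0" using zero_or by blast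
        then show ?thesis by (intro mult_nonneg_nonpos mult_nonneg_nonneg bump_nonneg bump'_nonneg n0)
      next
        case False
        then consider "Z \<theta> \<le> 0" | "Q \<theta> \<le> 0" | "B t \<theta> \<le> 0" by linarith
        then show ?thesis by cases (simp_all add: bump_eq_0 bump'_eq_0)
      qed
      have i3: "(?bZ * (?bQ * ?bB)) * (2 * (\<theta> \<bullet> ?V)) \<le> (?bZ * (?bQ * ?bB)) * (- c * ?n)"
      proof (cases "0 < Z \<theta> \<and> 0 < Q \<theta> \<and> 0 < B t \<theta>")
        case True
        then have "2 * (\<theta> \<bullet> ?V) \<le> - c * ?n" using zero_or by blast
        then show ?thesis by (intro mult_left_mono mult_nonneg_nonneg bump_nonneg)
      next
        case False
        then consider "Z \<theta> \<le> 0" | "Q \<theta> \<le> 0" | "B t \<theta> \<le> 0" by linarith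
        then show ?thesis by cases (simp_all add: bump_eq_0)
      qed
      have "G \<bullet> ?V \<le> (- c) * \<Phi> t \<theta> + ?n * (?bZ * (?bQ * (bump' (B t \<theta>) * (2 * M0 * \<kappa> t * ?n))))"
        unfolding GV \<Phi>_def using i1 i2 i3 by (simp add: mult_ac)
      then show "grad (\<Psi> t) \<theta> \<bullet> V t \<theta> \<le> D t \<theta>"
        unfolding gr D_def inner_scaleR_left by (intro mult_left_mono) auto
    qed (use M off\<Phi> in auto)
    have \<Psi>i: "integrable (\<pi> t) (\<Psi> t)" if "T \<le> t" "t \<le> t1" for t
    proof (rule integrable_continuous_compact_support[OF _ _ M(1)])
      show "0 \<le> t" using that T by simp
      show "continuous_on M (\<Psi> t)" using Ck\<Psi>[of 0 t] by (auto intro: continuous_on_subset)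
      show "\<theta> \<notin> M \<Longrightarrow> \<Psi> t \<theta> = 0" for \<theta> using off\<Phi>[OF that(2)] by (simp add: \<Psi>_def)
    qed
    have "y \<le> (\<integral>\<theta>. \<Psi> T \<theta> \<partial>\<pi> T)"
    proof -
      have Ns: "?N \<in> sets (\<pi> T)" using N_open P2_D(1)[OF flow_P2[OF T]] by auto
      have "y = (\<integral>\<theta>. (\<delta> * bump (\<delta> / 2) * bump (\<delta> / 2) * bump 1) * indicator ?N \<theta> \<partial>\<pi> T)"
        using Ns by (simp add: y_def)
      also have "\<dots> \<le> (\<integral>\<theta>. \<Psi> T \<theta> \<partial>\<pi> T)"
      proof (rule integral_mono[OF _ \<Psi>i[OF order_refl t1]])
        show "integrable (\<pi> T) (\<lambda>\<theta>. (\<delta> * bump (\<delta> / 2) * bump (\<delta> / 2) * bump 1) * indicator ?N \<theta>)"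
          using Ns by (intro integrable_mult_right) (simp add: pT.emeasure_eq_measure)
        fix \<theta>
        show "(\<delta> * bump (\<delta> / 2) * bump (\<delta> / 2) * bump 1) * indicator ?N \<theta> \<le> \<Psi> T \<theta>"
        proof (cases "\<theta> \<in> ?N")
          case True
          then have q: "\<delta> < qf \<theta>" and po: "pot h \<theta> < s * (norm \<theta>)\<^sup>2 - \<delta>" and nR: "norm \<theta> < R" by auto
          have nn: "\<theta> \<bullet> \<theta> = (norm \<theta>)\<^sup>2" by (simp add: power2_norm_eq_inner)
          have n2: "(norm \<theta>)\<^sup>2 \<le> R\<^sup>2" using nR by (intro power_mono) auto
          have \<kappa>T: "\<kappa> T = 1" by (simp add: \<kappa>_def)
          have BT: "1 \<le> B T \<theta>" using n2 by (simp add: B_def \<kappa>T R2_def nn)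
          have QT: "\<delta> / 2 \<le> Q \<theta>" using q by (simp add: Q_def \<epsilon>_def)
          have "\<theta> \<in> M" using inM[OF t1] QT BT \<delta> by simp
          then have "\<bar>p \<theta> - pot h \<theta>\<bar> \<le> e" by (intro p(3)) (auto simp: M_def)
          then have ZT: "\<delta> / 2 \<le> Z \<theta>" using po e(2) unfolding Z_def nn by linarith
          have "\<delta> \<le> \<theta> \<bullet> \<theta>" using q qf_le[of \<theta>] unfolding nn by linarith
          then have "\<delta> * (bump (\<delta> / 2) * (bump (\<delta> / 2) * bump 1)) \<le> \<Phi> T \<theta>"
            unfolding \<Phi>_def using \<delta>
            by (intro mult_mono bump_mono ZT QT BT) (auto simp: bump_nonneg)
          then show ?thesis using True by (simp add: \<Psi>_def mult.assoc)
        next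
          case False
          then show ?thesis by (simp add: \<Psi>_def \<Phi>_def bump_nonneg)
        qed
      qed
      finally show ?thesis .
    qed
    also have "\<dots> \<le> (\<integral>\<theta>. \<Psi> t1 \<theta> \<partial>\<pi> t1)" by (rule main)
    also have "\<dots> \<le> (\<integral>\<theta>. exp (- c * (t1 - T)) * (norm \<theta>)\<^sup>2 \<partial>\<pi> t1)"
    proof (rule integral_mono[OF \<Psi>i[OF t1 order_refl]])
      show "integrable (\<pi> t1) (\<lambda>\<theta>. exp (- c * (t1 - T)) * (norm \<theta>)\<^sup>2)"
        using T t1 by (intro integrable_mult_right P2_D(5)[OF flow_P2]) auto
      fix \<theta>
      have "bump (Z \<theta>) * (bump (Q \<theta>) * bump (B t1 \<theta>)) \<le> 1 * (1 * 1)"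
        by (intro mult_mono bump_le_1) (auto simp: bump_nonneg)
      then have "(\<theta> \<bullet> \<theta>) * (bump (Z \<theta>) * (bump (Q \<theta>) * bump (B t1 \<theta>))) \<le> (\<theta> \<bullet> \<theta>) * 1"
        by (intro mult_left_mono) auto
      then show "\<Psi> t1 \<theta> \<le> exp (- c * (t1 - T)) * (norm \<theta>)\<^sup>2"
        unfolding \<Psi>_def \<Phi>_def by (intro mult_left_mono) (auto simp: power2_norm_eq_inner)
    qed
    also have "\<dots> = exp (- c * (t1 - T)) * sq_moment (\<pi> t1)" by (simp add: sq_moment_def)
    finally have "y * exp (c * (t1 - T)) \<le> (exp (- c * (t1 - T)) * sq_moment (\<pi> t1)) * exp (c * (t1 - T))"
      by (rule mult_right_mono) simp
    also have "\<dots> = sq_moment (\<pi> t1)" by (simp add: exp_minus)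
    finally show "y * exp (2 * \<bar>s\<bar> * (t1 - T)) \<le> sq_moment (\<pi> t1)" by (simp add: c_def)
  qed
qed

end

subsection \<open>Optimality of critical networks\<close>

lemma eq_0_if_abs_le:
  fixes x :: real
  assumes "\<And>e. 0 < e \<Longrightarrow> \<bar>x\<bar> \<le> c * e" "0 \<le> c"
  shows "x = 0"
proof (rule ccontr)
  assume x: "x \<noteq> 0"
  have "\<bar>x\<bar> \<le> c * (\<bar>x\<bar> / (2 * (c + 1)))" using x assms(2) by (intro assms(1)) (auto intro!: divide_pos_pos)
  also have "\<dots> = \<bar>x\<bar> * (c / (2 * (c + 1)))" by simp
  also have "\<dots> < \<bar>x\<bar> * 1" using x assms(2) by (intro mult_strict_left_mono) (auto simp: divide_less_eq)
  finally show False by simp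
qed

context relu_data
begin

lemma marg_D: "sets (marg P) = sets borel" "space (marg P) = UNIV" "prob_space (marg P)"
  unfolding marg_def by (auto intro: prob_space_distr)

lemma integral_marg:
  fixes f :: "real ^ 'd \<Rightarrow> real"
  assumes "f \<in> borel_measurable borel"
  shows "(\<integral>x. f x \<partial>marg P) = (\<integral>z. f (fst z) \<partial>P)"
    and "integrable (marg P) f \<longleftrightarrow> integrable P (\<lambda>z. f (fst z))"
  unfolding marg_def using assms by (auto intro!: integral_distr integrable_distr_eq)

text \<open>A bounded \<open>h\<close> defines a continuous functional on L1 of the marginal, and
  this functional vanishes on the dense span of the neurons.\<close>

lemma density_orthogonal:
  assumes dense: "\<And>k e. integrable (marg P) k \<Longrightarrow> 0 < e \<Longrightarrow> \<exists>S c. finite S \<and> S \<subseteq> closure Theta \<and>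
      (\<integral>x. \<bar>k x - (\<Sum>\<theta>\<in>S. c \<theta> * phi \<theta> x)\<bar> \<partial>marg P) < e"
    and h: "bounded_density C h" and zero: "\<And>\<theta>. \<theta> \<in> closure Theta \<Longrightarrow> pot h \<theta> = 0"
    and k: "integrable (marg P) k"
  shows "(\<integral>z. h z * k (fst z) \<partial>P) = 0"
proof (rule eq_0_if_abs_le[OF _ bounded_densityD(3)[OF h]])
  fix e :: real assume "0 < e"
  from dense[OF k this] obtain S c where S: "finite S" "S \<subseteq> closure Theta"
    "(\<integral>x. \<bar>k x - (\<Sum>\<theta>\<in>S. c \<theta> * phi \<theta> x)\<bar> \<partial>marg P) < e" by blast
  have km: "k \<in> borel_measurable borel"
    using borel_measurable_integrable[OF k] measurable_cong_sets[OF marg_D(1) refl, of borel] by blast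
  have ki: "integrable P (\<lambda>z. k (fst z))" using k integral_marg(2)[OF km] by simp
  have phii: "integrable P (\<lambda>z. phi \<theta> (fst z))" for \<theta>
    by (rule integrable_le_wt[where c="(norm \<theta>)\<^sup>2"]) (auto simp: phi_abs_le wt_def)
  have hm: "h \<in> borel_measurable P" by (rule bounded_densityD(1)[OF h])
  let ?s = "\<lambda>x. \<Sum>\<theta>\<in>S. c \<theta> * phi \<theta> x"
  have si: "integrable P (\<lambda>z. ?s (fst z))"
    by (intro Bochner_Integration.integrable_sum integrable_mult_right phii)
  have hsi: "integrable P (\<lambda>z. h z * ?s (fst z))" and hs0: "(\<integral>z. h z * ?s (fst z) \<partial>P) = 0"
  proof -
    have eq: "h z * ?s (fst z) = (\<Sum>\<theta>\<in>S. c \<theta> * (h z * phi \<theta> (fst z)))" for z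
      by (simp add: sum_distrib_left mult.left_commute)
    show "integrable P (\<lambda>z. h z * ?s (fst z))"
      unfolding eq by (intro Bochner_Integration.integrable_sum integrable_mult_right integrable_pot[OF h])
    have "(\<integral>z. h z * ?s (fst z) \<partial>P) = (\<Sum>\<theta>\<in>S. c \<theta> * pot h \<theta>)"
      unfolding eq pot_def by (subst Bochner_Integration.integral_sum) (auto intro: integrable_pot[OF h])
    also have "\<dots> = 0" using zero S(2) by (intro sum.neutral) auto
    finally show "(\<integral>z. h z * ?s (fst z) \<partial>P) = 0" .
  qed
  have di: "integrable P (\<lambda>z. C * \<bar>k (fst z) - ?s (fst z)\<bar>)"
    by (intro integrable_mult_right integrable_abs Bochner_Integration.integrable_diff ki si)
  have hki: "integrable P (\<lambda>z. h z * k (fst z))"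
  proof (rule Bochner_Integration.integrable_bound[OF integrable_mult_right[OF ki, of C]])
    show "(\<lambda>z. h z * k (fst z)) \<in> borel_measurable P"
      using hm borel_measurable_integrable[OF ki] by measurable
    show "AE z in P. norm (h z * k (fst z)) \<le> norm (C * k (fst z))"
      using bounded_densityD(2,3)[OF h] by (auto intro!: AE_I2 mult_right_mono simp: abs_mult)
  qed
  have "(\<integral>z. h z * k (fst z) \<partial>P) = (\<integral>z. h z * k (fst z) - h z * ?s (fst z) \<partial>P)"
    using hki hsi hs0 by simp
  also have "\<bar>\<dots>\<bar> \<le> (\<integral>z. C * \<bar>k (fst z) - ?s (fst z)\<bar> \<partial>P)"
  proof (rule norm_integral_le_wt[where 'b=real, unfolded real_norm_def])
    show "integrable P (\<lambda>z. h z * k (fst z) - h z * ?s (fst z))"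
      by (intro Bochner_Integration.integrable_diff hki hsi)
    fix z
    show "\<bar>h z * k (fst z) - h z * ?s (fst z)\<bar> \<le> C * \<bar>k (fst z) - ?s (fst z)\<bar>"
      unfolding right_diff_distrib[symmetric] abs_mult
      using bounded_densityD(2)[OF h] by (intro mult_right_mono) auto
  qed (rule di)
  also have "\<dots> = C * (\<integral>x. \<bar>k x - ?s x\<bar> \<partial>marg P)"
    by (subst integral_marg(1)) (use km in auto)
  also have "\<dots> \<le> C * e" using S(3) bounded_densityD(3)[OF h] by (intro mult_left_mono) auto
  finally show "\<bar>\<integral>z. h z * k (fst z) \<partial>P\<bar> \<le> C * e" .
qed

text \<open>The kernel \<open>J\<close> places the conditional law of y on the fibre over x, so that
  the bind of \<open>marg P\<close> with \<open>J\<close> is a measure on pairs. Rectangles generate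
  the sigma-algebra and are stable under intersection, and on them the claim is the defining
  property of the conditional distribution.\<close>

lemma disintegration:
  assumes \<kappa>: "cond_distribution P \<kappa>"
  defines "J \<equiv> \<lambda>x. distr (\<kappa> x) borel (Pair x)"
  shows "J \<in> marg P \<rightarrow>\<^sub>M subprob_algebra borel" "P = marg P \<bind> J"
    and "\<And>x. sets (\<kappa> x) = sets borel" "\<And>x. prob_space (\<kappa> x)"
proof -
  have \<kappa>m: "\<kappa> \<in> borel \<rightarrow>\<^sub>M prob_algebra borel" and
    \<kappa>e: "\<And>A B. A \<in> sets borel \<Longrightarrow> B \<in> sets borel \<Longrightarrow>
      emeasure P (A \<times> B) = (\<integral>\<^sup>+x. emeasure (\<kappa> x) B * indicator A x \<partial>marg P)"
    using \<kappa> by (auto simp: cond_distribution_def)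
  have "\<kappa> x \<in> space (prob_algebra borel)" for x using measurable_space[OF \<kappa>m] by simp
  then show s: "sets (\<kappa> x) = sets borel" and ps: "prob_space (\<kappa> x)" for x
    by (auto simp: space_prob_algebra)
  have "(\<lambda>x. distr (\<kappa> x) borel (Pair x)) \<in> borel \<rightarrow>\<^sub>M subprob_algebra (borel :: ((real ^ 'd) \<times> real) measure)"
  proof (rule measurable_distr2[OF _ measurable_prob_algebraD[OF \<kappa>m]])
    show "(\<lambda>(x, y). (x, y)) \<in> (borel :: (real ^ 'd) measure) \<Otimes>\<^sub>M (borel :: real measure) \<rightarrow>\<^sub>M borel"
      unfolding borel_prod by simp
  qed
  then show J: "J \<in> marg P \<rightarrow>\<^sub>M subprob_algebra borel"
    unfolding J_def measurable_cong_sets[OF marg_D(1) refl] .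
  have Jx: "emeasure (J x) (A \<times> B) = emeasure (\<kappa> x) B * indicator A x"
    if "A \<in> sets borel" "B \<in> sets borel" for x A B
  proof -
    have "Pair x \<in> \<kappa> x \<rightarrow>\<^sub>M (borel :: ((real ^ 'd) \<times> real) measure)"
      unfolding measurable_cong_sets[OF s refl] borel_prod[symmetric] by measurable
    moreover have "A \<times> B \<in> sets (borel :: ((real ^ 'd) \<times> real) measure)"
      unfolding borel_prod[symmetric] using that by (intro pair_measureI) auto
    ultimately have "emeasure (J x) (A \<times> B) = emeasure (\<kappa> x) (Pair x -` (A \<times> B) \<inter> space (\<kappa> x))"
      unfolding J_def by (rule emeasure_distr)
    also have "Pair x -` (A \<times> B) \<inter> space (\<kappa> x) = (if x \<in> A then B else {})"
      using sets_eq_imp_space_eq[OF s[of x]] by auto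
    finally show ?thesis by (auto simp: indicator_def)
  qed
  let ?E = "{A \<times> B | A B. A \<in> sets (borel :: (real ^ 'd) measure) \<and> B \<in> sets (borel :: real measure)}"
  have gen: "sets (borel :: ((real ^ 'd) \<times> real) measure) = sigma_sets UNIV ?E"
    unfolding borel_prod[symmetric] sets_pair_measure by simp
  show "P = marg P \<bind> J"
  proof (rule measure_eqI_generator_eq[where \<Omega>=UNIV and E="?E" and A="\<lambda>_. UNIV"])
    show "Int_stable ?E" by (rule Int_stable_pair_measure_generator)
    show "sets P = sigma_sets UNIV ?E" using gen by simp
    have "sets (marg P \<bind> J) = sets borel"
      by (rule sets_bind) (auto simp: J_def marg_D)
    then show "sets (marg P \<bind> J) = sigma_sets UNIV ?E" using gen by simp
    show "range (\<lambda>_. UNIV) \<subseteq> ?E" by (auto intro!: exI[of _ UNIV])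
    fix X assume "X \<in> ?E"
    then obtain A B where X: "X = A \<times> B" "A \<in> sets borel" "B \<in> sets borel" by blast
    have "X \<in> sets (borel :: ((real ^ 'd) \<times> real) measure)"
      unfolding borel_prod[symmetric] using X by (auto intro: pair_measureI)
    then have "emeasure (marg P \<bind> J) X = (\<integral>\<^sup>+x. emeasure (J x) X \<partial>marg P)"
      by (intro emeasure_bind[OF _ J]) (simp_all add: marg_D)
    then show "emeasure P X = emeasure (marg P \<bind> J) X"
      unfolding X(1) using \<kappa>e[OF X(2,3)] Jx[OF X(2,3)] by simp
  qed (auto simp: emeasure_eq_measure)
qed

end

context relu_risk
begin

section \<open>From vanishing conditional derivatives to minimality\<close>

lemma loss_lipschitz: "\<bar>l u y - l u' y\<bar> \<le> C * \<bar>u - u'\<bar>"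
proof -
  have "norm (l u y - l u' y) \<le> C * norm (u - u')"
    by (rule field_differentiable_bound[of UNIV _ "\<lambda>u. d1 l u y"])
       (use loss_has_real_derivative(1)[OF loss] d1_bound in auto)
  then show ?thesis by simp
qed

lemma loss_tangent: "l u y + d1 l u y * (u' - u) \<le> l u' y"
proof -
  have "convex_on UNIV (\<lambda>u. l u y)" using loss by (simp add: loss_assm_def)
  from convex_on_imp_above_tangent[OF this connected_UNIV, of u u' "d1 l u y"]
  show ?thesis using loss_has_real_derivative(1)[OF loss] by simp
qed

lemma loss_nonneg: "0 \<le> l u y" using loss by (simp add: loss_assm_def)

lemma loss_section_measurable: "l u \<in> borel_measurable borel" "d1 l u \<in> borel_measurable borel"
proof -
  have p: "(\<lambda>y. (u, y)) \<in> borel \<rightarrow>\<^sub>M (borel :: (real \<times> real) measure)"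
    by (intro borel_measurable_Pair) auto
  show "l u \<in> borel_measurable borel" "d1 l u \<in> borel_measurable borel"
    using measurable_compose[OF p loss_measurable(1)[OF loss]] measurable_compose[OF p loss_measurable(2)[OF loss]] by simp_all
qed

text \<open>With H the conditional mean of the derivative, testing orthogonality against the bounded
  function sgn H yields that the integral of |H| is 0.\<close>

lemma critical_conditional_derivative:
  assumes \<kappa>: "cond_distribution P \<kappa>" and \<mu>: "\<mu> \<in> P2 A"
    and orth: "\<And>k. integrable (marg P) k \<Longrightarrow> (\<integral>z. dens \<mu> z * k (fst z) \<partial>P) = 0"
  shows "AE x in marg P. (\<integral>y. d1 l (f_net \<mu> x) y \<partial>\<kappa> x) = 0"
proof -
  note dis = disintegration[OF \<kappa>]
  define J where "J x = distr (\<kappa> x) borel (Pair x)" for x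
  note J = dis(1,2)[folded J_def]
  interpret m: prob_space "marg P" by (rule marg_D(3))
  define H where "H x = (\<integral>y. d1 l (f_net \<mu> x) y \<partial>\<kappa> x)" for x
  have Pair_meas: "Pair x \<in> \<kappa> x \<rightarrow>\<^sub>M (borel :: ((real ^ 'd) \<times> real) measure)" for x
    unfolding measurable_cong_sets[OF dis(3) refl] borel_prod[symmetric] by measurable
  have dm: "dens \<mu> \<in> borel_measurable borel"
    using bounded_density_dens[OF \<mu>] by (simp add: bounded_density_def)
  \<comment> \<open>Rewriting the conditional mean as an integral against the kernel
    \<open>J\<close> gives its measurability in x, although the integrand itself also depends on
    x.\<close>
  have HJ: "H x = (\<integral>z. dens \<mu> z \<partial>J x)" for x
    unfolding J_def by (subst integral_distr[OF Pair_meas dm]) (simp add: H_def dens_def)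
  have "(\<lambda>x. \<integral>z. dens \<mu> z \<partial>J x) \<in> borel_measurable (marg P)"
    by (rule measurable_compose[OF J(1) integral_measurable_subprob_algebra[OF dm]])
  then have Hm: "H \<in> borel_measurable (marg P)" by (simp add: HJ[abs_def])
  have Hm': "H \<in> borel_measurable borel"
    using Hm unfolding measurable_cong_sets[OF marg_D(1) refl] .
  have Hb: "\<bar>H x\<bar> \<le> C" for x
  proof -
    interpret k: prob_space "\<kappa> x" by (rule dis(4))
    have "d1 l (f_net \<mu> x) \<in> borel_measurable (\<kappa> x)"
      unfolding measurable_cong_sets[OF dis(3) refl] by (rule loss_section_measurable)
    then have "integrable (\<kappa> x) (d1 l (f_net \<mu> x))"
      by (intro k.integrable_const_bound[of _ C]) (auto simp: d1_bound)
    then have "norm (H x) \<le> (\<integral>y. C \<partial>\<kappa> x)"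
      unfolding H_def by (rule Bochner_Integration.integral_norm_bound_integral) (auto simp: d1_bound)
    then show ?thesis using k.prob_space by simp
  qed
  have sm: "(\<lambda>x. sgn (H x)) \<in> borel_measurable borel" using Hm' by measurable
  have "integrable (marg P) (\<lambda>x. sgn (H x))"
    by (rule m.integrable_const_bound[of _ 1])
       (use Hm in \<open>auto simp: sgn_if\<close>)
  from orth[OF this] have "0 = (\<integral>z. dens \<mu> z * sgn (H (fst z)) \<partial>P)" by simp
  also have "\<dots> = (\<integral>z. dens \<mu> z * sgn (H (fst z)) \<partial>(marg P \<bind> J))"
    using J(2) by (rule arg_cong)
  also have "\<dots> = (\<integral>x. \<integral>z. dens \<mu> z * sgn (H (fst z)) \<partial>J x \<partial>marg P)"
  proof (rule integral_bind[OF _ _ J(1) m.finite_measure_axioms, where B=C and B'=1])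
    have "(fst :: (real ^ 'd) \<times> real \<Rightarrow> _) \<in> borel \<rightarrow>\<^sub>M borel"
      unfolding borel_prod[symmetric] by measurable
    from measurable_compose[OF this sm] show "(\<lambda>z. dens \<mu> z * sgn (H (fst z))) \<in> borel_measurable borel"
      using dm by measurable
    fix z
    have "\<bar>dens \<mu> z\<bar> * \<bar>sgn (H (fst z))\<bar> \<le> C * 1"
      using C_nonneg by (intro mult_mono) (auto simp: dens_def d1_bound sgn_if)
    then show "\<bar>dens \<mu> z * sgn (H (fst z))\<bar> \<le> C" by (simp add: abs_mult)
  next
    have "emeasure (J x) (space (J x)) = 1" for x
      unfolding J_def using prob_space.prob_space_distr[OF dis(4) Pair_meas] prob_space.emeasure_space_1 by blast
    then show "AE x in marg P. emeasure (J x) (space (J x)) \<le> ennreal 1" by simp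
  qed
  also have "\<dots> = (\<integral>x. \<bar>H x\<bar> \<partial>marg P)"
  proof (rule Bochner_Integration.integral_cong[OF refl])
    fix x
    have "(\<integral>z. dens \<mu> z * sgn (H (fst z)) \<partial>J x) = (\<integral>y. d1 l (f_net \<mu> x) y * sgn (H x) \<partial>\<kappa> x)"
      unfolding J_def
    proof (subst integral_distr[OF Pair_meas])
      have "(fst :: (real ^ 'd) \<times> real \<Rightarrow> _) \<in> borel \<rightarrow>\<^sub>M borel"
        unfolding borel_prod[symmetric] by measurable
      from measurable_compose[OF this sm] show "(\<lambda>z. dens \<mu> z * sgn (H (fst z))) \<in> borel_measurable borel"
        using dm by measurable
    qed (simp add: dens_def)
    also have "\<dots> = H x * sgn (H x)" by (simp add: H_def)
    also have "\<dots> = \<bar>H x\<bar>" by (simp add: abs_sgn)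
    finally show "(\<integral>z. dens \<mu> z * sgn (H (fst z)) \<partial>J x) = \<bar>H x\<bar>" .
  qed
  finally have "(\<integral>x. \<bar>H x\<bar> \<partial>marg P) = 0" by simp
  moreover have "integrable (marg P) (\<lambda>x. \<bar>H x\<bar>)"
    by (rule m.integrable_const_bound[of _ C]) (use Hm Hb in auto)
  ultimately have "AE x in marg P. \<bar>H x\<bar> = 0" by (subst (asm) integral_nonneg_eq_0_iff_AE) auto
  then show ?thesis unfolding H_def by simp
qed

text \<open>One null set serves all \<alpha>: integrability is obtained at \<alpha> = 0 by
  disintegrating, and the Lipschitz bound on the loss, uniform in y, carries it to every other
  \<alpha>.\<close>

lemma conditional_loss_integrable:
  assumes \<kappa>: "cond_distribution P \<kappa>" and l0: "integrable P (\<lambda>z. l 0 (snd z))"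
  shows "AE x in marg P. \<forall>\<alpha>. integrable (\<kappa> x) (l \<alpha>)"
proof -
  note dis = disintegration[OF \<kappa>]
  define J where "J x = distr (\<kappa> x) borel (Pair x)" for x
  note J = dis(1,2)[folded J_def]
  have Pair_meas: "Pair x \<in> \<kappa> x \<rightarrow>\<^sub>M (borel :: ((real ^ 'd) \<times> real) measure)" for x
    unfolding measurable_cong_sets[OF dis(3) refl] borel_prod[symmetric] by measurable
  have "(snd :: (real ^ 'd) \<times> real \<Rightarrow> _) \<in> borel \<rightarrow>\<^sub>M borel"
    unfolding borel_prod[symmetric] by measurable
  from measurable_compose[OF this loss_section_measurable(1)]
  have fm: "(\<lambda>z. ennreal (l 0 (snd z))) \<in> borel_measurable (borel :: ((real ^ 'd) \<times> real) measure)"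
    by measurable
  have "(\<integral>\<^sup>+z. ennreal (l 0 (snd z)) \<partial>P) \<noteq> \<infinity>"
    using l0 loss_nonneg by (simp add: nn_integral_eq_integral)
  moreover have "(\<integral>\<^sup>+z. ennreal (l 0 (snd z)) \<partial>P) = (\<integral>\<^sup>+x. \<integral>\<^sup>+z. ennreal (l 0 (snd z)) \<partial>J x \<partial>marg P)"
    by (rule trans[OF arg_cong[OF J(2), of "\<lambda>M. integral\<^sup>N M (\<lambda>z. ennreal (l 0 (snd z)))"] nn_integral_bind[OF fm J(1)]])
  ultimately have "AE x in marg P. (\<integral>\<^sup>+z. ennreal (l 0 (snd z)) \<partial>J x) \<noteq> \<infinity>"
    by (intro nn_integral_noteq_infinite measurable_compose[OF J(1) nn_integral_measurable_subprob_algebra[OF fm]]) simp_all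
  then show ?thesis
  proof eventually_elim
    case (elim x)
    interpret k: prob_space "\<kappa> x" by (rule dis(4))
    have m: "l \<alpha> \<in> borel_measurable (\<kappa> x)" for \<alpha>
      unfolding measurable_cong_sets[OF dis(3) refl] by (rule loss_section_measurable)
    have "(\<integral>\<^sup>+z. ennreal (l 0 (snd z)) \<partial>J x) = (\<integral>\<^sup>+y. ennreal (l 0 y) \<partial>\<kappa> x)"
      unfolding J_def by (subst nn_integral_distr[OF Pair_meas]) (use fm in simp_all)
    then have i0: "integrable (\<kappa> x) (l 0)"
      using elim m[of 0] loss_nonneg by (intro integrableI_bounded) (auto simp: less_top[symmetric])
    show ?case
    proof
      fix \<alpha>
      show "integrable (\<kappa> x) (l \<alpha>)"
      proof (rule Bochner_Integration.integrable_bound[OF Bochner_Integration.integrable_add[OF i0 k.integrable_const[of "C * \<bar>\<alpha>\<bar>"]] m])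
        have "\<bar>l \<alpha> y\<bar> \<le> \<bar>l 0 y + C * \<bar>\<alpha>\<bar>\<bar>" for y
          using loss_lipschitz[of \<alpha> y 0] loss_nonneg[of \<alpha> y] by simp
        then show "AE y in \<kappa> x. norm (l \<alpha> y) \<le> norm (l 0 y + C * \<bar>\<alpha>\<bar>)" by simp
      qed
    qed
  qed
qed

lemma f_net_integrable_marg:
  assumes "\<mu> \<in> P2 A"
  shows "integrable (marg P) (f_net \<mu>)"
proof -
  note [measurable] = f_net_measurable[OF assms]
  have "integrable P (\<lambda>z. f_net \<mu> (fst z))"
    by (rule integrable_le_wt[where c="sq_moment \<mu>"]) (auto simp: wt_def f_net_abs_le[OF assms])
  then show ?thesis using integral_marg(2)[OF f_net_measurable[OF assms]] by simp
qed

text \<open>Both conclusions are tangent inequalities of the convex loss with vanishing linear term.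
  For the conditional losses the term is the conditional mean of the derivative; for the risk it is
  the pairing of \<open>dens \<mu>\<close> with a difference of networks.\<close>

theorem critical_network_optimal:
  assumes \<kappa>: "cond_distribution P \<kappa>" and l0: "integrable P (\<lambda>z. l 0 (snd z))"
    and \<mu>: "\<mu> \<in> P2 (closure Theta)"
    and orth: "\<And>k. integrable (marg P) k \<Longrightarrow> (\<integral>z. dens \<mu> z * k (fst z) \<partial>P) = 0"
  shows "optimal_predictor l P \<kappa> (f_net \<mu>)" "risk_minimizing l P \<mu>"
proof -
  note dis = disintegration[OF \<kappa>]
  have "AE x in marg P. (\<integral>y. d1 l (f_net \<mu> x) y \<partial>\<kappa> x) = 0"
    by (rule critical_conditional_derivative[OF \<kappa> \<mu>]) (rule orth)
  then have "AE x in marg P. is_arg_min (cond_loss l \<kappa> x) (\<lambda>_. True) (f_net \<mu> x)"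
    using conditional_loss_integrable[OF \<kappa> l0]
  proof eventually_elim
    case (elim x)
    interpret k: prob_space "\<kappa> x" by (rule dis(4))
    let ?u = "f_net \<mu> x"
    have dm: "d1 l ?u \<in> borel_measurable (\<kappa> x)"
      unfolding measurable_cong_sets[OF dis(3) refl] by (rule loss_section_measurable)
    have di: "integrable (\<kappa> x) (d1 l ?u)"
      by (rule k.integrable_const_bound[of _ C]) (auto simp: d1_bound dm)
    have "cond_loss l \<kappa> x ?u \<le> cond_loss l \<kappa> x \<alpha>" for \<alpha>
    proof -
      have "(\<integral>y. l ?u y + d1 l ?u y * (\<alpha> - ?u) \<partial>\<kappa> x) \<le> (\<integral>y. l \<alpha> y \<partial>\<kappa> x)"
        using elim(2) di by (intro integral_mono loss_tangent) auto
      then show ?thesis using elim di by (simp add: cond_loss_def)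
    qed
    then show ?case by (auto simp: is_arg_min_def not_less)
  qed
  moreover have "f_net \<mu> \<in> borel_measurable (marg P)"
    unfolding measurable_cong_sets[OF marg_D(1) refl] by (rule f_net_measurable[OF \<mu>])
  ultimately show "optimal_predictor l P \<kappa> (f_net \<mu>)" by (simp add: optimal_predictor_def)
  have ri: "integrable P (\<lambda>z. l (f_net \<nu> (fst z)) (snd z))" if \<nu>: "\<nu> \<in> P2 (closure Theta)" for \<nu>
  proof (rule Bochner_Integration.integrable_bound[OF Bochner_Integration.integrable_add[OF l0]])
    note [measurable] = f_net_measurable[OF \<nu>]
    show "integrable P (\<lambda>z. C * \<bar>f_net \<nu> (fst z)\<bar>)"
      using f_net_integrable_marg[OF \<nu>] integral_marg(2)[OF f_net_measurable[OF \<nu>]] by simp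
    have "(\<lambda>z. (f_net \<nu> (fst z), snd z)) \<in> P \<rightarrow>\<^sub>M (borel :: (real \<times> real) measure)"
      by (intro borel_measurable_Pair) measurable
    from measurable_compose[OF this loss_measurable(1)[OF loss]]
    show "(\<lambda>z. l (f_net \<nu> (fst z)) (snd z)) \<in> borel_measurable P" by simp
    have "\<bar>l (f_net \<nu> (fst z)) (snd z)\<bar> \<le> \<bar>l 0 (snd z) + C * \<bar>f_net \<nu> (fst z)\<bar>\<bar>" for z
      using loss_lipschitz[of "f_net \<nu> (fst z)" "snd z" 0] loss_nonneg[of "f_net \<nu> (fst z)" "snd z"] by simp
    then show "AE z in P. norm (l (f_net \<nu> (fst z)) (snd z)) \<le> norm (l 0 (snd z) + C * \<bar>f_net \<nu> (fst z)\<bar>)"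
      by simp
  qed
  have "risk l P \<mu> \<le> risk l P \<nu>" if \<nu>: "\<nu> \<in> P2 (closure Theta)" for \<nu>
  proof -
    let ?k = "\<lambda>x. f_net \<nu> x - f_net \<mu> x"
    have ki: "integrable (marg P) ?k"
      by (intro Bochner_Integration.integrable_diff f_net_integrable_marg[OF \<nu>] f_net_integrable_marg[OF \<mu>])
    have km: "?k \<in> borel_measurable borel"
      by (intro borel_measurable_diff f_net_measurable[OF \<nu>] f_net_measurable[OF \<mu>])
    have kP: "integrable P (\<lambda>z. ?k (fst z))" using ki integral_marg(2)[OF km] by simp
    have dk: "integrable P (\<lambda>z. dens \<mu> z * ?k (fst z))"
    proof (rule Bochner_Integration.integrable_bound[OF integrable_mult_right[OF kP, of C]])
      show "(\<lambda>z. dens \<mu> z * ?k (fst z)) \<in> borel_measurable P"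
        using bounded_densityD(1)[OF bounded_density_dens[OF \<mu>]] borel_measurable_integrable[OF kP]
        by (rule borel_measurable_times)
      have "\<bar>dens \<mu> z * ?k (fst z)\<bar> \<le> \<bar>C * ?k (fst z)\<bar>" for z
        using d1_bound C_nonneg by (auto simp: abs_mult dens_def intro: mult_right_mono)
      then show "AE z in P. norm (dens \<mu> z * ?k (fst z)) \<le> norm (C * ?k (fst z))" by simp
    qed
    have "(\<integral>z. l (f_net \<mu> (fst z)) (snd z) + dens \<mu> z * ?k (fst z) \<partial>P) \<le> (\<integral>z. l (f_net \<nu> (fst z)) (snd z) \<partial>P)"
      unfolding dens_def
      by (intro integral_mono Bochner_Integration.integrable_add ri[OF \<mu>] ri[OF \<nu>] dk[unfolded dens_def] loss_tangent)
    then show ?thesis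
      using orth[OF ki] ri[OF \<mu>] dk by (simp add: risk_def case_prod_beta')
  qed
  then show "risk_minimizing l P \<mu>"
    using \<mu> by (auto simp: risk_minimizing_def is_arg_min_def not_less)
qed

end

subsection \<open>Convergence along the flow\<close>

lemma closure_Theta_scaleR:
  fixes \<theta> :: "'d::finite param"
  assumes "\<theta> \<in> closure Theta" "0 < c"
  shows "c *\<^sub>R \<theta> \<in> closure Theta"
proof -
  have "(\<lambda>x. c *\<^sub>R x) ` closure Theta = closure ((\<lambda>x. c *\<^sub>R x) ` (Theta :: 'd param set))"
    by (rule closure_scaleR)
  also have "\<dots> \<subseteq> closure Theta"
    using Theta_scaleR[OF _ assms(2)] by (intro closure_mono) auto
  finally show ?thesis using assms(1) by blast
qed

lemma uniform_limit_if_le: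
  assumes "\<And>n x. x \<in> X \<Longrightarrow> dist (F n x) (G x) \<le> B * a n" "a \<longlonglongrightarrow> 0"
  shows "uniform_limit X F G sequentially"
proof (rule uniform_limitI)
  fix e :: real assume e: "0 < e"
  have "(\<lambda>n. B * a n) \<longlonglongrightarrow> B * 0" by (intro tendsto_mult tendsto_const assms(2))
  then have "eventually (\<lambda>n. B * a n < e) sequentially" using e by (intro order_tendstoD) auto
  then show "eventually (\<lambda>n. \<forall>x\<in>X. dist (F n x) (G x) < e) sequentially"
    by (rule eventually_mono) (use assms(1) le_less_trans in blast)
qed

context relu_data
begin

text \<open>Both differences are bounded by the L1 distance of the densities times a power of the
  norm. The limits \<open>g\<close> and \<open>W\<close> are prescribed on \<open>A\<close> only, so
  extensional restrictions and unrestricted versions are served alike.\<close>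

lemma loc_unif_limit_L1dist:
  assumes "\<And>n. bounded_density C (h n)" "bounded_density C h'" "(\<lambda>n. L1dist (h n) h') \<longlonglongrightarrow> 0"
    and "\<And>\<theta>. \<theta> \<in> A \<Longrightarrow> g \<theta> = pot h' \<theta>" "\<And>\<theta>. \<theta> \<in> A \<Longrightarrow> W \<theta> = vel h' \<theta>"
  shows "loc_unif_limit A (\<lambda>n. pot (h n)) g" "loc_unif_limit A (\<lambda>n. vel (h n)) W"
proof -
  have "uniform_limit M (\<lambda>n. pot (h n)) g sequentially \<and> uniform_limit M (\<lambda>n. vel (h n)) W sequentially"
    if M: "compact M" "M \<subseteq> A" for M
  proof -
    obtain B where B: "\<And>\<theta>. \<theta> \<in> M \<Longrightarrow> norm \<theta> \<le> B"
      using compact_imp_bounded[OF M(1)] unfolding bounded_iff by blast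
    have "uniform_limit M (\<lambda>n. pot (h n)) g sequentially"
    proof (rule uniform_limit_if_le[OF _ assms(3), where B="B\<^sup>2"])
      fix n \<theta> assume \<theta>: "\<theta> \<in> M"
      have "\<bar>pot (h n) \<theta> - pot h' \<theta>\<bar> \<le> (norm \<theta>)\<^sup>2 * L1dist (h n) h'" by (rule pot_diff_le[OF assms(1,2)])
      also have "\<dots> \<le> B\<^sup>2 * L1dist (h n) h'"
        using B[OF \<theta>] by (intro mult_right_mono L1dist_nonneg power_mono) auto
      finally have "\<bar>pot (h n) \<theta> - pot h' \<theta>\<bar> \<le> B\<^sup>2 * L1dist (h n) h'" .
      moreover have "g \<theta> = pot h' \<theta>" using assms(4) \<theta> M(2) by blast
      ultimately show "dist (pot (h n) \<theta>) (g \<theta>) \<le> B\<^sup>2 * L1dist (h n) h'" by (simp only: dist_real_def)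
    qed
    moreover have "uniform_limit M (\<lambda>n. vel (h n)) W sequentially"
    proof (rule uniform_limit_if_le[OF _ assms(3), where B="2 * B"])
      fix n \<theta> assume \<theta>: "\<theta> \<in> M"
      have "norm (vel (h n) \<theta> - vel h' \<theta>) \<le> 2 * norm \<theta> * L1dist (h n) h'" by (rule vel_diff_le[OF assms(1,2)])
      also have "\<dots> \<le> 2 * B * L1dist (h n) h'"
        using B[OF \<theta>] by (intro mult_right_mono L1dist_nonneg) auto
      finally have "norm (vel (h n) \<theta> - vel h' \<theta>) \<le> 2 * B * L1dist (h n) h'" .
      moreover have "W \<theta> = vel h' \<theta>" using assms(5) \<theta> M(2) by blast
      ultimately show "dist (vel (h n) \<theta>) (W \<theta>) \<le> 2 * B * L1dist (h n) h'" by (simp only: dist_norm)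
    qed
    ultimately show ?thesis by blast
  qed
  then show "loc_unif_limit A (\<lambda>n. pot (h n)) g" "loc_unif_limit A (\<lambda>n. vel (h n)) W"
    unfolding loc_unif_limit_def by blast+
qed

lemma pot_vel_zero: "pot h 0 = 0" "vel h 0 = 0"
  by (simp_all add: pot_def vel_def phi_eq grad_phi_eq relu_def zero_prod_def[symmetric])

lemma norm_vel_sphere:
  assumes "bounded_density C h" "norm \<theta> = 1"
  shows "norm (vel h \<theta>) \<le> 2 * C * mom" "\<bar>pot h \<theta>\<bar> \<le> C * mom"
proof -
  show v: "norm (vel h \<theta>) \<le> 2 * C * mom" using norm_vel_le[OF assms(1), of \<theta>] assms(2) by simp
  have "\<bar>2 * pot h \<theta>\<bar> \<le> norm (vel h \<theta>) * norm \<theta>"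
    unfolding vel_inner_self[OF assms(1), symmetric] by (rule Cauchy_Schwarz_ineq2)
  then show "\<bar>pot h \<theta>\<bar> \<le> C * mom" using v assms(2) by simp
qed

text \<open>Arzela-Ascoli is applied to potential and velocity jointly on the compact part of the
  sphere, where the Lipschitz and size bounds depend on \<open>C\<close> alone. Homogeneity, of
  degree 2 and 1 respectively, extends the limits to the whole cone and makes the convergence
  locally uniform.\<close>

lemma subsequence_limit:
  assumes h: "\<And>n. bounded_density C (h n)"
  obtains k g W where "strict_mono (k :: nat \<Rightarrow> nat)"
    "g \<in> extensional (closure Theta)" "W \<in> extensional (closure Theta)"
    "loc_unif_limit (closure Theta) (\<lambda>n. pot (h (k n))) g"
    "loc_unif_limit (closure Theta) (\<lambda>n. vel (h (k n))) W"
proof -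
  let ?S = "sphere (0 :: 'd param) 1 \<inter> closure Theta"
  have C: "0 \<le> C" using bounded_densityD(3)[OF h] .
  define F where "F n \<theta> = (pot (h n) \<theta>, vel (h n) \<theta>)" for n \<theta>
  define Lc where "Lc = 2 * C * mom + C * (3 * mom + 2 * L)"
  have Lc: "0 \<le> Lc" unfolding Lc_def using C mom_ge_1 L_nonneg by simp
  have F_lip: "norm (F n \<theta> - F n \<theta>') \<le> Lc * norm (\<theta> - \<theta>')" if "\<theta> \<in> ?S" "\<theta>' \<in> ?S" for n \<theta> \<theta>'
  proof -
    have "\<bar>pot (h n) \<theta> - pot (h n) \<theta>'\<bar> \<le> 2 * C * mom * norm (\<theta> - \<theta>')"
      using pot_lipschitz[OF h, of n \<theta> \<theta>'] that by (simp add: mult_ac)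
    moreover have "norm (vel (h n) \<theta> - vel (h n) \<theta>') \<le> C * (3 * mom + 2 * L) * norm (\<theta> - \<theta>')"
      using that closure_Theta_qf[of \<theta>'] by (intro vel_lipschitz h) auto
    moreover have "norm (F n \<theta> - F n \<theta>') \<le> norm (pot (h n) \<theta> - pot (h n) \<theta>') + norm (vel (h n) \<theta> - vel (h n) \<theta>')"
      unfolding F_def diff_Pair by (rule norm_Pair_le)
    ultimately show ?thesis by (simp add: Lc_def algebra_simps)
  qed
  have "compact ?S" by (intro compact_Int_closed compact_sphere closed_closure)
  then obtain G and k :: "nat \<Rightarrow> nat" where k: "strict_mono k" and
    G: "\<And>e. 0 < e \<Longrightarrow> \<exists>N. \<forall>n \<theta>. N \<le> n \<and> \<theta> \<in> ?S \<longrightarrow> norm (F (k n) \<theta> - G \<theta>) < e"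
  proof (rule Arzela_Ascoli[of ?S F "C * mom + 2 * C * mom"])
    fix n and \<theta> :: "'d param" assume "\<theta> \<in> ?S"
    then have n: "norm \<theta> = 1" by simp
    have "norm (F n \<theta>) \<le> norm (pot (h n) \<theta>) + norm (vel (h n) \<theta>)" unfolding F_def by (rule norm_Pair_le)
    then show "norm (F n \<theta>) \<le> C * mom + 2 * C * mom" using norm_vel_sphere[OF h n, of n] by simp
  next
    fix \<theta> :: "'d param" and e :: real assume \<theta>: "\<theta> \<in> ?S" and e: "0 < e"
    have d: "0 < e / (Lc + 1)" using e Lc by simp
    have "norm (F n \<theta> - F n \<theta>') < e" if "\<theta>' \<in> ?S" "norm (\<theta> - \<theta>') < e / (Lc + 1)" for n \<theta>'
    proof -
      have "Lc * norm (\<theta> - \<theta>') \<le> (Lc + 1) * norm (\<theta> - \<theta>')" by (intro mult_right_mono) auto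
      also have "\<dots> < (Lc + 1) * (e / (Lc + 1))" using that(2) Lc by (intro mult_strict_left_mono) auto
      also have "\<dots> = e" using Lc by simp
      finally show ?thesis using F_lip[OF \<theta> that(1), of n] by linarith
    qed
    then show "\<exists>d>0. \<forall>n \<theta>'. \<theta>' \<in> ?S \<and> norm (\<theta> - \<theta>') < d \<longrightarrow> norm (F n \<theta> - F n \<theta>') < e"
      using d by blast
  qed (rule that)
  \<comment> \<open>At the origin the quotient takes the default value 0, which is harmless: the
    norm factors vanish there, as do potential and velocity. Restriction makes the limits eligible
    for \<open>Omega_lim\<close>.\<close>
  define g where "g = restrict (\<lambda>\<theta>. (norm \<theta>)\<^sup>2 * fst (G ((1 / norm \<theta>) *\<^sub>R \<theta>))) (closure Theta)"
  define W where "W = restrict (\<lambda>\<theta>. norm \<theta> *\<^sub>R snd (G ((1 / norm \<theta>) *\<^sub>R \<theta>))) (closure Theta)"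
  have close: "\<bar>pot (h (k n)) \<theta> - g \<theta>\<bar> \<le> (norm \<theta>)\<^sup>2 * e \<and> norm (vel (h (k n)) \<theta> - W \<theta>) \<le> norm \<theta> * e"
    if \<theta>: "\<theta> \<in> closure Theta" and e: "0 < e" and N: "\<And>\<theta>. \<theta> \<in> ?S \<Longrightarrow> norm (F (k n) \<theta> - G \<theta>) < e" for n \<theta> e
  proof (cases "\<theta> = 0")
    case True
    then show ?thesis using \<theta> by (simp add: g_def W_def pot_vel_zero)
  next
    case False
    define r where "r = norm \<theta>"
    define \<omega> where "\<omega> = (1 / r) *\<^sub>R \<theta>"
    have r: "0 < r" using False by (simp add: r_def)
    have \<theta>\<omega>: "\<theta> = r *\<^sub>R \<omega>" using r by (simp add: \<omega>_def)
    have "\<omega> \<in> closure Theta" unfolding \<omega>_def using r by (intro closure_Theta_scaleR[OF \<theta>]) auto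
    moreover have "norm \<omega> = 1" using r by (simp add: \<omega>_def r_def)
    ultimately have w: "norm (F (k n) \<omega> - G \<omega>) < e" using N by simp
    have comp: "norm (fst X) \<le> norm X" "norm (snd X) \<le> norm X" for X :: "real \<times> 'd param"
      using norm_fst_le[of "fst X" "snd X"] norm_snd_le[of "snd X" "fst X"] unfolding prod.collapse by blast+
    have f: "\<bar>pot (h (k n)) \<omega> - fst (G \<omega>)\<bar> \<le> e"
      using w comp(1)[of "F (k n) \<omega> - G \<omega>"] by (simp add: F_def)
    have s: "norm (vel (h (k n)) \<omega> - snd (G \<omega>)) \<le> e"
      using w comp(2)[of "F (k n) \<omega> - G \<omega>"] by (simp add: F_def)
    have g\<theta>: "g \<theta> = r\<^sup>2 * fst (G \<omega>)" and W\<theta>: "W \<theta> = r *\<^sub>R snd (G \<omega>)"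
      using \<theta> by (auto simp: g_def W_def r_def \<omega>_def)
    have "pot (h (k n)) \<theta> - g \<theta> = r\<^sup>2 * (pot (h (k n)) \<omega> - fst (G \<omega>))"
      unfolding g\<theta> by (subst \<theta>\<omega>, subst pot_scaleR[OF r]) (simp add: right_diff_distrib)
    moreover have "vel (h (k n)) \<theta> - W \<theta> = r *\<^sub>R (vel (h (k n)) \<omega> - snd (G \<omega>))"
      unfolding W\<theta> by (subst \<theta>\<omega>, subst vel_scaleR[OF r]) (simp add: scaleR_diff_right)
    ultimately show ?thesis using f s r by (simp add: abs_mult r_def[symmetric] mult_left_mono)
  qed
  have lim: "uniform_limit M (\<lambda>n. pot (h (k n))) g sequentially \<and> uniform_limit M (\<lambda>n. vel (h (k n))) W sequentially"
    if M: "compact M" "M \<subseteq> closure Theta" for M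
  proof -
    obtain B where B: "\<And>\<theta>. \<theta> \<in> M \<Longrightarrow> norm \<theta> \<le> B"
      using compact_imp_bounded[OF M(1)] unfolding bounded_iff by blast
    define B1 where "B1 = \<bar>B\<bar> + 1"
    have B1: "0 < B1" "\<And>\<theta>. \<theta> \<in> M \<Longrightarrow> norm \<theta> \<le> B1" using B by (fastforce simp: B1_def)+
    have key: "eventually (\<lambda>n. \<forall>\<theta>\<in>M. \<bar>pot (h (k n)) \<theta> - g \<theta>\<bar> < e \<and> norm (vel (h (k n)) \<theta> - W \<theta>) < e) sequentially"
      if e: "0 < e" for e
    proof -
      define e' where "e' = min (e / (2 * B1\<^sup>2)) (e / (2 * B1))"
      have e': "0 < e'" using e B1(1) by (simp add: e'_def)
      have "B1\<^sup>2 * e' \<le> B1\<^sup>2 * (e / (2 * B1\<^sup>2))" by (intro mult_left_mono) (auto simp: e'_def)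
      then have b1: "B1\<^sup>2 * e' < e" using e B1(1) by simp
      have "B1 * e' \<le> B1 * (e / (2 * B1))" using B1(1) by (intro mult_left_mono) (auto simp: e'_def)
      then have b2: "B1 * e' < e" using e B1(1) by simp
      obtain N where N: "\<And>n \<theta>. N \<le> n \<Longrightarrow> \<theta> \<in> ?S \<Longrightarrow> norm (F (k n) \<theta> - G \<theta>) < e'" using G[OF e'] by blast
      have "\<bar>pot (h (k n)) \<theta> - g \<theta>\<bar> < e \<and> norm (vel (h (k n)) \<theta> - W \<theta>) < e" if n: "N \<le> n" and \<theta>: "\<theta> \<in> M" for n \<theta>
      proof -
        have c: "\<bar>pot (h (k n)) \<theta> - g \<theta>\<bar> \<le> (norm \<theta>)\<^sup>2 * e'" "norm (vel (h (k n)) \<theta> - W \<theta>) \<le> norm \<theta> * e'"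
          using close[OF _ e' N[OF n], of \<theta>] \<theta> M(2) by blast+
        have "(norm \<theta>)\<^sup>2 * e' \<le> B1\<^sup>2 * e'" using B1(2)[OF \<theta>] e' by (intro mult_right_mono power_mono) auto
        moreover have "norm \<theta> * e' \<le> B1 * e'" using B1(2)[OF \<theta>] e' by (intro mult_right_mono) auto
        ultimately show ?thesis using c b1 b2 by linarith
      qed
      then show ?thesis unfolding eventually_sequentially by blast
    qed
    have "uniform_limit M (\<lambda>n. pot (h (k n))) g sequentially"
      by (rule uniform_limitI, rule eventually_mono[OF key]) (auto simp: dist_real_def)
    moreover have "uniform_limit M (\<lambda>n. vel (h (k n))) W sequentially"
      by (rule uniform_limitI, rule eventually_mono[OF key]) (simp_all only: dist_norm, blast)
    ultimately show ?thesis by blast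
  qed
  show ?thesis
    by (rule that[OF k, of g W]) (use lim in \<open>simp_all add: loc_unif_limit_def g_def W_def\<close>)
qed

lemma pot_fst_mult: "pot h (a, u) = a * (\<integral>z. h z * relu (u \<bullet> lift1 (fst z)) \<partial>P)"
  unfolding pot_def phi_eq by (subst integral_mult_right_zero[symmetric]) (simp add: mult_ac)

text \<open>The potential is odd in the outer weight \<open>a\<close>, so it is negative somewhere unless it vanishes.\<close>

lemma pot_negative_point:
  assumes "pot h \<theta> \<noteq> 0"
  obtains \<theta>' where "\<theta>' \<in> Theta" "pot h \<theta>' < 0"
proof -
  define u where "u = snd \<theta>"
  define q where "q = (\<integral>z. h z * relu (u \<bullet> lift1 (fst z)) \<partial>P)"
  have "pot h (fst \<theta>, u) \<noteq> 0" using assms by (simp add: u_def)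
  then have q: "q \<noteq> 0" unfolding pot_fst_mult q_def[symmetric] by simp
  have u: "u \<noteq> 0"
  proof
    assume "u = 0"
    then have "q = 0" by (simp add: q_def relu_def)
    then show False using q by simp
  qed
  show ?thesis
  \<comment> \<open>The sign of the outer weight makes the potential negative; half the norm of the
    inner weight keeps the point strictly inside \<open>Theta\<close>, with \<open>qf\<close> equal
    to 3/4 of that norm squared.\<close>
  proof (rule that[of "(- sgn q * (norm u / 2), u)"])
    have "(sgn q)\<^sup>2 = 1" using q by (simp add: sgn_if)
    then have "qf (- sgn q * (norm u / 2), u) = (norm u)\<^sup>2 * (3 / 4)"
      by (simp add: qf_def power_mult_distrib power_divide power2_norm_eq_inner)
    moreover have "0 < (norm u)\<^sup>2 * (3 / 4)" using u by simp
    ultimately show "(- sgn q * (norm u / 2), u) \<in> Theta" unfolding Theta_eq by (simp only: mem_Collect_eq)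
    have "pot h (- sgn q * (norm u / 2), u) = - (norm u / 2 * (q * sgn q))"
      unfolding pot_fst_mult q_def[symmetric] by simp
    also have "\<dots> = - (norm u / 2 * \<bar>q\<bar>)" by (simp add: abs_sgn)
    also have "\<dots> < 0" using u q by simp
    finally show "pot h (- sgn q * (norm u / 2), u) < 0" .
  qed
qed

end

lemma AE_lborel_interval:
  fixes a b :: real
  assumes "AE s in lborel. Q s" "a < b"
  obtains s where "a < s" "s < b" "Q s"
proof -
  obtain N where N: "{s \<in> space lborel. \<not> Q s} \<subseteq> N" "emeasure lborel N = 0" "N \<in> sets lborel"
    using assms(1) by (rule AE_E)
  have "\<exists>s\<in>{a<..<b}. Q s"
  proof (rule ccontr)
    assume "\<not> ?thesis"
    then have "{a<..<b} \<subseteq> N" using N(1) by auto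
    then have "emeasure lborel {a<..<b} \<le> emeasure lborel N" using N(3) by (rule emeasure_mono)
    then show False using N(2) assms(2) by simp
  qed
  then show ?thesis using that by auto
qed

context gradient_flow
begin

section \<open>Consequences of a unique limit pair\<close>

lemma limit_along_eq:
  "limit_along l P \<pi> \<tau> g W \<longleftrightarrow> filterlim \<tau> at_top sequentially \<and>
     loc_unif_limit (closure Theta) (\<lambda>n. pot (dens (\<pi> (\<tau> n)))) g \<and>
     loc_unif_limit (closure Theta) (\<lambda>n. V (\<tau> n)) W"
  by (simp add: limit_along_def delta_risk_eq grad_delta_risk_eq)

text \<open>If closeness failed at arbitrarily late times, a subsequence of these times would have a
  limit pair in \<open>Omega_lim\<close>. The only candidate is (g, W), and convergence to it on the
  compact sphere part contradicts the failure.\<close>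

lemma unique_limit_uniform:
  assumes card: "card (Omega_lim l P \<pi>) = 1" and mem: "(g, W) \<in> Omega_lim l P \<pi>" and e: "0 < e"
  obtains T where "0 \<le> T" "\<And>t \<theta>. T \<le> t \<Longrightarrow> \<theta> \<in> sphere 0 1 \<inter> closure Theta \<Longrightarrow>
    \<bar>pot (dens (\<pi> t)) \<theta> - g \<theta>\<bar> \<le> e \<and> norm (V t \<theta> - W \<theta>) \<le> e"
proof -
  let ?S = "sphere (0 :: 'd param) 1 \<inter> closure Theta"
  let ?bad = "\<lambda>t \<theta>. \<theta> \<in> ?S \<and> \<not> (\<bar>pot (dens (\<pi> t)) \<theta> - g \<theta>\<bar> \<le> e \<and> norm (V t \<theta> - W \<theta>) \<le> e)"
  have "\<exists>T\<ge>0. \<forall>t\<ge>T. \<forall>\<theta>. \<not> ?bad t \<theta>"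
  proof (rule ccontr)
    assume "\<not> ?thesis"
    then have "\<exists>p. real n \<le> fst p \<and> ?bad (fst p) (snd p)" for n
      using of_nat_0_le_iff[of n] by fastforce
    then obtain p where p: "\<And>n. real n \<le> fst (p n) \<and> ?bad (fst (p n)) (snd (p n))" by metis
    define \<tau> where "\<tau> n = fst (p n)" for n
    define \<eta> where "\<eta> n = snd (p n)" for n
    have \<tau>: "real n \<le> \<tau> n" and bad: "?bad (\<tau> n) (\<eta> n)" for n
      using p[of n] unfolding \<tau>_def \<eta>_def by blast+
    have \<tau>0: "0 \<le> \<tau> n" for n using \<tau>[of n] of_nat_0_le_iff[of n] by linarith
    obtain k g' W' where k: "strict_mono (k :: nat \<Rightarrow> nat)"
      and ext: "g' \<in> extensional (closure Theta)" "W' \<in> extensional (closure Theta)"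
      and lim: "loc_unif_limit (closure Theta) (\<lambda>n. pot (dens (\<pi> (\<tau> (k n))))) g'"
        "loc_unif_limit (closure Theta) (\<lambda>n. vel (dens (\<pi> (\<tau> (k n))))) W'"
      by (rule subsequence_limit[OF bounded_density_flow[OF \<tau>0]])
    have "filterlim (\<lambda>n. \<tau> (k n)) at_top sequentially"
    proof (rule filterlim_at_top_mono[OF filterlim_real_sequentially always_eventually], rule allI)
      fix n
      have "real n \<le> real (k n)" using seq_suble[OF k, of n] by simp
      then show "real n \<le> \<tau> (k n)" using \<tau>[of "k n"] by linarith
    qed
    then have "limit_along l P \<pi> (\<lambda>n. \<tau> (k n)) g' W'" using lim by (simp add: limit_along_eq)
    then have "(g', W') \<in> Omega_lim l P \<pi>" using ext unfolding Omega_lim_def by blast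
    then have eq: "g' = g" "W' = W"
    proof -
      obtain p where "Omega_lim l P \<pi> = {p}" using card by (rule card_1_singletonE)
      then have "(g', W') = (g, W)" using mem \<open>(g', W') \<in> Omega_lim l P \<pi>\<close> by simp
      then show "g' = g" "W' = W" by simp_all
    qed
    have "compact ?S" by (intro compact_Int_closed compact_sphere closed_closure)
    then have u: "uniform_limit ?S (\<lambda>n. pot (dens (\<pi> (\<tau> (k n))))) g sequentially"
      "uniform_limit ?S (\<lambda>n. vel (dens (\<pi> (\<tau> (k n))))) W sequentially"
      using lim unfolding eq loc_unif_limit_def by blast+
    have "eventually (\<lambda>n. (\<forall>\<theta>\<in>?S. dist (pot (dens (\<pi> (\<tau> (k n)))) \<theta>) (g \<theta>) < e)
        \<and> (\<forall>\<theta>\<in>?S. dist (vel (dens (\<pi> (\<tau> (k n)))) \<theta>) (W \<theta>) < e)) sequentially"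
      by (rule eventually_conj[OF uniform_limitD[OF u(1) e] uniform_limitD[OF u(2) e]])
    then obtain n where n: "\<forall>\<theta>\<in>?S. dist (pot (dens (\<pi> (\<tau> (k n)))) \<theta>) (g \<theta>) < e"
      "\<forall>\<theta>\<in>?S. dist (vel (dens (\<pi> (\<tau> (k n)))) \<theta>) (W \<theta>) < e"
      unfolding eventually_sequentially by blast
    have mem: "\<eta> (k n) \<in> ?S" and not: "\<not> (\<bar>pot (dens (\<pi> (\<tau> (k n)))) (\<eta> (k n)) - g (\<eta> (k n))\<bar> \<le> e
        \<and> norm (V (\<tau> (k n)) (\<eta> (k n)) - W (\<eta> (k n))) \<le> e)"
      using bad[of "k n"] by blast+
    show False
      using bspec[OF n(1) mem] bspec[OF n(2) mem] not unfolding dist_norm real_norm_def by linarith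
  qed
  then show ?thesis using that by blast
qed

theorem limit_potential_vanishes:
  assumes omni: "omnidirectional (\<pi> 0)" and ms: "morse_sard l P \<pi>"
    and t: "filterlim t at_top sequentially" and \<mu>: "\<mu> \<in> P2 (closure Theta)"
    and W2: "(\<lambda>n. W2 (\<pi> (t n)) \<mu>) \<longlonglongrightarrow> 0" and card: "card (Omega_lim l P \<pi>) = 1"
  shows "pot (dens \<mu>) \<theta> = 0"
proof (rule ccontr)
  assume nz: "pot (dens \<mu>) \<theta> \<noteq> 0"
  let ?h = "dens \<mu>"
  have h: "bounded_density C ?h" by (rule bounded_density_dens[OF \<mu>])
  \<comment> \<open>Early members of the sequence may be negative, where the flow is unconstrained;
    the shifted sequence \<open>t'\<close> starts after them.\<close>
  obtain N where N: "\<And>n. N \<le> n \<Longrightarrow> 0 \<le> t n"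
    using t unfolding filterlim_at_top eventually_sequentially by blast
  define t' where "t' n = t (n + N)" for n
  have t'0: "0 \<le> t' n" for n unfolding t'_def by (rule N) simp
  have t': "filterlim t' at_top sequentially"
    unfolding t'_def by (rule filterlim_compose[OF t filterlim_add_const_nat_at_top])
  have W2': "(\<lambda>n. W2 (\<pi> (t' n)) \<mu>) \<longlonglongrightarrow> 0"
    unfolding t'_def by (rule LIMSEQ_ignore_initial_segment[OF W2])
  have conv: "(\<lambda>n. L1dist (dens (\<pi> (t' n))) ?h) \<longlonglongrightarrow> 0"
    by (rule dens_L1dist_tendsto[OF flow_P2[OF t'0] \<mu> W2'])
  \<comment> \<open>Stated for any pair agreeing with the limit on the closure of
    \<open>Theta\<close>: membership in \<open>Omega_lim\<close> needs the restricted functions,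
    while the Morse-Sard condition is applied to the unrestricted ones.\<close>
  have la: "limit_along l P \<pi> t' g W"
    if "\<And>\<theta>. \<theta> \<in> closure Theta \<Longrightarrow> g \<theta> = pot ?h \<theta>" "\<And>\<theta>. \<theta> \<in> closure Theta \<Longrightarrow> W \<theta> = vel ?h \<theta>" for g W
    unfolding limit_along_eq
    using t' loc_unif_limit_L1dist[OF bounded_density_flow[OF t'0] h conv that] by blast
  define g where "g = restrict (pot ?h) (closure Theta)"
  define W where "W = restrict (vel ?h) (closure Theta)"
  have "limit_along l P \<pi> t' g W" by (rule la) (simp_all add: g_def W_def)
  then have mem: "(g, W) \<in> Omega_lim l P \<pi>"
    unfolding Omega_lim_def by (auto simp: g_def W_def)
  obtain \<theta>1 where \<theta>1: "\<theta>1 \<in> Theta" "pot ?h \<theta>1 < 0" using pot_negative_point[OF nz] .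
  then have n1: "0 < (norm \<theta>1)\<^sup>2" by (auto simp: Theta_eq qf_def)
  have "AE s in lborel. \<forall>\<theta> \<in> sphere 0 1 \<inter> closure Theta. pot ?h \<theta> = s \<longrightarrow> tangential (vel ?h) \<theta> \<noteq> 0"
    using ms la[of "pot ?h" "vel ?h"] unfolding morse_sard_def by blast
  moreover have "pot ?h \<theta>1 / (norm \<theta>1)\<^sup>2 < 0" using \<theta>1(2) n1 by (rule divide_neg_pos)
  ultimately obtain s where s: "pot ?h \<theta>1 / (norm \<theta>1)\<^sup>2 < s" "s < 0"
    and reg: "\<forall>\<theta> \<in> sphere 0 1 \<inter> closure Theta. pot ?h \<theta> = s \<longrightarrow> tangential (vel ?h) \<theta> \<noteq> 0"
    by (rule AE_lborel_interval)
  \<comment> \<open>Choosing the level above the normalised value at \<open>\<theta>1\<close> places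
    this point in the open sublevel cone, which is therefore nonempty.\<close>
  have \<theta>1s: "pot ?h \<theta>1 < s * (norm \<theta>1)\<^sup>2" using s(1) n1 by (simp add: divide_less_eq)
  obtain c1 where c1: "0 < c1" "\<And>\<theta>. \<theta> \<in> Theta \<Longrightarrow> pot ?h \<theta> \<le> s * (norm \<theta>)\<^sup>2 \<Longrightarrow>
      c1 * (norm \<theta>)\<^sup>2 \<le> (norm (vel ?h \<theta>))\<^sup>2 - 4 * s * pot ?h \<theta>"
    using dissipation_lower_bound[OF h s(2)] reg by blast
  define m where "m = 2 * C * mom + 2 * \<bar>s\<bar>"
  have "0 \<le> 2 * C * mom" using C_nonneg mom_ge_1 by simp
  then have m: "0 < m" using s(2) by (simp add: m_def)
  \<comment> \<open>The first bound limits the loss in dissipation to half of \<open>c1\<close>, the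
    second the loss in the growth rate of |\<theta>|^2 to half of 4 |s|.\<close>
  define e1 where "e1 = min (c1 / (2 * m)) (\<bar>s\<bar> / 2)"
  have e1: "0 < e1" "m * e1 \<le> c1 / 2" "4 * e1 \<le> 2 * \<bar>s\<bar>"
  proof -
    show "0 < e1" using c1(1) m s(2) by (simp add: e1_def)
    have "m * e1 \<le> m * (c1 / (2 * m))" using m by (intro mult_left_mono) (auto simp: e1_def)
    then show "m * e1 \<le> c1 / 2" using m by simp
    have "e1 \<le> \<bar>s\<bar> / 2" unfolding e1_def by (rule min.cobounded2)
    then show "4 * e1 \<le> 2 * \<bar>s\<bar>" by simp
  qed
  obtain T where T: "0 \<le> T" "\<And>t \<theta>. T \<le> t \<Longrightarrow> \<theta> \<in> sphere 0 1 \<inter> closure Theta \<Longrightarrow>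
    \<bar>pot (dens (\<pi> t)) \<theta> - g \<theta>\<bar> \<le> e1 \<and> norm (V t \<theta> - W \<theta>) \<le> e1"
    using unique_limit_uniform[OF card mem e1(1)] by blast
  \<comment> \<open>Homogeneity carries the estimate from the sphere to all of \<open>Theta\<close>,
    with the powers of |\<theta>| that the growth lemma expects.\<close>
  have near: "pot (dens (\<pi> t)) \<theta> \<le> pot ?h \<theta> + e1 * (norm \<theta>)\<^sup>2 \<and> norm (V t \<theta> - vel ?h \<theta>) \<le> e1 * norm \<theta>"
    if t: "T \<le> t" and \<theta>: "\<theta> \<in> Theta" for t \<theta>
  proof -
    define r where "r = norm \<theta>"
    have r: "0 < r" using \<theta> by (auto simp: r_def Theta_eq qf_def)
    define \<omega> where "\<omega> = (1 / r) *\<^sub>R \<theta>"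
    have \<theta>\<omega>: "\<theta> = r *\<^sub>R \<omega>" using r by (simp add: \<omega>_def)
    have "\<omega> \<in> Theta" unfolding \<omega>_def using r \<theta> by (intro Theta_scaleR) auto
    then have wc: "\<omega> \<in> closure Theta" using closure_subset by blast
    have "norm \<omega> = 1" using r by (simp add: \<omega>_def r_def)
    then have w: "\<bar>pot (dens (\<pi> t)) \<omega> - pot ?h \<omega>\<bar> \<le> e1" "norm (V t \<omega> - vel ?h \<omega>) \<le> e1"
      using T(2)[OF t, of \<omega>] wc by (auto simp: g_def W_def)
    have "r\<^sup>2 * pot (dens (\<pi> t)) \<omega> \<le> r\<^sup>2 * (pot ?h \<omega> + e1)" using w(1) by (intro mult_left_mono) auto
    then have 1: "pot (dens (\<pi> t)) \<theta> \<le> pot ?h \<theta> + e1 * r\<^sup>2"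
      by (subst (1 2) \<theta>\<omega>) (simp add: pot_scaleR[OF r] algebra_simps)
    have "V t \<theta> - vel ?h \<theta> = r *\<^sub>R (V t \<omega> - vel ?h \<omega>)"
      by (subst (1 2) \<theta>\<omega>) (simp add: vel_scaleR[OF r] scaleR_diff_right)
    then have "norm (V t \<theta> - vel ?h \<theta>) = r * norm (V t \<omega> - vel ?h \<omega>)" using r by simp
    also have "\<dots> \<le> r * e1" using w(2) r by (intro mult_left_mono) auto
    finally show ?thesis using 1 by (simp add: r_def mult.commute)
  qed
  obtain \<delta> R where \<delta>R: "0 < \<delta>" "0 < R"
    "0 < emeasure (\<pi> T) {\<theta>. \<delta> < qf \<theta> \<and> pot ?h \<theta> < s * (norm \<theta>)\<^sup>2 - \<delta> \<and> norm \<theta> < R}"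
    using sublevel_cone_positive_mass[OF omnidirectional_flow[OF omni T(1)] T(1) h \<theta>1(1) \<theta>1s] .
  obtain y where y: "0 < y" "\<And>t. T \<le> t \<Longrightarrow> y * exp (2 * \<bar>s\<bar> * (t - T)) \<le> sq_moment (\<pi> t)"
    using sq_moment_growth[OF T(1) h s(2) c1 e1(1) e1(2)[unfolded m_def] e1(3)
        conjunct1[OF near] conjunct2[OF near] \<delta>R] by blast
  define B where "B = 2 * sq_moment \<mu> + 2 * 1\<^sup>2"
  define k where "k = 2 * \<bar>s\<bar> * y"
  \<comment> \<open>Beyond this time even the linear lower bound k (t - T) for the exponential
    exceeds the bound \<open>B\<close> that convergence in \<open>W2\<close> imposes on the second
    moments along the sequence.\<close>
  define t2 where "t2 = T + B / k"
  have "eventually (\<lambda>n. W2 (\<pi> (t' n)) \<mu> < 1 \<and> t2 < t' n) sequentially"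
    using order_tendstoD(2)[OF W2' zero_less_one] t'[unfolded filterlim_at_top_dense, rule_format, of t2]
    by (rule eventually_conj)
  then obtain n where n: "W2 (\<pi> (t' n)) \<mu> < 1" "t2 < t' n" unfolding eventually_sequentially by blast
  have B: "sq_moment (\<pi> (t' n)) \<le> B"
    unfolding B_def by (rule sq_moment_le(2)[OF flow_P2[OF t'0] \<mu> n(1)])
  have B0: "0 \<le> B" using sq_moment_nonneg[of \<mu>] by (simp add: B_def)
  have sy: "0 < k" unfolding k_def using s(2) y(1) by (intro mult_pos_pos) auto
  have "0 \<le> B / k" using B0 sy by simp
  then have Tt: "T \<le> t' n" using n(2) by (simp add: t2_def)
  have "B = k * (t2 - T)" using sy by (simp add: t2_def)
  also have "\<dots> < k * (t' n - T)" using n(2) sy by (intro mult_strict_left_mono) auto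
  also have "\<dots> = y * (2 * \<bar>s\<bar> * (t' n - T))" by (simp add: k_def)
  also have "\<dots> \<le> y * exp (2 * \<bar>s\<bar> * (t' n - T))"
  proof (rule mult_left_mono)
    show "2 * \<bar>s\<bar> * (t' n - T) \<le> exp (2 * \<bar>s\<bar> * (t' n - T))"
      using exp_ge_add_one_self[of "2 * \<bar>s\<bar> * (t' n - T)"] by linarith
  qed (use y(1) in simp)
  also have "\<dots> \<le> B" using y(2)[OF Tt] B by linarith
  finally show False by simp
qed

end

section \<open>From the stated assumptions to the theorem\<close>

lemma data_assm_relu_data:
  fixes P :: "((real ^ 'd::finite) \<times> real) measure"
  assumes "data_assm P"
  obtains L where "relu_data P L"
proof -
  have sP: "sets P = sets borel" and pP: "prob_space P" and iP: "integrable P (\<lambda>(x, y). norm x + \<bar>y\<bar>)"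
    using assms unfolding data_assm_def by blast+
  interpret prob_space P by (rule pP)
  let ?I = "\<lambda>w b. {x :: real ^ 'd. w \<bullet> x + b > 0}"
  obtain L where L: "\<forall>(w, b) \<in> sphere 0 1. \<forall>(w', b') \<in> sphere 0 1.
        (\<integral>x. \<bar>indicator (?I w b) x - indicator (?I w' b') x\<bar>
            \<partial>density (marg P) (\<lambda>x. ennreal (sqrt (1 + (norm x)\<^sup>2)))) \<le> L * dist (w, b) (w', b')"
    using assms unfolding data_assm_def by blast
  have fm: "fst \<in> P \<rightarrow>\<^sub>M borel" and sm: "snd \<in> P \<rightarrow>\<^sub>M borel"
    unfolding measurable_cong_sets[OF sP refl] borel_prod[symmetric] by measurable
  note [measurable] = fm sm
  have ni: "integrable P (\<lambda>z. norm (fst z))"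
    by (rule Bochner_Integration.integrable_bound[OF iP]) auto
  \<comment> \<open>The factor 2 comes from 1 + |x| \<le> 2 sqrt(1 + |x|^2), and the absolute value
    makes the constant visibly nonnegative.\<close>
  have "relu_data P (2 * \<bar>L\<bar>)"
  proof (rule relu_data.intro[OF sP pP ni])
    fix u v :: "(real ^ 'd) \<times> real" assume u: "norm u = 1" and v: "norm v = 1"
    let ?d = "\<lambda>x. \<bar>indicator (?I (fst u) (snd u)) x - indicator (?I (fst v) (snd v)) x\<bar> :: real"
    let ?w = "\<lambda>x :: real ^ 'd. sqrt (1 + (norm x)\<^sup>2)"
    have d_eq: "\<bar>relu' (u \<bullet> lift1 x) - relu' (v \<bullet> lift1 x)\<bar> = ?d x" for x
      by (auto simp: relu'_def lift1_def inner_prod_def indicator_def)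
    have Im: "?I w b \<in> sets borel" for w b
      by (intro borel_open open_Collect_less continuous_intros)
    then have dm: "?d \<in> borel_measurable borel" by measurable
    have wm: "?w \<in> borel_measurable borel" by measurable
    have w1: "?w x \<le> 1 + norm x" for x
      using sqrt_add_le_add_sqrt[of 1 "(norm x)\<^sup>2"] by simp
    have w2: "1 + norm x \<le> 2 * ?w x" for x
    proof -
      have "1 \<le> ?w x" by simp
      moreover have "norm x \<le> ?w x" by (rule real_le_rsqrt) simp
      ultimately show ?thesis by linarith
    qed
    have d1: "0 \<le> ?d x" "?d x \<le> 1" for x by (auto simp: indicator_def)
    have int1: "integrable P (\<lambda>z. 1 + norm (fst z))" using ni by simp
    have dmP: "(\<lambda>z. ?d (fst z)) \<in> borel_measurable P" by (rule measurable_compose[OF fm dm])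
    have i1: "integrable P (\<lambda>z. (1 + norm (fst z)) * ?d (fst z))"
    proof (rule Bochner_Integration.integrable_bound[OF int1])
      show "AE z in P. norm ((1 + norm (fst z)) * ?d (fst z)) \<le> norm (1 + norm (fst z))"
        using d1 by (auto simp: abs_mult intro!: mult_left_le AE_I2)
    qed (use dmP in measurable)
    have i2: "integrable P (\<lambda>z. ?w (fst z) * ?d (fst z))"
    proof (rule Bochner_Integration.integrable_bound[OF int1])
      show "AE z in P. norm (?w (fst z) * ?d (fst z)) \<le> norm (1 + norm (fst z))"
      proof (rule AE_I2)
        fix z
        have "?w (fst z) * ?d (fst z) \<le> (1 + norm (fst z)) * 1" using w1 d1 by (intro mult_mono) auto
        then show "norm (?w (fst z) * ?d (fst z)) \<le> norm (1 + norm (fst z))"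
          using d1(1)[of "fst z"] by (simp add: abs_mult)
      qed
    qed (use dmP measurable_compose[OF fm wm] in measurable)
    have "(\<integral>z. (1 + norm (fst z)) * ?d (fst z) \<partial>P) \<le> (\<integral>z. 2 * (?w (fst z) * ?d (fst z)) \<partial>P)"
    proof (rule integral_mono[OF i1 integrable_mult_right[OF i2]])
      fix z show "(1 + norm (fst z)) * ?d (fst z) \<le> 2 * (?w (fst z) * ?d (fst z))"
        using mult_right_mono[OF w2 d1(1)] by (simp add: mult.assoc)
    qed
    also have "\<dots> = 2 * (\<integral>z. ?w (fst z) * ?d (fst z) \<partial>P)" by simp
    also have "(\<integral>z. ?w (fst z) * ?d (fst z) \<partial>P) = (\<integral>x. ?w x * ?d x \<partial>marg P)"
      unfolding marg_def by (rule integral_distr[OF fm, symmetric]) (use dm wm in measurable)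
    also have "(\<integral>x. ?w x * ?d x \<partial>marg P) = (\<integral>x. ?d x \<partial>density (marg P) (\<lambda>x. ennreal (?w x)))"
      using dm wm by (subst integral_density) (auto simp: marg_def)
    also have "\<dots> \<le> L * dist u v" using L u v by (cases u, cases v) fastforce
    also have "\<dots> \<le> \<bar>L\<bar> * dist u v" by (intro mult_right_mono) auto
    finally show "(\<integral>z. (1 + norm (fst z)) * \<bar>relu' (u \<bullet> lift1 (fst z)) - relu' (v \<bullet> lift1 (fst z))\<bar> \<partial>P)
        \<le> 2 * \<bar>L\<bar> * norm (u - v)"
      unfolding d_eq by (simp add: dist_norm)
  qed simp
  then show ?thesis by (rule that)
qed

text \<open>Conditional losses may have several minimizers, so two versions of the optimal predictor
  can differ on a set of positive measure. The identity of the limit network with the optimal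
  predictor is therefore expressed as being itself an integrable version, together with agreement
  with the given version wherever the minimizer is unique.\<close>

theorem corollary3p7:
  fixes l :: "real \<Rightarrow> real \<Rightarrow> real"
    and P :: "((real ^ 'd::finite) \<times> real) measure"
    and \<kappa> :: "real ^ 'd \<Rightarrow> real measure"
    and fstar :: "real ^ 'd \<Rightarrow> real"
    and \<pi>0 \<pi>_inf :: "'d param measure"
    and \<pi> :: "real \<Rightarrow> 'd param measure"
    and t :: "nat \<Rightarrow> real"
  assumes "loss_assm l"
    and "data_assm P"
    and "cond_distribution P \<kappa>"
    and "compat_assm l P \<kappa>"
    and "optimal_predictor l P \<kappa> fstar" and "integrable (marg P) fstar"
    and "\<pi>0 \<in> P2 (closure Theta)" and "omnidirectional \<pi>0"
    and "wasserstein_gradient_flow l P \<pi>0 \<pi>"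
    and "morse_sard l P \<pi>"
    and "filterlim t at_top sequentially"
    and "\<pi>_inf \<in> P2 (closure Theta)"
    and "(\<lambda>n. W2 (\<pi> (t n)) \<pi>_inf) \<longlonglongrightarrow> 0"
    and "card (Omega_lim l P \<pi>) = 1"
  shows "optimal_predictor l P \<kappa> (f_net \<pi>_inf) \<and> integrable (marg P) (f_net \<pi>_inf) \<and>
    (AE x in marg P. (\<exists>!\<alpha>. is_arg_min (cond_loss l \<kappa> x) (\<lambda>_. True) \<alpha>) \<longrightarrow> f_net \<pi>_inf x = fstar x) \<and>
    risk_minimizing l P \<pi>_inf"
proof -
  obtain C where C: "\<And>u y. \<bar>d1 l u y\<bar> \<le> C" using assms(1) unfolding loss_assm_def by blast
  obtain L where L: "relu_data P L" using data_assm_relu_data[OF assms(2)] .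
  have \<pi>0: "\<pi> 0 = \<pi>0" using assms(9) by (simp add: wasserstein_gradient_flow_def)
  interpret relu_data P L by (rule L)
  interpret gradient_flow P L l C \<pi>
    by unfold_locales (use assms(1,9) C \<pi>0 in auto)
  have zero: "pot (dens \<pi>_inf) \<theta> = 0" for \<theta>
    by (rule limit_potential_vanishes[OF _ assms(10,11,12,13,14)]) (simp add: \<pi>0 assms(8))
  have dense: "\<exists>S c. finite S \<and> S \<subseteq> closure Theta \<and> (\<integral>x. \<bar>k x - (\<Sum>\<theta>\<in>S. c \<theta> * phi \<theta> x)\<bar> \<partial>marg P) < e"
    if "integrable (marg P) k" "0 < e" for k e
    using assms(2) that unfolding data_assm_def by blast
  have orth: "(\<integral>z. dens \<pi>_inf z * k (fst z) \<partial>P) = 0" if "integrable (marg P) k" for k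
    by (rule density_orthogonal[OF dense bounded_density_dens[OF assms(12)] zero that])
  have l0: "integrable P (\<lambda>z. l 0 (snd z))"
    using assms(4) by (simp add: compat_assm_def case_prod_beta')
  note opt = critical_network_optimal[OF assms(3) l0 assms(12) orth]
  have "AE x in marg P. is_arg_min (cond_loss l \<kappa> x) (\<lambda>_. True) (f_net \<pi>_inf x)"
    "AE x in marg P. is_arg_min (cond_loss l \<kappa> x) (\<lambda>_. True) (fstar x)"
    using opt(1) assms(5) by (auto simp: optimal_predictor_def)
  then have "AE x in marg P. (\<exists>!\<alpha>. is_arg_min (cond_loss l \<kappa> x) (\<lambda>_. True) \<alpha>) \<longrightarrow> f_net \<pi>_inf x = fstar x"
    by eventually_elim blast
  then show ?thesis using opt f_net_integrable_marg[OF assms(12)] by blast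
qed

end
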